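(* Let $X$ and $Y$ be finite sets and $\Gamma:M_{XY}\to M_{XY}$ be a linear map. The following are equivalent: (i) $\Gamma$ is a QNS bicorrelation; (ii) there exists a state $s:\mathcal{T}_X\otimes_{\max}\mathcal{T}_Y\to\mathbb{C}$ such that $\Gamma=\Gamma_s$.
   Context: $M_X$ is the algebra of complex $X\times X$ matrices with matrix units $\epsilon_{x,x'}$; $M_{XY}=M_X\otimes M_Y$. Put $A=X$, $B=Y$. QNS correlations: a quantum channel (completely positive trace preserving map) $\Gamma:M_{XY}\to M_{AB}$ is a quantum no-signalling (QNS) correlation if $\mathrm{Tr}_A\Gamma(\rho_X\otimes\rho_Y)=0$ whenever $\mathrm{Tr}(\rho_X)=0$, and $\mathrm{Tr}_B\Gamma(\rho_X\otimes\rho_Y)=0$ whenever $\mathrm{Tr}(\rho_Y)=0$ ($\rho_X\in M_X,\rho_Y\in M_Y$). QNS bicorrelations: for $\Gamma:M_{XY}\to M_{XY}$, the dual $\Gamma^*$ is defined by $\langle\Gamma^*(\omega),\rho\rangle=\langle\omega,\Gamma(\rho)\rangle$, where $\langle\omega,\rho\rangle=\mathrm{Tr}(\omega\rho^{\rm t})$ and ${\rm t}$ is the transpose. A QNS correlation $\Gamma:M_{XY}\to M_{XY}$ is a QNS bicorrelation if $\Gamma(I_{XY})=I_{XY}$ and $\Gamma^*$ is a QNS correlation. Definition of $\mathcal{T}_X$: a bi-isometry is a block operator matrix $V=(V_{a,x})_{a,x\in X}$, $V_{a,x}\in\mathcal{B}(H,K)$, with $\sum_a V_{a,x}^*V_{a,x'}=\delta_{x,x'}I$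 and $\sum_x V_{a,x}^*V_{a',x}=\delta_{a,a'}I$. Let $(v_{a,x})$ be the universal bi-isometry (direct sum of representatives of all unitary equivalence classes of bi-isometries on Hilbert spaces of dimension bounded by a fixed sufficiently large infinite cardinal), let $\mathcal{C}_X$ be the unital C*-algebra generated by $e_{x,x',a,a'}:=v_{a,x}^*v_{a',x'}$, and $\mathcal{T}_X=\mathrm{span}\{e_{x,x',a,a'}:x,x',a,a'\in X\}$, an operator subsystem of $\mathcal{C}_X$. The corresponding generators of $\mathcal{T}_Y$ are denoted $f_{y,y',b,b'}$. $\mathcal{S}\otimes_{\max}\mathcal{T}$ is the maximal operator system tensor product: the algebraic tensor product with matrix cones the Archimedeanisation of the cones $\{\alpha(P\otimes Q)\alpha^*:P\in M_k(\mathcal{S})^+,Q\in M_m(\mathcal{T})^+,\alpha\in M_{n,km},\,k,m\in\mathbb{N}\}$. For a linear functional $s$ on $\mathcal{T}_X\otimes\mathcal{T}_Y$, $\Gamma_s:M_{XY}\to M_{XY}$ is the linear map $$\Gamma_s(\epsilon_{x,x'}\otimes\epsilon_{y,y'})=\sum_{a,a'\in X}\sum_{b,b'\in Y}s(e_{x,x',a,a'}\otimes f_{y,y',b,b'})\,\epsilon_{a,a'}\otimes\epsilon_{b,b'}.$$ *)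

theory Defs
  imports
    "HOL-Analysis.Analysis"
    "HOL-Library.Function_Algebras"
    "HOL-Library.Complex_Order"
begin

section \<open>Complex vector spaces\<close>

class complex_vector = ab_group_add +
  fixes scaleC :: "complex \<Rightarrow> 'a \<Rightarrow> 'a"  (infixr \<open>*\<^sub>C\<close> 75)
  assumes scaleC_add_right: "c *\<^sub>C (x + y) = c *\<^sub>C x + c *\<^sub>C y"
    and scaleC_add_left: "(c + d) *\<^sub>C x = c *\<^sub>C x + d *\<^sub>C x"
    and scaleC_scaleC: "c *\<^sub>C d *\<^sub>C x = (c * d) *\<^sub>C x"
    and scaleC_one: "1 *\<^sub>C x = x"

global_interpretation complex_vector:
  vector_space "scaleC :: complex \<Rightarrow> 'a \<Rightarrow> 'a::complex_vector"
  by unfold_locales (simp_all add: scaleC_add_right scaleC_add_left scaleC_scaleC scaleC_one)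

instantiation complex :: complex_vector
begin
definition scaleC_complex :: "complex \<Rightarrow> complex \<Rightarrow> complex"
  where "scaleC_complex c z = c * z"
instance
  by intro_classes (simp_all add: scaleC_complex_def algebra_simps)
end

instantiation "fun" :: (type, complex_vector) complex_vector
begin
definition scaleC_fun :: "complex \<Rightarrow> ('a \<Rightarrow> 'b) \<Rightarrow> 'a \<Rightarrow> 'b"
  where "scaleC_fun c f = (\<lambda>x. c *\<^sub>C f x)"
instance
  by intro_classes
    (simp_all add: scaleC_fun_def fun_eq_iff scaleC_add_right scaleC_add_left scaleC_scaleC scaleC_one)
end

instantiation vec :: (complex_vector, finite) complex_vector
begin
definition scaleC_vec :: "complex \<Rightarrow> 'a ^ 'b \<Rightarrow> 'a ^ 'b"
  where "scaleC_vec c v = (\<chi> i. c *\<^sub>C v $ i)"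
instance
  by intro_classes
    (simp_all add: scaleC_vec_def vec_eq_iff scaleC_add_right scaleC_add_left scaleC_scaleC scaleC_one)
end

abbreviation clinear :: "('a::complex_vector \<Rightarrow> 'b::complex_vector) \<Rightarrow> bool"
  where "clinear \<equiv> Vector_Spaces.linear scaleC scaleC"


section \<open>QNS correlations and bicorrelations\<close>

type_synonym 'x cmat = "complex ^ 'x ^ 'x"

definition matrix_unit :: "'x::finite \<Rightarrow> 'x \<Rightarrow> 'x cmat"
  where "matrix_unit x x' = (\<chi> i j. if i = x \<and> j = x' then 1 else 0)"

definition kron :: "'x::finite cmat \<Rightarrow> 'y::finite cmat \<Rightarrow> ('x \<times> 'y) cmat"
  where "kron \<rho> \<sigma> = (\<chi> p q. \<rho> $ fst p $ fst q * \<sigma> $ snd p $ snd q)"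

definition ptrace_fst :: "('a::finite \<times> 'b::finite) cmat \<Rightarrow> 'b cmat"
  where "ptrace_fst \<omega> = (\<chi> b b'. \<Sum>a\<in>UNIV. \<omega> $ (a, b) $ (a, b'))"

definition ptrace_snd :: "('a::finite \<times> 'b::finite) cmat \<Rightarrow> 'a cmat"
  where "ptrace_snd \<omega> = (\<chi> a a'. \<Sum>b\<in>UNIV. \<omega> $ (a, b) $ (a', b))"

text \<open>Elements of \<open>M\<^sub>n(M\<^sub>X)\<close> are functions of two natural numbers, of which only
  the values at \<open>i, j < n\<close> matter. Inequalities between complex numbers are those of
  \<^theory>\<open>HOL-Library.Complex_Order\<close>: \<open>0 \<le> z\<close> says that \<open>z\<close> is real and nonnegative.\<close>

definition psd_block :: "nat \<Rightarrow> (nat \<Rightarrow> nat \<Rightarrow> 'x::finite cmat) \<Rightarrow> bool"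
  where "psd_block n \<rho> \<longleftrightarrow>
    (\<forall>\<xi> :: nat \<Rightarrow> complex ^ 'x.
       0 \<le> (\<Sum>i<n. \<Sum>j<n. \<Sum>p\<in>UNIV. \<Sum>q\<in>UNIV. cnj (\<xi> i $ p) * \<rho> i j $ p $ q * \<xi> j $ q))"

definition completely_positive :: "('x::finite cmat \<Rightarrow> 'a::finite cmat) \<Rightarrow> bool"
  where "completely_positive \<Gamma> \<longleftrightarrow>
    (\<forall>n \<rho>. psd_block n \<rho> \<longrightarrow> psd_block n (\<lambda>i j. \<Gamma> (\<rho> i j)))"

definition quantum_channel :: "('x::finite cmat \<Rightarrow> 'a::finite cmat) \<Rightarrow> bool"
  where "quantum_channel \<Gamma> \<longleftrightarrow>
    clinear \<Gamma> \<and> completely_positive \<Gamma> \<and> (\<forall>\<rho>. trace (\<Gamma> \<rho>) = trace \<rho>)"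

definition QNS_correlation ::
    "(('x::finite \<times> 'y::finite) cmat \<Rightarrow> ('a::finite \<times> 'b::finite) cmat) \<Rightarrow> bool"
  where "QNS_correlation \<Gamma> \<longleftrightarrow>
    quantum_channel \<Gamma> \<and>
    (\<forall>\<rho>\<^sub>X \<rho>\<^sub>Y. trace \<rho>\<^sub>X = 0 \<longrightarrow> ptrace_fst (\<Gamma> (kron \<rho>\<^sub>X \<rho>\<^sub>Y)) = 0) \<and>
    (\<forall>\<rho>\<^sub>X \<rho>\<^sub>Y. trace \<rho>\<^sub>Y = 0 \<longrightarrow> ptrace_snd (\<Gamma> (kron \<rho>\<^sub>X \<rho>\<^sub>Y)) = 0)"

definition mat_pairing :: "'x::finite cmat \<Rightarrow> 'x cmat \<Rightarrow> complex"
  where "mat_pairing \<omega> \<rho> = trace (\<omega> ** transpose \<rho>)"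

definition dual_map :: "('x::finite cmat \<Rightarrow> 'a::finite cmat) \<Rightarrow> 'a cmat \<Rightarrow> 'x cmat"
  where "dual_map \<Gamma> =
    (THE \<Delta>. \<forall>\<omega> \<rho>. mat_pairing (\<Delta> \<omega>) \<rho> = mat_pairing \<omega> (\<Gamma> \<rho>))"

definition QNS_bicorrelation ::
    "(('x::finite \<times> 'y::finite) cmat \<Rightarrow> ('x \<times> 'y) cmat) \<Rightarrow> bool"
  where "QNS_bicorrelation \<Gamma> \<longleftrightarrow>
    QNS_correlation \<Gamma> \<and> \<Gamma> (mat 1) = mat 1 \<and> QNS_correlation (dual_map \<Gamma>)"


section \<open>Hilbert spaces and bounded operators\<close>

text \<open>Up to unitary isomorphism, the Hilbert spaces of dimension at most the cardinality of a
  type \<open>'k\<close> are the spaces \<open>\<ell>\<^sup>2(J)\<close> with \<open>J\<close> a set of elements of \<open>'k\<close>; \<open>\<ell>\<^sup>2(J)\<close> is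
  realised by functions on the whole type that vanish off \<open>J\<close>. The inner product is
  conjugate-linear in its first argument.\<close>

definition ell2 :: "'i set \<Rightarrow> ('i \<Rightarrow> complex) set"
  where "ell2 J = {\<psi>. (\<forall>i. i \<notin> J \<longrightarrow> \<psi> i = 0) \<and> (\<lambda>i. (cmod (\<psi> i))\<^sup>2) summable_on UNIV}"

definition ell2_inner :: "('i \<Rightarrow> complex) \<Rightarrow> ('i \<Rightarrow> complex) \<Rightarrow> complex"
  where "ell2_inner \<phi> \<psi> = (\<Sum>\<^sub>\<infinity>i. cnj (\<phi> i) * \<psi> i)"

definition ell2_norm :: "('i \<Rightarrow> complex) \<Rightarrow> real"
  where "ell2_norm \<psi> = sqrt (\<Sum>\<^sub>\<infinity>i. (cmod (\<psi> i))\<^sup>2)"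

type_synonym ('j, 'l) op = "('j \<Rightarrow> complex) \<Rightarrow> ('l \<Rightarrow> complex)"

text \<open>The space \<open>\<B>(\<ell>\<^sup>2(J), \<ell>\<^sup>2(L))\<close>. Operators take the value \<open>0\<close> outside \<open>\<ell>\<^sup>2(J)\<close>, so that
  equality of operators is equality of functions.\<close>

definition bounded_ops :: "'j set \<Rightarrow> 'l set \<Rightarrow> ('j, 'l) op set"
  where "bounded_ops J L = {T.
    (\<forall>\<psi>. \<psi> \<notin> ell2 J \<longrightarrow> T \<psi> = 0) \<and>
    (\<forall>\<psi>\<in>ell2 J. T \<psi> \<in> ell2 L) \<and>
    (\<forall>\<psi>\<in>ell2 J. \<forall>\<phi>\<in>ell2 J. T (\<psi> + \<phi>) = T \<psi> + T \<phi>) \<and>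
    (\<forall>c. \<forall>\<psi>\<in>ell2 J. T (c *\<^sub>C \<psi>) = c *\<^sub>C T \<psi>) \<and>
    (\<exists>C. \<forall>\<psi>\<in>ell2 J. ell2_norm (T \<psi>) \<le> C * ell2_norm \<psi>)}"

definition id_op :: "'j set \<Rightarrow> ('j, 'j) op"
  where "id_op J = (\<lambda>\<psi>. if \<psi> \<in> ell2 J then \<psi> else 0)"

definition adj :: "'j set \<Rightarrow> 'l set \<Rightarrow> ('j, 'l) op \<Rightarrow> ('l, 'j) op"
  where "adj J L T = (THE S. S \<in> bounded_ops L J \<and>
    (\<forall>\<phi>\<in>ell2 L. \<forall>\<psi>\<in>ell2 J. ell2_inner (S \<phi>) \<psi> = ell2_inner \<phi> (T \<psi>)))"

definition unitary_op :: "'j set \<Rightarrow> 'l set \<Rightarrow> ('j, 'l) op \<Rightarrow> bool"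
  where "unitary_op J L U \<longleftrightarrow> U \<in> bounded_ops J L \<and>
    adj J L U \<circ> U = id_op J \<and> U \<circ> adj J L U = id_op L"

text \<open>The Hilbert space direct sum of the \<open>\<ell>\<^sup>2(J p)\<close>, \<open>p \<in> I\<close>, is \<open>\<ell>\<^sup>2\<close> of the disjoint
  union \<open>Sigma I J\<close>.\<close>

definition dsum_op :: "'p set \<Rightarrow> ('p \<Rightarrow> 'j set) \<Rightarrow> ('p \<Rightarrow> ('j, 'l) op) \<Rightarrow> ('p \<times> 'j, 'p \<times> 'l) op"
  where "dsum_op I J T = (\<lambda>\<psi>.
    if \<psi> \<in> ell2 (Sigma I J)
    then (\<lambda>(p, l). if p \<in> I then T p (\<lambda>j. \<psi> (p, j)) l else 0)
    else 0)"

definition unital_cstar_subalgebra :: "'j set \<Rightarrow> ('j, 'j) op set \<Rightarrow> bool"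
  where "unital_cstar_subalgebra J A \<longleftrightarrow>
    A \<subseteq> bounded_ops J J \<and> id_op J \<in> A \<and>
    (\<forall>S\<in>A. \<forall>T\<in>A. S + T \<in> A \<and> S \<circ> T \<in> A) \<and>
    (\<forall>c. \<forall>T\<in>A. c *\<^sub>C T \<in> A) \<and>
    (\<forall>T\<in>A. adj J J T \<in> A) \<and>
    (\<forall>T\<in>bounded_ops J J.
       (\<forall>\<epsilon>>0. \<exists>S\<in>A. \<forall>\<psi>\<in>ell2 J. ell2_norm (T \<psi> - S \<psi>) \<le> \<epsilon> * ell2_norm \<psi>) \<longrightarrow> T \<in> A)"

definition cstar_generated :: "'j set \<Rightarrow> ('j, 'j) op set \<Rightarrow> ('j, 'j) op set"
  where "cstar_generated J G = \<Inter>{A. unital_cstar_subalgebra J A \<and> G \<subseteq> A}"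


section \<open>Operator systems and the maximal tensor product\<close>

text \<open>\<open>os_pos S n\<close> is the cone \<open>M\<^sub>n(S)\<^sup>+\<close>; an \<open>n \<times> n\<close> matrix over \<open>S\<close> is a function of two
  natural numbers, of which only the values at \<open>i, j < n\<close> matter.\<close>

record 'a operator_system =
  os_space :: "'a set"
  os_unit :: 'a
  os_pos :: "nat \<Rightarrow> (nat \<Rightarrow> nat \<Rightarrow> 'a) \<Rightarrow> bool"

definition concrete_system :: "'j set \<Rightarrow> ('j, 'j) op set \<Rightarrow> ('j, 'j) op operator_system"
  where "concrete_system J S = \<lparr>
    os_space = S,
    os_unit = id_op J,
    os_pos = (\<lambda>n P. (\<forall>i<n. \<forall>j<n. P i j \<in> S) \<and>
      (\<forall>\<xi>. (\<forall>i<n. \<xi> i \<in> ell2 J) \<longrightarrow> 0 \<le> (\<Sum>i<n. \<Sum>j<n. ell2_inner (\<xi> i) (P i j (\<xi> j))))) \<rparr>"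

definition subsystem :: "'a operator_system \<Rightarrow> 'a set \<Rightarrow> 'a operator_system"
  where "subsystem \<C> S = \<lparr>
    os_space = S,
    os_unit = os_unit \<C>,
    os_pos = (\<lambda>n P. (\<forall>i<n. \<forall>j<n. P i j \<in> S) \<and> os_pos \<C> n P) \<rparr>"

text \<open>The elementary tensor \<open>u \<otimes> w\<close> is the bilinear form \<open>(f, g) \<mapsto> f u * g w\<close> on pairs of
  linear functionals. As linear functionals separate linearly independent vectors (and extend
  from subspaces), the span of the elementary tensors is the algebraic tensor product.\<close>

type_synonym ('a, 'b) tensor = "('a \<Rightarrow> complex) \<times> ('b \<Rightarrow> complex) \<Rightarrow> complex"

definition tens :: "'a::complex_vector \<Rightarrow> 'b::complex_vector \<Rightarrow> ('a, 'b) tensor"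
  where "tens u w = (\<lambda>(f, g). if clinear f \<and> clinear g then f u * g w else 0)"

definition alg_tensor :: "'a::complex_vector set \<Rightarrow> 'b::complex_vector set \<Rightarrow> ('a, 'b) tensor set"
  where "alg_tensor S T = complex_vector.span {tens u w | u w. u \<in> S \<and> w \<in> T}"

text \<open>The cones \<open>{\<alpha> (P \<otimes> Q) \<alpha>\<^sup>*}\<close>; the columns of the \<open>n \<times> km\<close> matrix \<open>\<alpha>\<close> are indexed by
  pairs.\<close>

definition max_precone ::
    "'a::complex_vector operator_system \<Rightarrow> 'b::complex_vector operator_system \<Rightarrow>
      nat \<Rightarrow> (nat \<Rightarrow> nat \<Rightarrow> ('a, 'b) tensor) \<Rightarrow> bool"
  where "max_precone \<S> \<T> n U \<longleftrightarrow>
    (\<exists>k m P Q (\<alpha> :: nat \<Rightarrow> nat \<times> nat \<Rightarrow> complex). os_pos \<S> k P \<and> os_pos \<T> m Q \<and>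
      (\<forall>i<n. \<forall>j<n. U i j =
        (\<Sum>(p, q)\<in>{..<k} \<times> {..<m}. \<Sum>(p', q')\<in>{..<k} \<times> {..<m}.
          (\<alpha> i (p, q) * cnj (\<alpha> j (p', q'))) *\<^sub>C tens (P p p') (Q q q'))))"

definition max_tensor ::
    "'a::complex_vector operator_system \<Rightarrow> 'b::complex_vector operator_system \<Rightarrow>
      ('a, 'b) tensor operator_system"
  where "max_tensor \<S> \<T> = \<lparr>
    os_space = alg_tensor (os_space \<S>) (os_space \<T>),
    os_unit = tens (os_unit \<S>) (os_unit \<T>),
    os_pos = (\<lambda>n U.
      (\<forall>i<n. \<forall>j<n. U i j \<in> alg_tensor (os_space \<S>) (os_space \<T>)) \<and>
      (\<forall>r::real. r > 0 \<longrightarrow> max_precone \<S> \<T> n (\<lambda>i j.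
         (if i = j then complex_of_real r *\<^sub>C tens (os_unit \<S>) (os_unit \<T>) else 0) + U i j))) \<rparr>"

text \<open>Only the values of a functional on the underlying space of the operator system matter.\<close>

definition linear_functional_on :: "'a::complex_vector set \<Rightarrow> ('a \<Rightarrow> complex) \<Rightarrow> bool"
  where "linear_functional_on S s \<longleftrightarrow>
    (\<forall>u\<in>S. \<forall>w\<in>S. s (u + w) = s u + s w) \<and> (\<forall>c. \<forall>u\<in>S. s (c *\<^sub>C u) = c * s u)"

definition state :: "'a::complex_vector operator_system \<Rightarrow> ('a \<Rightarrow> complex) \<Rightarrow> bool"
  where "state \<S> s \<longleftrightarrow>
    linear_functional_on (os_space \<S>) s \<and>
    (\<forall>u. os_pos \<S> 1 (\<lambda>_ _. u) \<longrightarrow> 0 \<le> s u) \<and>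
    s (os_unit \<S>) = 1"


section \<open>The universal bi-isometry and the operator system \<open>\<T>\<^sub>X\<close>\<close>

definition bi_isometry :: "'j set \<Rightarrow> 'l set \<Rightarrow> ('x::finite \<Rightarrow> 'x \<Rightarrow> ('j, 'l) op) \<Rightarrow> bool"
  where "bi_isometry J L V \<longleftrightarrow>
    (\<forall>a x. V a x \<in> bounded_ops J L) \<and>
    (\<forall>x x'. (\<Sum>a\<in>UNIV. adj J L (V a x) \<circ> V a x') = (if x = x' then id_op J else 0)) \<and>
    (\<forall>a a'. (\<Sum>x\<in>UNIV. adj J L (V a x) \<circ> V a' x) = (if a = a' then id_op J else 0))"

text \<open>A triple \<open>(J, L, V)\<close> consists of operators \<open>V a x\<close> from \<open>\<ell>\<^sup>2(J)\<close> to \<open>\<ell>\<^sup>2(L)\<close>, where the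
  type \<open>'k\<close> stands for the cardinal that bounds the dimensions.\<close>

type_synonym ('x, 'k) bi_iso = "'k set \<times> 'k set \<times> ('x \<Rightarrow> 'x \<Rightarrow> ('k, 'k) op)"

definition bi_isometries :: "('x::finite, 'k) bi_iso set"
  where "bi_isometries = {(J, L, V). bi_isometry J L V}"

definition unitarily_equivalent :: "(('x::finite, 'k) bi_iso \<times> ('x, 'k) bi_iso) set"
  where "unitarily_equivalent = {((J, L, V), (J', L', V')).
    bi_isometry J L V \<and> bi_isometry J' L' V' \<and>
    (\<exists>U W. unitary_op J J' U \<and> unitary_op L L' W \<and> (\<forall>a x. V' a x \<circ> U = W \<circ> V a x))}"

definition bi_iso_reps :: "('x::finite, 'k) bi_iso set"
  where "bi_iso_reps = (\<lambda>c. SOME p. p \<in> c) ` (bi_isometries // unitarily_equivalent)"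

text \<open>The universal bi-isometry acts from \<open>\<ell>\<^sup>2(univ_dom)\<close> to \<open>\<ell>\<^sup>2(univ_cod)\<close>.\<close>

definition univ_dom :: "(('x::finite, 'k) bi_iso \<times> 'k) set"
  where "univ_dom = Sigma bi_iso_reps (\<lambda>(J, L, V). J)"

definition univ_cod :: "(('x::finite, 'k) bi_iso \<times> 'k) set"
  where "univ_cod = Sigma bi_iso_reps (\<lambda>(J, L, V). L)"

definition univ_bi_isometry ::
    "'x::finite \<Rightarrow> 'x \<Rightarrow> (('x, 'k) bi_iso \<times> 'k, ('x, 'k) bi_iso \<times> 'k) op"
  where "univ_bi_isometry a x = dsum_op bi_iso_reps (\<lambda>(J, L, V). J) (\<lambda>(J, L, V). V a x)"

type_synonym ('x, 'k) univ_op = "(('x, 'k) bi_iso \<times> 'k, ('x, 'k) bi_iso \<times> 'k) op"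

definition gen :: "'x::finite \<Rightarrow> 'x \<Rightarrow> 'x \<Rightarrow> 'x \<Rightarrow> ('x, 'k) univ_op"
  where "gen x x' a a' =
    adj univ_dom univ_cod (univ_bi_isometry a x) \<circ> univ_bi_isometry a' x'"

definition C_alg :: "('x::finite, 'k) univ_op set"
  where "C_alg = cstar_generated univ_dom {gen x x' a a' | x x' a a'. True}"

definition T_system :: "('x::finite, 'k) univ_op operator_system"
  where "T_system = subsystem (concrete_system univ_dom C_alg)
    (complex_vector.span {gen x x' a a' | x x' a a'. True})"


section \<open>The map \<open>\<Gamma>\<^sub>s\<close>\<close>

definition Gamma_of ::
    "((('x::finite, 'k) univ_op, ('y::finite, 'k) univ_op) tensor \<Rightarrow> complex) \<Rightarrow>
      ('x \<times> 'y) cmat \<Rightarrow> ('x \<times> 'y) cmat"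
  where "Gamma_of s \<rho> =
    (\<Sum>x\<in>UNIV. \<Sum>x'\<in>UNIV. \<Sum>y\<in>UNIV. \<Sum>y'\<in>UNIV. \<rho> $ (x, y) $ (x', y') *\<^sub>C
      (\<Sum>a\<in>UNIV. \<Sum>a'\<in>UNIV. \<Sum>b\<in>UNIV. \<Sum>b'\<in>UNIV.
         s (tens (gen x x' a a') (gen y y' b b')) *\<^sub>C
           kron (matrix_unit a a') (matrix_unit b b')))"

end

theory Submission
  imports Defs
begin

text \<open>A linear map \<open>\<Gamma>\<close> on \<open>M\<^sub>X\<^sub>Y\<close> is determined by its Choi matrix. Group the indices of the latter by party,
\<open>z = (x, a)\<close> and \<open>w = (y, b)\<close>, and write \<open>R z z' w w'\<close> for its entries. Then \<open>\<Gamma>\<close> is a QNS bicorrelation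
exactly when \<open>R\<close> is positive semidefinite in \<open>(z, w)\<close> and \<^emph>\<open>bistochastic\<close> in each party: summing the diagonal
over the output index \<open>a\<close> gives \<open>\<delta>\<^sub>x\<^sub>x\<^sub>' c\<close>, summing it over the input index \<open>x\<close> gives \<open>\<delta>\<^sub>a\<^sub>a\<^sub>' c\<close> with the same
\<open>c\<close>, and likewise for \<open>w\<close>; moreover the trace over the outputs is \<open>1\<close> at all diagonal inputs
(\<open>QNS_bicorrelation_choi_map\<close>). The first family of relations is no-signalling for \<open>\<Gamma>\<close>, the second is no-signalling for \<open>\<Gamma>\<^sup>*\<close>.

For \<open>\<Gamma> = \<Gamma>\<^sub>s\<close> the array is \<open>R z z' w w' = s (e\<^sub>z\<^sub>z\<^sub>' \<otimes> f\<^sub>w\<^sub>w\<^sub>')\<close>. The theorem therefore says that the arrays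
with these properties are the arrays of values of the states on the generators.

One direction is immediate: \<open>(e\<^sub>z\<^sub>z\<^sub>')\<close> is a positive matrix \<open>V\<^sup>* V\<close> with entries in \<open>\<T>\<^sub>X\<close>, it is bistochastic
with \<open>c = 1\<close>, and \<open>s\<close> transports both facts to \<open>R\<close> (\<open>state_matrix_bicorrelation\<close>).

The other direction rests on the universality of the generators, \<open>T_system_pos_pairing\<close>: if
\<open>P = \<Sum> \<mu>\<^sub>z\<^sub>z\<^sub>' e\<^sub>z\<^sub>z\<^sub>'\<close> is a positive matrix over \<open>\<T>\<^sub>X\<close>, with scalar matrices \<open>\<mu>\<^sub>z\<^sub>z\<^sub>'\<close>, then replacing \<open>e\<^sub>z\<^sub>z\<^sub>'\<close> by
the blocks of any positive semidefinite bistochastic block matrix \<open>D\<close> leaves it positive. The reason is that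
\<open>D = c\<^sup>1\<^sup>/\<^sup>2 V\<^sup>* V c\<^sup>1\<^sup>/\<^sup>2\<close> for a finite-dimensional bi-isometry \<open>V\<close>, which is up to unitary
equivalence a direct summand of the universal one.
For \<open>P = 0\<close> this shows that every linear relation between the generators also holds for \<open>R\<close>, so that
\<open>e\<^sub>z\<^sub>z\<^sub>' \<otimes> f\<^sub>w\<^sub>w\<^sub>' \<mapsto> R z z' w w'\<close> extends to a linear functional \<open>s\<close>. Applied first in the variables of \<open>Y\<close> and
then in those of \<open>X\<close>, it shows that \<open>s\<close> sends \<open>P \<otimes> Q\<close> to a positive matrix, so \<open>s\<close> is positive on the cone that
defines the maximal tensor product (\<open>bicorrelation_state\<close>).\<close>

section \<open>Positive semidefinite sesquilinear forms\<close>

lemma sum_fun_apply: "(\<Sum>a\<in>A. f a) x = (\<Sum>a\<in>A. f a x)"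
  by (induction A rule: infinite_finite_induct) auto

lemma scaleC_complex [simp]: "(c::complex) *\<^sub>C z = c * z"
  by (simp add: scaleC_complex_def)

lemma scaleC_fun_apply [simp]: "(c *\<^sub>C f) x = c *\<^sub>C f x"
  by (simp add: scaleC_fun_def)

lemma cnj_mult_self: "cnj z * z = complex_of_real ((cmod z)\<^sup>2)"
  by (metis complex_norm_square mult.commute)

lemma nonneg_complex_iff: "0 \<le> z \<longleftrightarrow> 0 \<le> Re z \<and> Im z = 0"
  by (auto simp: less_eq_complex_def)

lemma nonneg_cnj_mult_self: "0 \<le> cnj z * z"
  by (simp add: nonneg_complex_iff)

text \<open>Used to remove the \<open>r (1 \<otimes> 1)\<close> of the Archimedeanisation.\<close>

lemma nonneg_Archimedean:
  fixes z :: complex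
  assumes "\<And>r::real. r > 0 \<Longrightarrow> 0 \<le> complex_of_real r + z"
  shows "0 \<le> z"
  unfolding nonneg_complex_iff
proof
  show "Im z = 0"
    using assms[of 1] by (simp add: nonneg_complex_iff)
  show "0 \<le> Re z"
  proof (rule field_le_epsilon)
    fix e :: real assume "e > 0"
    with assms[of e] show "0 \<le> Re z + e" by (simp add: nonneg_complex_iff)
  qed
qed

text \<open>Two instances matter: the inner product of \<open>\<ell>\<^sup>2(J)\<close>, for which the form lives on a proper subset of the type,
and the possibly degenerate form of a positive semidefinite matrix. Hermitian symmetry is a consequence of
positivity, so it is not an axiom.\<close>

locale psd_form =
  fixes S :: "'v::complex_vector set" and B :: "'v \<Rightarrow> 'v \<Rightarrow> complex"
  assumes add_closed: "x \<in> S \<Longrightarrow> y \<in> S \<Longrightarrow> x + y \<in> S"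
    and scale_closed: "x \<in> S \<Longrightarrow> c *\<^sub>C x \<in> S"
    and zero_closed: "0 \<in> S"
    and add_right: "x \<in> S \<Longrightarrow> y \<in> S \<Longrightarrow> z \<in> S \<Longrightarrow> B x (y + z) = B x y + B x z"
    and add_left: "x \<in> S \<Longrightarrow> y \<in> S \<Longrightarrow> z \<in> S \<Longrightarrow> B (x + y) z = B x z + B y z"
    and scale_right: "x \<in> S \<Longrightarrow> y \<in> S \<Longrightarrow> B x (c *\<^sub>C y) = c * B x y"
    and scale_left: "x \<in> S \<Longrightarrow> y \<in> S \<Longrightarrow> B (c *\<^sub>C x) y = cnj c * B x y"
    and nonneg: "x \<in> S \<Longrightarrow> 0 \<le> B x x"
begin

text \<open>Polarisation: the values at \<open>x + y\<close> and \<open>x + \<i>y\<close> are real.\<close>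

lemma hermitian:
  assumes "x \<in> S" "y \<in> S"
  shows "B y x = cnj (B x y)"
proof -
  have iy: "\<i> *\<^sub>C y \<in> S" using assms scale_closed by blast
  have r: "Im (B x x) = 0" "Im (B y y) = 0" "Im (B (x + y) (x + y)) = 0"
    "Im (B (x + \<i> *\<^sub>C y) (x + \<i> *\<^sub>C y)) = 0"
    using nonneg assms iy add_closed by (auto simp: nonneg_complex_iff)
  have "B (x + y) (x + y) = B x x + B x y + (B y x + B y y)"
    using assms add_closed by (simp add: add_left add_right)
  moreover have "B (x + \<i> *\<^sub>C y) (x + \<i> *\<^sub>C y) = B x x + \<i> * B x y + (- \<i> * B y x + B y y)"
    using assms iy add_closed
    by (simp add: add_left add_right scale_left scale_right scale_closed algebra_simps)
  ultimately show ?thesis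
    using r by (simp add: complex_eq_iff)
qed

lemma real_diag: "x \<in> S \<Longrightarrow> B x x = complex_of_real (Re (B x x))"
  using nonneg[of x] by (simp add: nonneg_complex_iff complex_eq_iff)

lemma sum_closed: "(\<And>k. k \<in> K \<Longrightarrow> f k \<in> S) \<Longrightarrow> (\<Sum>k\<in>K. f k) \<in> S"
  by (induction K rule: infinite_finite_induct) (auto simp: zero_closed add_closed)

lemma zero_right: "x \<in> S \<Longrightarrow> B x 0 = 0"
  using add_right[of x 0 0] zero_closed by simp

lemma sum_right:
  assumes "x \<in> S" "\<And>k. k \<in> K \<Longrightarrow> f k \<in> S"
  shows "B x (\<Sum>k\<in>K. c k *\<^sub>C f k) = (\<Sum>k\<in>K. c k * B x (f k))"
  using assms(2)
  by (induction K rule: infinite_finite_induct)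
    (auto simp: zero_right assms(1) add_right scale_right scale_closed sum_closed)

lemma sum_left:
  assumes "y \<in> S" "\<And>k. k \<in> K \<Longrightarrow> f k \<in> S"
  shows "B (\<Sum>k\<in>K. c k *\<^sub>C f k) y = (\<Sum>k\<in>K. cnj (c k) * B (f k) y)"
proof -
  have "(\<Sum>k\<in>K. c k *\<^sub>C f k) \<in> S"
    using assms(2) by (intro sum_closed scale_closed)
  then have "B (\<Sum>k\<in>K. c k *\<^sub>C f k) y = cnj (B y (\<Sum>k\<in>K. c k *\<^sub>C f k))"
    by (rule hermitian[OF assms(1)])
  also have "\<dots> = cnj (\<Sum>k\<in>K. c k * B y (f k))"
    by (subst sum_right[OF assms]) simp_all
  also have "\<dots> = (\<Sum>k\<in>K. cnj (c k) * B (f k) y)"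
    using hermitian[OF assms(1) assms(2)] by simp
  finally show ?thesis .
qed

text \<open>Positivity of \<open>B\<close> at \<open>x - t \<langle>y, x\<rangle> y\<close> is a quadratic inequality in the real number \<open>t\<close>.\<close>

lemma Cauchy_Schwarz:
  assumes "x \<in> S" "y \<in> S"
  shows "(cmod (B x y))\<^sup>2 \<le> Re (B x x) * Re (B y y)"
proof -
  define b where "b = (cmod (B x y))\<^sup>2"
  have *: "0 \<le> Re (B x x) - 2 * t * b + t\<^sup>2 * b * Re (B y y)" for t :: real
  proof -
    \<comment> \<open>The phase makes both mixed terms real.\<close>
    define c where "c = complex_of_real (- t) * cnj (B x y)"
    have cy: "c *\<^sub>C y \<in> S" using assms scale_closed by blast
    have "B (x + c *\<^sub>C y) (x + c *\<^sub>C y) = B x x + c * B x y + (cnj c * B y x + cnj c * (c * B y y))"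
      using assms cy add_closed
      by (simp add: add_left add_right scale_left scale_right scale_closed algebra_simps)
    also have "c * B x y = - complex_of_real (t * b)"
      using cnj_mult_self[of "B x y"] by (simp add: c_def b_def algebra_simps)
    also have "cnj c * B y x = - complex_of_real (t * b)"
      using cnj_mult_self[of "B x y"] hermitian[OF assms] by (simp add: c_def b_def algebra_simps)
    also have "cnj c * (c * B y y) = complex_of_real (t\<^sup>2 * b) * B y y"
      using cnj_mult_self[of "B x y"] by (simp add: c_def b_def algebra_simps power2_eq_square)
    finally have e: "B (x + c *\<^sub>C y) (x + c *\<^sub>C y) = B x x + - complex_of_real (t * b)
        + (- complex_of_real (t * b) + complex_of_real (t\<^sup>2 * b) * B y y)" .
    have "Re (B (x + c *\<^sub>C y) (x + c *\<^sub>C y)) = Re (B x x) - 2 * t * b + t\<^sup>2 * b * Re (B y y)"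
      unfolding e by simp
    moreover have "0 \<le> Re (B (x + c *\<^sub>C y) (x + c *\<^sub>C y))"
      using nonneg add_closed cy assms(1) by (auto simp: nonneg_complex_iff)
    ultimately show ?thesis by simp
  qed
  have nn: "0 \<le> Re (B x x)" "0 \<le> Re (B y y)" "0 \<le> b"
    using nonneg assms by (auto simp: nonneg_complex_iff b_def)
  show ?thesis
  proof (cases "Re (B y y) = 0")
    case True
    have "b = 0"
    proof (rule ccontr)
      assume "b \<noteq> 0"
      then show False
        using *[of "(Re (B x x) + 1) / (2 * b)"] True nn by (simp add: field_simps)
    qed
    then show ?thesis using nn by (simp add: b_def)
  next
    case False
    then have pos: "Re (B y y) > 0" using nn by simp
    have "0 \<le> Re (B x x) - b / Re (B y y)"
      using *[of "1 / Re (B y y)"] pos by (simp add: field_simps power2_eq_square)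
    then show ?thesis using pos by (simp add: b_def field_simps)
  qed
qed

lemma null_right:
  assumes "x \<in> S" "y \<in> S" "B y y = 0"
  shows "B x y = 0"
  using Cauchy_Schwarz[OF assms(1,2)] assms(3) by simp

text \<open>Gram--Schmidt: a null remainder contributes no new vector, and by Cauchy--Schwarz it is
  orthogonal to everything.\<close>

lemma gram_schmidt:
  assumes "finite F" "F \<subseteq> S"
  shows "\<exists>(r::nat) b. (\<forall>i<r. b i \<in> S) \<and> (\<forall>i<r. \<forall>j<r. B (b i) (b j) = (if i = j then 1 else 0)) \<and>
    (\<forall>v\<in>F. \<forall>y\<in>S. B y v = (\<Sum>k<r. B y (b k) * B (b k) v))"
  using assms
proof (induction F rule: finite_induct)
  case empty
  show ?case by (intro exI[of _ 0]) auto
next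
  case (insert w F)
  then obtain r :: nat and b where
    IH: "\<forall>i<r. b i \<in> S" "\<forall>i<r. \<forall>j<r. B (b i) (b j) = (if i = j then 1 else 0)"
      "\<forall>v\<in>F. \<forall>y\<in>S. B y v = (\<Sum>k<r. B y (b k) * B (b k) v)"
    by blast
  have b: "\<And>i. i < r \<Longrightarrow> b i \<in> S"
      "\<And>i j. i < r \<Longrightarrow> j < r \<Longrightarrow> B (b i) (b j) = (if i = j then 1 else 0)"
      "\<And>v y. v \<in> F \<Longrightarrow> y \<in> S \<Longrightarrow> B y v = (\<Sum>k<r. B y (b k) * B (b k) v)"
    using IH by blast+
  have w: "w \<in> S" using insert.prems by simp
  define c where "c k = B (b k) w" for k
  define p where "p = (\<Sum>k<r. c k *\<^sub>C b k)"
  define g where "g = w + (- 1) *\<^sub>C p"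
  have p: "p \<in> S" unfolding p_def by (intro sum_closed scale_closed) (use b in auto)
  have g: "g \<in> S" unfolding g_def by (intro add_closed scale_closed w p)
  have By: "B y g = B y w - (\<Sum>k<r. B y (b k) * B (b k) w)" if "y \<in> S" for y
  proof -
    have "B y g = B y w - B y p"
      unfolding g_def
      using add_right[OF that w scale_closed[OF p], of "- 1"] scale_right[OF that p, of "- 1"] by simp
    also have "B y p = (\<Sum>k<r. c k * B y (b k))"
      unfolding p_def by (intro sum_right) (use that b in auto)
    finally show ?thesis by (simp add: c_def mult.commute)
  qed
  have orth: "B (b i) g = 0" if "i < r" for i
  proof -
    have "(\<Sum>k<r. B (b i) (b k) * B (b k) w) = (\<Sum>k<r. if i = k then B (b k) w else 0)"
      by (rule sum.cong) (use b(2) that in auto)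
    then show ?thesis using By[OF b(1)[OF that]] that by simp
  qed
  have orth': "B g (b i) = 0" if "i < r" for i
    using hermitian[OF b(1)[OF that] g] orth[OF that] by simp
  show ?case
  proof (cases "B g g = 0")
    case True
    have "B y w = (\<Sum>k<r. B y (b k) * B (b k) w)" if "y \<in> S" for y
      using By[OF that] null_right[OF that g True] by simp
    then show ?thesis
      using IH by (intro exI[of _ r] exI[of _ b]) blast
  next
    case False
    define \<nu> where "\<nu> = sqrt (Re (B g g))"
    have Bgg: "B g g = complex_of_real (\<nu>\<^sup>2)"
      using real_diag[OF g] nonneg[OF g] by (simp add: \<nu>_def nonneg_complex_iff)
    have \<nu>0: "\<nu> \<noteq> 0" using Bgg False by auto
    define u where "u = complex_of_real (1 / \<nu>) *\<^sub>C g"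
    define b' where "b' = b(r := u)"
    have u: "u \<in> S" unfolding u_def using g scale_closed by blast
    have uu: "B u u = 1"
      unfolding u_def using g \<nu>0 Bgg
      by (simp add: scale_left scale_right scale_closed power2_eq_square)
    have ub: "B u (b i) = 0" "B (b i) u = 0" if "i < r" for i
      unfolding u_def using g b(1)[OF that] orth[OF that] orth'[OF that]
      by (simp_all add: scale_left scale_right)
    have gw: "B g w = B g g"
      using By[OF g] orth' by simp
    have yu: "B y u * B u w = B y g" if "y \<in> S" for y
      unfolding u_def using g that w gw \<nu>0 Bgg
      by (simp add: scale_left scale_right power2_eq_square)
    have uv: "B u v = 0" if "v \<in> F" for v
      using b(3)[OF that u] ub by simp
    have "B y v = (\<Sum>k<Suc r. B y (b' k) * B (b' k) v)" if "v \<in> insert w F" "y \<in> S" for v y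
    proof -
      have eq: "(\<Sum>k<Suc r. B y (b' k) * B (b' k) v) = (\<Sum>k<r. B y (b k) * B (b k) v) + B y u * B u v"
        by (simp add: b'_def)
      from that consider "v = w" | "v \<in> F" by blast
      then show ?thesis
      proof cases
        case 1 then show ?thesis unfolding eq using By[OF that(2)] yu[OF that(2)] by simp
      next
        case 2 then show ?thesis unfolding eq using b(3)[OF 2 that(2)] uv[OF 2] by simp
      qed
    qed
    moreover have "b' i \<in> S" if "i < Suc r" for i
      using that b(1) u by (auto simp: b'_def less_Suc_eq)
    moreover have "B (b' i) (b' j) = (if i = j then 1 else 0)" if "i < Suc r" "j < Suc r" for i j
      using that b(2) uu ub by (auto simp: b'_def less_Suc_eq)
    ultimately show ?thesis
      by (intro exI[of _ "Suc r"] exI[of _ b']) blast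
  qed
qed


end

definition form :: "'i set \<Rightarrow> ('i \<Rightarrow> 'i \<Rightarrow> complex) \<Rightarrow> ('i \<Rightarrow> complex) \<Rightarrow> ('i \<Rightarrow> complex) \<Rightarrow> complex"
  where "form I M \<xi> \<eta> = (\<Sum>i\<in>I. \<Sum>j\<in>I. cnj (\<xi> i) * M i j * \<eta> j)"

definition psd_on :: "'i set \<Rightarrow> ('i \<Rightarrow> 'i \<Rightarrow> complex) \<Rightarrow> bool"
  where "psd_on I M \<longleftrightarrow> (\<forall>\<xi>. 0 \<le> form I M \<xi> \<xi>)"

lemma psd_form_of_matrix:
  assumes "psd_on I M"
  shows "psd_form UNIV (form I M)"
proof
  show "0 \<le> form I M x x" for x using assms by (auto simp: psd_on_def)
qed (auto simp: form_def algebra_simps sum.distrib sum_distrib_left)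

text \<open>Parseval: on a finite index set the point masses span, so the Gram--Schmidt vectors of a
  positive semidefinite matrix resolve its form completely, null vectors included.\<close>

lemma psd_parseval:
  assumes "finite I" "psd_on I M"
  shows "\<exists>(r::nat) b. (\<forall>i<r. \<forall>j<r. form I M (b i) (b j) = (if i = j then 1 else 0)) \<and>
    (\<forall>\<xi> \<eta>. form I M \<xi> \<eta> = (\<Sum>k<r. form I M \<xi> (b k) * form I M (b k) \<eta>))"
proof -
  interpret psd_form UNIV "form I M" using assms(2) by (rule psd_form_of_matrix)
  define \<delta> :: "'a \<Rightarrow> 'a \<Rightarrow> complex" where "\<delta> i = (\<lambda>j. if j = i then 1 else 0)" for i
  obtain r :: nat and b where
    b: "\<forall>i<r. \<forall>j<r. form I M (b i) (b j) = (if i = j then 1 else 0)"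
      "\<forall>v\<in>\<delta> ` I. \<forall>y\<in>UNIV. form I M y v = (\<Sum>k<r. form I M y (b k) * form I M (b k) v)"
    using gram_schmidt[of "\<delta> ` I"] assms(1) by blast
  have dec: "form I M \<xi> \<eta> = (\<Sum>i\<in>I. \<eta> i * form I M \<xi> (\<delta> i))" for \<xi> \<eta>
  proof -
    have "form I M \<xi> \<eta> = form I M \<xi> (\<Sum>i\<in>I. \<eta> i *\<^sub>C \<delta> i)"
      unfolding form_def using assms(1)
      by (intro sum.cong refl) (simp add: \<delta>_def sum_fun_apply if_distrib cong: if_cong)
    then show ?thesis by (simp add: sum_right)
  qed
  have "form I M \<xi> \<eta> = (\<Sum>k<r. form I M \<xi> (b k) * form I M (b k) \<eta>)" for \<xi> \<eta>
  proof -
    have "form I M \<xi> \<eta> = (\<Sum>i\<in>I. \<eta> i * (\<Sum>k<r. form I M \<xi> (b k) * form I M (b k) (\<delta> i)))"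
      unfolding dec[of \<xi> \<eta>]
      by (intro sum.cong refl arg_cong2[where f = "(*)"]) (rule b(2)[rule_format], auto)
    also have "\<dots> = (\<Sum>k<r. form I M \<xi> (b k) * (\<Sum>i\<in>I. \<eta> i * form I M (b k) (\<delta> i)))"
      unfolding sum_distrib_left by (subst sum.swap) (simp add: algebra_simps)
    finally show ?thesis unfolding dec[of _ \<eta>, symmetric] .
  qed
  then show ?thesis using b(1) by blast
qed

lemma form_delta:
  assumes "finite I" "i \<in> I" "j \<in> I"
  shows "form I M (\<lambda>k. if k = i then 1 else 0) (\<lambda>k. if k = j then 1 else 0) = M i j"
proof -
  have "(\<Sum>l\<in>I. c * M k l * (if l = j then 1 else 0)) = (\<Sum>l\<in>I. if l = j then c * M k l else 0)" for c k
    by (intro sum.cong) auto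
  then have "form I M (\<lambda>k. if k = i then 1 else 0) (\<lambda>k. if k = j then 1 else 0)
      = (\<Sum>k\<in>I. cnj (if k = i then 1 else 0) * M k j)"
    unfolding form_def using assms by simp
  also have "\<dots> = (\<Sum>k\<in>I. if k = i then M k j else 0)"
    by (intro sum.cong) auto
  finally show ?thesis using assms by simp
qed

text \<open>The Gram factorisation of a positive semidefinite matrix.\<close>

lemma psd_gram:
  assumes "finite I" "psd_on I M"
  shows "\<exists>(t::nat) w. \<forall>i\<in>I. \<forall>j\<in>I. M i j = (\<Sum>k<t. cnj (w k i) * w k j)"
proof -
  interpret psd_form UNIV "form I M" using assms(2) by (rule psd_form_of_matrix)
  obtain r :: nat and b where
    "\<forall>i<r. \<forall>j<r. form I M (b i) (b j) = (if i = j then 1 else 0)"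
    and b: "\<forall>\<xi> \<eta>. form I M \<xi> \<eta> = (\<Sum>k<r. form I M \<xi> (b k) * form I M (b k) \<eta>)"
    using psd_parseval[OF assms] by (elim exE conjE) (rule that)
  define w where "w k i = form I M (b k) (\<lambda>l. if l = i then 1 else 0)" for k i
  have "M i j = (\<Sum>k<r. cnj (w k i) * w k j)" if "i \<in> I" "j \<in> I" for i j
  proof -
    have "M i j = form I M (\<lambda>k. if k = i then 1 else 0) (\<lambda>k. if k = j then 1 else 0)"
      by (rule form_delta[OF assms(1) that, symmetric])
    also have "\<dots> = (\<Sum>k<r. form I M (\<lambda>k. if k = i then 1 else 0) (b k) * w k j)"
      unfolding w_def by (rule b[rule_format])
    also have "\<dots> = (\<Sum>k<r. cnj (w k i) * w k j)"
      unfolding w_def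
      by (rule sum.cong[OF refl], rule arg_cong2[where f = "(*)"]) (rule hermitian[OF UNIV_I UNIV_I], rule refl)
    finally show ?thesis .
  qed
  then show ?thesis by (intro exI[of _ r] exI[of _ w] ballI)
qed

text \<open>Under the hypotheses all vectors are null, and by Cauchy--Schwarz a form all of whose vectors are null vanishes.\<close>

lemma psd_and_uminus_psd_imp_zero:
  assumes "finite I" "psd_on I M" "psd_on I (\<lambda>i j. - M i j)" "i \<in> I" "j \<in> I"
  shows "M i j = 0"
proof -
  interpret psd_form UNIV "form I M" using assms(2) by (rule psd_form_of_matrix)
  have null: "form I M x x = 0" for x
  proof -
    have "0 \<le> form I M x x" using assms(2) by (simp add: psd_on_def)
    moreover have "0 \<le> - form I M x x"
      using assms(3) by (simp add: psd_on_def form_def sum_negf)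
    ultimately show ?thesis by (simp add: nonneg_complex_iff complex_eq_iff)
  qed
  have "form I M (\<lambda>k. if k = i then 1 else 0) (\<lambda>k. if k = j then 1 else 0) = 0"
    by (rule null_right[OF UNIV_I UNIV_I null])
  then show ?thesis by (simp only: form_delta[OF assms(1,4,5)])
qed

section \<open>Square-summable functions and adjoints\<close>

lemma ell2D: "\<psi> \<in> ell2 J \<Longrightarrow> i \<notin> J \<Longrightarrow> \<psi> i = 0"
  and ell2_summable: "\<psi> \<in> ell2 J \<Longrightarrow> (\<lambda>i. (cmod (\<psi> i))\<^sup>2) summable_on UNIV"
  by (auto simp: ell2_def)

lemma ell2_product_abs_summable:
  assumes "(\<lambda>i. (cmod (\<phi> i))\<^sup>2) summable_on UNIV" "(\<lambda>i. (cmod (\<psi> i))\<^sup>2) summable_on UNIV"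
  shows "(\<lambda>i. norm (cnj (\<phi> i) * \<psi> i)) summable_on UNIV"
proof (rule summable_on_comparison_test)
  show "(\<lambda>i. (cmod (\<phi> i))\<^sup>2 + (cmod (\<psi> i))\<^sup>2) summable_on UNIV"
    using assms by (rule summable_on_add)
  show "norm (cnj (\<phi> i) * \<psi> i) \<le> (cmod (\<phi> i))\<^sup>2 + (cmod (\<psi> i))\<^sup>2" for i
    using sum_squares_bound[of "cmod (\<phi> i)" "cmod (\<psi> i)"] mult_nonneg_nonneg[OF norm_ge_zero norm_ge_zero, of "\<phi> i" "\<psi> i"]
    unfolding norm_mult complex_mod_cnj by linarith
qed auto

lemma ell2_product_summable:
  assumes "\<phi> \<in> ell2 J" "\<psi> \<in> ell2 J'"
  shows "(\<lambda>i. cnj (\<phi> i) * \<psi> i) summable_on UNIV"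
  by (rule abs_summable_summable[OF ell2_product_abs_summable[OF assms[THEN ell2_summable]]])

lemma ell2_zero: "0 \<in> ell2 J"
  by (simp add: ell2_def)

lemma ell2_scale: "\<psi> \<in> ell2 J \<Longrightarrow> c *\<^sub>C \<psi> \<in> ell2 J"
  by (auto simp: ell2_def norm_mult power_mult_distrib intro: summable_on_cmult_right)

lemma ell2_add:
  assumes "\<phi> \<in> ell2 J" "\<psi> \<in> ell2 J"
  shows "\<phi> + \<psi> \<in> ell2 J"
proof -
  have "(\<lambda>i. (cmod (\<phi> i + \<psi> i))\<^sup>2) summable_on UNIV"
  proof (rule summable_on_comparison_test)
    show "(\<lambda>i. 2 * (cmod (\<phi> i))\<^sup>2 + 2 * (cmod (\<psi> i))\<^sup>2) summable_on UNIV"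
      using assms by (intro summable_on_add summable_on_cmult_right ell2_summable)
    show "(cmod (\<phi> i + \<psi> i))\<^sup>2 \<le> 2 * (cmod (\<phi> i))\<^sup>2 + 2 * (cmod (\<psi> i))\<^sup>2" for i
    proof -
      have "(cmod (\<phi> i + \<psi> i))\<^sup>2 \<le> (cmod (\<phi> i) + cmod (\<psi> i))\<^sup>2"
        by (intro power_mono norm_triangle_ineq) auto
      also have "\<dots> \<le> 2 * (cmod (\<phi> i))\<^sup>2 + 2 * (cmod (\<psi> i))\<^sup>2"
        using sum_squares_bound[of "cmod (\<phi> i)" "cmod (\<psi> i)"] by (simp add: power2_sum)
      finally show ?thesis .
    qed
  qed auto
  then show ?thesis using assms by (auto simp: ell2_def)
qed

lemma psd_form_ell2: "psd_form (ell2 J) ell2_inner"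
proof
  fix x y z :: "'a \<Rightarrow> complex" and c :: complex
  assume x: "x \<in> ell2 J" and y: "y \<in> ell2 J"
  show "ell2_inner x (c *\<^sub>C y) = c * ell2_inner x y"
    using infsum_cmult_right'[of c "\<lambda>i. cnj (x i) * y i" UNIV]
    by (simp add: ell2_inner_def algebra_simps)
  show "ell2_inner (c *\<^sub>C x) y = cnj c * ell2_inner x y"
    using infsum_cmult_right'[of "cnj c" "\<lambda>i. cnj (x i) * y i" UNIV]
    by (simp add: ell2_inner_def algebra_simps)
  show "0 \<le> ell2_inner x x"
    unfolding ell2_inner_def by (intro infsum_nonneg_complex nonneg_cnj_mult_self ell2_product_summable[OF x x])
  assume z: "z \<in> ell2 J"
  show "ell2_inner x (y + z) = ell2_inner x y + ell2_inner x z"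
    using infsum_add[OF ell2_product_summable[OF x y] ell2_product_summable[OF x z]]
    by (simp add: ell2_inner_def algebra_simps)
  show "ell2_inner (x + y) z = ell2_inner x z + ell2_inner y z"
    using infsum_add[OF ell2_product_summable[OF x z] ell2_product_summable[OF y z]]
    by (simp add: ell2_inner_def algebra_simps)
qed (auto simp: ell2_zero ell2_add ell2_scale)

global_interpretation ell2: psd_form "ell2 J" ell2_inner for J
  by (rule psd_form_ell2)

lemma ell2_inner_self: "\<psi> \<in> ell2 J \<Longrightarrow> ell2_inner \<psi> \<psi> = complex_of_real ((ell2_norm \<psi>)\<^sup>2)"
proof -
  assume "\<psi> \<in> ell2 J"
  have "ell2_inner \<psi> \<psi> = (\<Sum>\<^sub>\<infinity>i. complex_of_real ((cmod (\<psi> i))\<^sup>2))"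
    by (simp only: ell2_inner_def cnj_mult_self)
  also have "\<dots> = complex_of_real (\<Sum>\<^sub>\<infinity>i. (cmod (\<psi> i))\<^sup>2)"
    by (rule infsumI[OF has_sum_of_real[OF has_sum_infsum[OF ell2_summable[OF \<open>\<psi> \<in> ell2 J\<close>]]]])
  finally show ?thesis
    by (simp add: ell2_norm_def infsum_nonneg)
qed

lemma ell2_norm_nonneg: "0 \<le> ell2_norm \<psi>"
  by (simp add: ell2_norm_def infsum_nonneg)

lemma ell2_Cauchy_Schwarz:
  assumes "\<phi> \<in> ell2 J" "\<psi> \<in> ell2 J"
  shows "cmod (ell2_inner \<phi> \<psi>) \<le> ell2_norm \<phi> * ell2_norm \<psi>"
proof -
  have "(cmod (ell2_inner \<phi> \<psi>))\<^sup>2 \<le> (ell2_norm \<phi> * ell2_norm \<psi>)\<^sup>2"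
    using ell2.Cauchy_Schwarz[OF assms] ell2_inner_self[OF assms(1)] ell2_inner_self[OF assms(2)]
    by (simp add: power_mult_distrib)
  then show ?thesis
    by (rule power2_le_imp_le) (simp add: ell2_norm_nonneg)
qed

definition basis_vec :: "'j \<Rightarrow> 'j \<Rightarrow> complex"
  where "basis_vec j = (\<lambda>i. if i = j then 1 else 0)"

lemma finite_support_ell2:
  assumes "finite F" "F \<subseteq> J" "\<And>i. i \<notin> F \<Longrightarrow> \<psi> i = 0"
  shows "\<psi> \<in> ell2 J"
proof -
  have "{i \<in> UNIV. (cmod (\<psi> i))\<^sup>2 \<noteq> 0} \<subseteq> F" using assms(3) by auto
  then have "(\<lambda>i. (cmod (\<psi> i))\<^sup>2) summable_on UNIV"
    by (intro finite_nonzero_values_imp_summable_on finite_subset[OF _ assms(1)])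
  then show ?thesis using assms(2,3) by (auto simp: ell2_def)
qed

lemma basis_vec_ell2: "j \<in> J \<Longrightarrow> basis_vec j \<in> ell2 J"
  by (rule finite_support_ell2[of "{j}"]) (auto simp: basis_vec_def)

lemma ell2_inner_finite_support:
  assumes "finite F" "\<And>i. i \<notin> F \<Longrightarrow> \<phi> i = 0 \<or> \<psi> i = 0"
  shows "ell2_inner \<phi> \<psi> = (\<Sum>i\<in>F. cnj (\<phi> i) * \<psi> i)"
proof -
  have "ell2_inner \<phi> \<psi> = (\<Sum>\<^sub>\<infinity>i\<in>F. cnj (\<phi> i) * \<psi> i)"
    unfolding ell2_inner_def by (rule infsum_cong_neutral) (use assms(2) in auto)
  then show ?thesis using assms(1) by simp
qed

lemma ell2_inner_basis_vec: "ell2_inner \<phi> (basis_vec j) = cnj (\<phi> j)"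
  using ell2_inner_finite_support[of "{j}" \<phi> "basis_vec j"] by (simp add: basis_vec_def)

lemma ell2_inner_basis_vec_left: "ell2_inner (basis_vec j) \<psi> = \<psi> j"
  using ell2_inner_finite_support[of "{j}" "basis_vec j" \<psi>] by (simp add: basis_vec_def)

lemma ell2_norm_finite_support:
  assumes "finite F" "\<And>i. i \<notin> F \<Longrightarrow> \<psi> i = 0"
  shows "(ell2_norm \<psi>)\<^sup>2 = (\<Sum>i\<in>F. (cmod (\<psi> i))\<^sup>2)"
proof -
  have "(\<Sum>\<^sub>\<infinity>i. (cmod (\<psi> i))\<^sup>2) = (\<Sum>\<^sub>\<infinity>i\<in>F. (cmod (\<psi> i))\<^sup>2)"
    by (rule infsum_cong_neutral) (use assms(2) in auto)
  then show ?thesis using assms(1) by (simp add: ell2_norm_def sum_nonneg)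
qed

lemma bounded_opsD:
  assumes "T \<in> bounded_ops J L"
  shows bounded_ops_outside: "\<psi> \<notin> ell2 J \<Longrightarrow> T \<psi> = 0"
    and bounded_ops_maps: "\<psi> \<in> ell2 J \<Longrightarrow> T \<psi> \<in> ell2 L"
    and bounded_ops_add: "\<psi> \<in> ell2 J \<Longrightarrow> \<phi> \<in> ell2 J \<Longrightarrow> T (\<psi> + \<phi>) = T \<psi> + T \<phi>"
    and bounded_ops_scale: "\<psi> \<in> ell2 J \<Longrightarrow> T (c *\<^sub>C \<psi>) = c *\<^sub>C T \<psi>"
  using assms by (auto simp: bounded_ops_def)

lemma bounded_ops_ell2: "T \<in> bounded_ops J L \<Longrightarrow> T \<psi> \<in> ell2 L"
  using bounded_ops_maps bounded_ops_outside ell2_zero by metis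

lemma bounded_ops_zero: "T \<in> bounded_ops J L \<Longrightarrow> T 0 = 0"
  using bounded_ops_add[of T J L 0 0] ell2_zero[of J] by simp

lemma bounded_ops_sum:
  assumes "T \<in> bounded_ops J L" "\<And>k. k \<in> K \<Longrightarrow> f k \<in> ell2 J"
  shows "T (\<Sum>k\<in>K. c k *\<^sub>C f k) = (\<Sum>k\<in>K. c k *\<^sub>C T (f k))"
  using assms(2)
  by (induction K rule: infinite_finite_induct)
    (auto simp: bounded_ops_zero[OF assms(1)] bounded_ops_add[OF assms(1)]
      bounded_ops_scale[OF assms(1)] ell2_scale ell2.sum_closed)

lemma bounded_ops_bound:
  assumes "T \<in> bounded_ops J L"
  shows "\<exists>C\<ge>0. \<forall>\<psi>\<in>ell2 J. ell2_norm (T \<psi>) \<le> C * ell2_norm \<psi>"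
proof -
  obtain C where C: "\<forall>\<psi>\<in>ell2 J. ell2_norm (T \<psi>) \<le> C * ell2_norm \<psi>"
    using assms unfolding bounded_ops_def mem_Collect_eq by (elim conjE exE) (rule that)
  have "ell2_norm (T \<psi>) \<le> \<bar>C\<bar> * ell2_norm \<psi>" if "\<psi> \<in> ell2 J" for \<psi>
    using C[rule_format, OF that] mult_right_mono[OF abs_ge_self[of C] ell2_norm_nonneg[of \<psi>]] by linarith
  then show ?thesis by (intro exI[of _ "\<bar>C\<bar>"]) simp
qed

text \<open>The Riesz representative of \<open>\<psi> \<mapsto> \<langle>\<phi>, T \<psi>\<rangle>\<close>, given by its coordinates. That it is square-summable is the
content of \<open>formal_adj_bound\<close>; it turns the definite description in the definition of \<open>adj\<close> into an actual
operator.\<close>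

definition formal_adj :: "'j set \<Rightarrow> 'l set \<Rightarrow> ('j, 'l) op \<Rightarrow> ('l, 'j) op"
  where "formal_adj J L T \<phi> =
    (if \<phi> \<in> ell2 L then (\<lambda>j. if j \<in> J then ell2_inner (T (basis_vec j)) \<phi> else 0) else 0)"

context
  fixes J :: "'j set" and L :: "'l set" and T :: "('j, 'l) op"
  assumes T: "T \<in> bounded_ops J L"
begin

lemma formal_adj_finite:
  assumes "\<phi> \<in> ell2 L" "finite F" "F \<subseteq> J" "\<And>i. i \<notin> F \<Longrightarrow> \<psi> i = 0"
  shows "ell2_inner \<phi> (T \<psi>) = (\<Sum>j\<in>F. cnj (formal_adj J L T \<phi> j) * \<psi> j)"
proof -
  have \<psi>: "\<psi> = (\<Sum>j\<in>F. \<psi> j *\<^sub>C basis_vec j)"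
    using assms(2,4) by (auto simp: fun_eq_iff sum_fun_apply basis_vec_def if_distrib cong: if_cong)
  have "T (\<Sum>j\<in>F. \<psi> j *\<^sub>C basis_vec j) = (\<Sum>j\<in>F. \<psi> j *\<^sub>C T (basis_vec j))"
    by (rule bounded_ops_sum[OF T]) (rule basis_vec_ell2, use assms(3) in blast)
  then have "T \<psi> = (\<Sum>j\<in>F. \<psi> j *\<^sub>C T (basis_vec j))"
    unfolding \<psi>[symmetric] .
  then have "ell2_inner \<phi> (T \<psi>) = (\<Sum>j\<in>F. \<psi> j * ell2_inner \<phi> (T (basis_vec j)))"
    using ell2.sum_right[OF assms(1), of F "\<lambda>j. T (basis_vec j)" \<psi>] bounded_ops_ell2[OF T] by simp
  also have "\<dots> = (\<Sum>j\<in>F. cnj (formal_adj J L T \<phi> j) * \<psi> j)"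
  proof (rule sum.cong)
    fix j assume "j \<in> F"
    then have "j \<in> J" using assms(3) by blast
    then show "\<psi> j * ell2_inner \<phi> (T (basis_vec j)) = cnj (formal_adj J L T \<phi> j) * \<psi> j"
      using assms(1) ell2.hermitian[OF bounded_ops_ell2[OF T] assms(1), of "basis_vec j"]
      by (simp add: formal_adj_def)
  qed simp
  finally show ?thesis .
qed

text \<open>For \<open>\<psi>\<close> the restriction of \<open>T\<^sup>* \<phi>\<close> to \<open>F\<close>, the finite identity reads \<open>\<parallel>\<psi>\<parallel>\<^sup>2 = \<langle>\<phi>, T \<psi>\<rangle> \<le> C \<parallel>\<phi>\<parallel> \<parallel>\<psi>\<parallel>\<close>.\<close>

lemma formal_adj_bound:
  shows "\<exists>C\<ge>0. \<forall>\<phi>\<in>ell2 L. \<forall>F. finite F \<longrightarrow>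
    (\<Sum>j\<in>F. (cmod (formal_adj J L T \<phi> j))\<^sup>2) \<le> (C * ell2_norm \<phi>)\<^sup>2"
proof -
  obtain C where C: "C \<ge> 0" "\<And>\<psi>. \<psi> \<in> ell2 J \<Longrightarrow> ell2_norm (T \<psi>) \<le> C * ell2_norm \<psi>"
    using bounded_ops_bound[OF T] by auto
  have bd: "(\<Sum>j\<in>F. (cmod (formal_adj J L T \<phi> j))\<^sup>2) \<le> (C * ell2_norm \<phi>)\<^sup>2"
    if \<phi>: "\<phi> \<in> ell2 L" and F: "finite F" "F \<subseteq> J" for \<phi> F
  proof -
    define \<psi> where "\<psi> j = (if j \<in> F then formal_adj J L T \<phi> j else 0)" for j
    define s where "s = (\<Sum>j\<in>F. (cmod (formal_adj J L T \<phi> j))\<^sup>2)"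
    have \<psi>: "\<psi> \<in> ell2 J" by (rule finite_support_ell2[OF F]) (simp add: \<psi>_def)
    have n: "(ell2_norm \<psi>)\<^sup>2 = s"
      unfolding s_def using ell2_norm_finite_support[OF F(1), of \<psi>] by (simp add: \<psi>_def)
    have "ell2_inner \<phi> (T \<psi>) = (\<Sum>j\<in>F. cnj (formal_adj J L T \<phi> j) * \<psi> j)"
      by (rule formal_adj_finite[OF \<phi> F]) (simp add: \<psi>_def)
    also have "\<dots> = complex_of_real s"
      by (simp add: \<psi>_def s_def cnj_mult_self del: of_real_power)
    finally have "s = cmod (ell2_inner \<phi> (T \<psi>))"
      by (simp only: norm_of_real) (simp add: s_def sum_nonneg)
    also have "\<dots> \<le> ell2_norm \<phi> * ell2_norm (T \<psi>)"
      using ell2_Cauchy_Schwarz[OF \<phi> bounded_ops_ell2[OF T]] .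
    also have "\<dots> \<le> ell2_norm \<phi> * (C * ell2_norm \<psi>)"
      by (intro mult_left_mono C(2) \<psi> ell2_norm_nonneg)
    finally have le: "ell2_norm \<psi> * ell2_norm \<psi> \<le> (C * ell2_norm \<phi>) * ell2_norm \<psi>"
      using n by (simp add: power2_eq_square algebra_simps)
    have "ell2_norm \<psi> \<le> C * ell2_norm \<phi>"
    proof (cases "ell2_norm \<psi> = 0")
      case True then show ?thesis using C(1) ell2_norm_nonneg[of \<phi>] by simp
    next
      case False
      then have "ell2_norm \<psi> > 0" using ell2_norm_nonneg[of \<psi>] by simp
      then show ?thesis by (rule mult_right_le_imp_le[OF le])
    qed
    then have "(ell2_norm \<psi>)\<^sup>2 \<le> (C * ell2_norm \<phi>)\<^sup>2"
      by (rule power_mono[OF _ ell2_norm_nonneg])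
    then show ?thesis
      unfolding n s_def .
  qed
  have "(\<Sum>j\<in>F. (cmod (formal_adj J L T \<phi> j))\<^sup>2) \<le> (C * ell2_norm \<phi>)\<^sup>2"
    if \<phi>: "\<phi> \<in> ell2 L" and F: "finite F" for \<phi> F
  proof -
    have "(\<Sum>j\<in>F. (cmod (formal_adj J L T \<phi> j))\<^sup>2) = (\<Sum>j\<in>F \<inter> J. (cmod (formal_adj J L T \<phi> j))\<^sup>2)"
      using F by (intro sum.mono_neutral_right) (auto simp: formal_adj_def)
    then show ?thesis using bd[OF \<phi>, of "F \<inter> J"] F by simp
  qed
  then show ?thesis using C(1) by blast
qed

lemma formal_adj_bounded: "formal_adj J L T \<in> bounded_ops L J"
proof -
  obtain C where C: "C \<ge> 0" "\<And>\<phi> F. \<phi> \<in> ell2 L \<Longrightarrow> finite F \<Longrightarrow>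
      (\<Sum>j\<in>F. (cmod (formal_adj J L T \<phi> j))\<^sup>2) \<le> (C * ell2_norm \<phi>)\<^sup>2"
    using formal_adj_bound by auto
  have sm: "(\<lambda>j. (cmod (formal_adj J L T \<phi> j))\<^sup>2) summable_on UNIV" if "\<phi> \<in> ell2 L" for \<phi>
    by (rule nonneg_bdd_above_summable_on) (use C(2)[OF that] in \<open>auto intro!: bdd_aboveI\<close>)
  have 1: "formal_adj J L T \<phi> \<in> ell2 J" if "\<phi> \<in> ell2 L" for \<phi>
    using sm[OF that] by (auto simp: ell2_def formal_adj_def)
  have 2: "ell2_norm (formal_adj J L T \<phi>) \<le> C * ell2_norm \<phi>" if "\<phi> \<in> ell2 L" for \<phi>
  proof -
    have "(\<Sum>\<^sub>\<infinity>j. (cmod (formal_adj J L T \<phi> j))\<^sup>2) \<le> (C * ell2_norm \<phi>)\<^sup>2"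
      using infsum_le_finite_sums[OF sm[OF that]] C(2)[OF that] by simp
    then show ?thesis
      unfolding ell2_norm_def[of "formal_adj J L T \<phi>"]
      by (rule real_le_lsqrt[rotated]) (simp add: C(1) ell2_norm_nonneg)
  qed
  have 3: "formal_adj J L T (\<psi> + \<phi>) = formal_adj J L T \<psi> + formal_adj J L T \<phi>"
    if "\<psi> \<in> ell2 L" "\<phi> \<in> ell2 L" for \<psi> \<phi>
    using that ell2.add_right[OF bounded_ops_ell2[OF T] that]
    by (auto simp: formal_adj_def fun_eq_iff ell2_add)
  have 4: "formal_adj J L T (c *\<^sub>C \<psi>) = c *\<^sub>C formal_adj J L T \<psi>" if "\<psi> \<in> ell2 L" for \<psi> c
    using that ell2.scale_right[OF bounded_ops_ell2[OF T] that]
    by (auto simp: formal_adj_def fun_eq_iff ell2_scale)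
  have 5: "formal_adj J L T \<psi> = 0" if "\<psi> \<notin> ell2 L" for \<psi>
    using that by (simp add: formal_adj_def)
  show ?thesis
    unfolding bounded_ops_def mem_Collect_eq
    using 1 2 3 4 5 by (intro conjI allI ballI impI exI[of _ C]) metis+
qed

text \<open>The identity holds on finitely supported vectors, and both sides are continuous.\<close>

lemma formal_adj_inner:
  assumes "\<phi> \<in> ell2 L" "\<psi> \<in> ell2 J"
  shows "ell2_inner (formal_adj J L T \<phi>) \<psi> = ell2_inner \<phi> (T \<psi>)"
proof -
  obtain C where C: "C \<ge> 0" "\<And>\<psi>. \<psi> \<in> ell2 J \<Longrightarrow> ell2_norm (T \<psi>) \<le> C * ell2_norm \<psi>"
    using bounded_ops_bound[OF T] by auto
  define g where "g j = cnj (formal_adj J L T \<phi> j) * \<psi> j" for j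
  define q where "q F = (\<Sum>j\<in>F. (cmod (\<psi> j))\<^sup>2)" for F
  define N where "N = (\<Sum>\<^sub>\<infinity>j. (cmod (\<psi> j))\<^sup>2)"
  have qN: "(q \<longlongrightarrow> N) (finite_subsets_at_top UNIV)"
    unfolding q_def N_def using infsum_tendsto[OF ell2_summable[OF assms(2)]] .
  have bound: "dist (sum g F) (ell2_inner \<phi> (T \<psi>)) \<le> ell2_norm \<phi> * (C * sqrt (N - q F))"
    if F: "finite F" for F
  proof -
    define \<psi>1 where "\<psi>1 j = (if j \<in> F then \<psi> j else 0)" for j
    define \<psi>2 where "\<psi>2 j = (if j \<in> F then 0 else \<psi> j)" for j
    have z: "\<psi>1 i = 0" if "i \<notin> F \<inter> J" for i using that ell2D[OF assms(2)] by (auto simp: \<psi>1_def)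
    have \<psi>1: "\<psi>1 \<in> ell2 J" by (rule finite_support_ell2[of "F \<inter> J"]) (use F z in auto)
    have \<psi>2_eq: "\<psi>2 = \<psi> + (- 1) *\<^sub>C \<psi>1" by (auto simp: \<psi>1_def \<psi>2_def fun_eq_iff)
    have \<psi>2: "\<psi>2 \<in> ell2 J" unfolding \<psi>2_eq by (intro ell2_add ell2_scale assms(2) \<psi>1)
    have \<psi>_eq: "\<psi> = \<psi>1 + \<psi>2" by (auto simp: \<psi>1_def \<psi>2_def fun_eq_iff)
    have "T \<psi> = T \<psi>1 + T \<psi>2"
      using bounded_ops_add[OF T \<psi>1 \<psi>2] unfolding \<psi>_eq[symmetric] .
    then have "ell2_inner \<phi> (T \<psi>) = ell2_inner \<phi> (T \<psi>1) + ell2_inner \<phi> (T \<psi>2)"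
      using ell2.add_right[OF assms(1) bounded_ops_ell2[OF T, of \<psi>1] bounded_ops_ell2[OF T, of \<psi>2]]
      by simp
    moreover have "ell2_inner \<phi> (T \<psi>1) = (\<Sum>j\<in>F \<inter> J. cnj (formal_adj J L T \<phi> j) * \<psi>1 j)"
      by (rule formal_adj_finite[OF assms(1)]) (use F z in auto)
    moreover have "\<dots> = sum g F"
      using F z by (intro sum.mono_neutral_cong_left) (auto simp: g_def \<psi>1_def formal_adj_def)
    ultimately have "dist (sum g F) (ell2_inner \<phi> (T \<psi>)) = cmod (ell2_inner \<phi> (T \<psi>2))"
      by (simp add: dist_norm)
    also have "\<dots> \<le> ell2_norm \<phi> * ell2_norm (T \<psi>2)"
      using ell2_Cauchy_Schwarz[OF assms(1) bounded_ops_ell2[OF T]] .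
    also have "\<dots> \<le> ell2_norm \<phi> * (C * ell2_norm \<psi>2)"
      by (intro mult_left_mono C(2) \<psi>2 ell2_norm_nonneg)
    also have "ell2_norm \<psi>2 = sqrt (N - q F)"
    proof -
      have "N = (\<Sum>\<^sub>\<infinity>j. (cmod (\<psi>1 j))\<^sup>2 + (cmod (\<psi>2 j))\<^sup>2)"
        unfolding N_def by (rule infsum_cong) (auto simp: \<psi>1_def \<psi>2_def)
      also have "\<dots> = (\<Sum>\<^sub>\<infinity>j. (cmod (\<psi>1 j))\<^sup>2) + (\<Sum>\<^sub>\<infinity>j. (cmod (\<psi>2 j))\<^sup>2)"
        by (rule infsum_add) (use ell2_summable \<psi>1 \<psi>2 in auto)
      also have "(\<Sum>\<^sub>\<infinity>j. (cmod (\<psi>1 j))\<^sup>2) = q F"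
      proof -
        have "(\<Sum>\<^sub>\<infinity>j. (cmod (\<psi>1 j))\<^sup>2) = (\<Sum>\<^sub>\<infinity>j\<in>F. (cmod (\<psi> j))\<^sup>2)"
          by (rule infsum_cong_neutral) (auto simp: \<psi>1_def)
        then show ?thesis using F by (simp add: q_def)
      qed
      finally show ?thesis by (simp add: ell2_norm_def)
    qed
    finally show ?thesis .
  qed
  have "((\<lambda>F. ell2_norm \<phi> * (C * sqrt (N - q F))) \<longlongrightarrow> ell2_norm \<phi> * (C * sqrt (N - N)))
      (finite_subsets_at_top UNIV)"
    by (intro tendsto_intros qN)
  then have "((\<lambda>F. ell2_norm \<phi> * (C * sqrt (N - q F))) \<longlongrightarrow> 0) (finite_subsets_at_top UNIV)"
    by simp
  then have "((\<lambda>F. dist (sum g F) (ell2_inner \<phi> (T \<psi>))) \<longlongrightarrow> 0) (finite_subsets_at_top UNIV)"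
    by (rule tendsto_sandwich[OF _ _ tendsto_const, rotated 2])
      (auto intro!: eventually_finite_subsets_at_top_weakI bound)
  then have "(sum g \<longlongrightarrow> ell2_inner \<phi> (T \<psi>)) (finite_subsets_at_top UNIV)"
    by (rule tendsto_dist_iff[THEN iffD2])
  then have "(g has_sum ell2_inner \<phi> (T \<psi>)) UNIV"
    by (simp add: has_sum_def)
  then show ?thesis
    by (simp add: ell2_inner_def g_def[symmetric] infsumI)
qed

lemma adj_eq_formal_adj: "adj J L T = formal_adj J L T"
  unfolding adj_def
proof (rule the_equality)
  show "formal_adj J L T \<in> bounded_ops L J \<and>
    (\<forall>\<phi>\<in>ell2 L. \<forall>\<psi>\<in>ell2 J. ell2_inner (formal_adj J L T \<phi>) \<psi> = ell2_inner \<phi> (T \<psi>))"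
    by (intro conjI ballI formal_adj_bounded formal_adj_inner)
next
  fix S assume S: "S \<in> bounded_ops L J \<and>
    (\<forall>\<phi>\<in>ell2 L. \<forall>\<psi>\<in>ell2 J. ell2_inner (S \<phi>) \<psi> = ell2_inner \<phi> (T \<psi>))"
  show "S = formal_adj J L T"
  proof
    fix \<phi>
    show "S \<phi> = formal_adj J L T \<phi>"
    proof (cases "\<phi> \<in> ell2 L")
      case True
      show ?thesis
      proof
        fix j
        show "S \<phi> j = formal_adj J L T \<phi> j"
        proof (cases "j \<in> J")
          case True
          have "ell2_inner (S \<phi>) (basis_vec j) = ell2_inner (formal_adj J L T \<phi>) (basis_vec j)"
            using S \<open>\<phi> \<in> ell2 L\<close> basis_vec_ell2[OF True] formal_adj_inner by simp
          then show ?thesis by (simp add: ell2_inner_basis_vec)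
        next
          case False
          then show ?thesis
            using S ell2D[OF bounded_ops_ell2[of S L J] False]
              ell2D[OF bounded_ops_ell2[OF formal_adj_bounded] False] by simp
        qed
      qed
    next
      case False
      then show ?thesis using S bounded_ops_outside formal_adj_bounded by metis
    qed
  qed
qed

lemma adj_bounded: "adj J L T \<in> bounded_ops L J"
  by (simp add: adj_eq_formal_adj formal_adj_bounded)

lemma adj_inner:
  "\<phi> \<in> ell2 L \<Longrightarrow> \<psi> \<in> ell2 J \<Longrightarrow> ell2_inner (adj J L T \<phi>) \<psi> = ell2_inner \<phi> (T \<psi>)"
  by (simp add: adj_eq_formal_adj formal_adj_inner)

lemma adj_inner_right:
  assumes "\<phi> \<in> ell2 L" "\<psi> \<in> ell2 J"
  shows "ell2_inner \<psi> (adj J L T \<phi>) = ell2_inner (T \<psi>) \<phi>"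
  using adj_inner[OF assms] ell2.hermitian[OF assms(2) bounded_ops_ell2[OF adj_bounded], of \<phi>]
    ell2.hermitian[OF bounded_ops_ell2[OF T] assms(1), of \<psi>] by simp

end

section \<open>Bi-isometries and the universal bi-isometry\<close>

lemma ell2_eqI:
  assumes "u \<in> ell2 J" "v \<in> ell2 J" "\<And>\<phi>. \<phi> \<in> ell2 J \<Longrightarrow> ell2_inner \<phi> u = ell2_inner \<phi> v"
  shows "u = v"
proof
  fix j
  show "u j = v j"
  proof (cases "j \<in> J")
    case True
    then show ?thesis using assms(3)[OF basis_vec_ell2[OF True]] by (simp add: ell2_inner_basis_vec_left)
  next
    case False
    then show ?thesis using ell2D[OF assms(1) False] ell2D[OF assms(2) False] by simp
  qed
qed

lemma adj_sum_inner:
  fixes V W :: "'a::finite \<Rightarrow> ('j, 'l) op"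
  assumes "\<And>a. V a \<in> bounded_ops J L" "\<And>a. W a \<in> bounded_ops J L" "\<phi> \<in> ell2 J" "\<psi> \<in> ell2 J"
  shows "ell2_inner \<phi> ((\<Sum>a\<in>UNIV. adj J L (V a) \<circ> W a) \<psi>) = (\<Sum>a\<in>UNIV. ell2_inner (V a \<phi>) (W a \<psi>))"
proof -
  have e: "(\<Sum>a\<in>UNIV. adj J L (V a) \<circ> W a) \<psi> = (\<Sum>a\<in>UNIV. 1 *\<^sub>C adj J L (V a) (W a \<psi>))"
    by (simp add: sum_fun_apply)
  have "ell2_inner \<phi> (\<Sum>a\<in>UNIV. 1 *\<^sub>C adj J L (V a) (W a \<psi>)) = (\<Sum>a\<in>UNIV. 1 * ell2_inner \<phi> (adj J L (V a) (W a \<psi>)))"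
    by (rule ell2.sum_right[OF assms(3)]) (rule bounded_ops_ell2[OF adj_bounded[OF assms(1)]])
  also have "\<dots> = (\<Sum>a\<in>UNIV. ell2_inner (V a \<phi>) (W a \<psi>))"
    using adj_inner_right[OF assms(1) bounded_ops_ell2[OF assms(2)] assms(3)] by simp
  finally show ?thesis unfolding e .
qed

text \<open>Operator identities between sums of products \<open>V\<^sub>a\<^sup>* W\<^sub>a\<close> are tested on inner products, which removes all adjoints
from the definition of a bi-isometry.\<close>

lemma adj_sum_eq_iff:
  fixes V W :: "'a::finite \<Rightarrow> ('j, 'l) op"
  assumes V: "\<And>a. V a \<in> bounded_ops J L" and W: "\<And>a. W a \<in> bounded_ops J L"
  shows "(\<Sum>a\<in>UNIV. adj J L (V a) \<circ> W a) = (if b then id_op J else 0) \<longleftrightarrow>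
    (\<forall>\<phi>\<in>ell2 J. \<forall>\<psi>\<in>ell2 J. (\<Sum>a\<in>UNIV. ell2_inner (V a \<phi>) (W a \<psi>)) = (if b then ell2_inner \<phi> \<psi> else 0))"
    (is "?S = ?R \<longleftrightarrow> ?I")
proof
  assume eq: "?S = ?R"
  show ?I
  proof (intro ballI)
    fix \<phi> \<psi> assume *: "\<phi> \<in> ell2 J" "\<psi> \<in> ell2 J"
    have "ell2_inner \<phi> (?R \<psi>) = (if b then ell2_inner \<phi> \<psi> else 0)"
      using * ell2.zero_right[OF *(1)] by (simp add: id_op_def)
    then show "(\<Sum>a\<in>UNIV. ell2_inner (V a \<phi>) (W a \<psi>)) = (if b then ell2_inner \<phi> \<psi> else 0)"
      using adj_sum_inner[of V J L W, OF V W *] unfolding eq by simp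
  qed
next
  assume I: ?I
  show "?S = ?R"
  proof
    fix \<psi>
    show "?S \<psi> = ?R \<psi>"
    proof (cases "\<psi> \<in> ell2 J")
      case True
      show ?thesis
      proof (rule ell2_eqI[of _ J])
        show "?S \<psi> \<in> ell2 J"
          by (subst sum_fun_apply) (simp add: ell2.sum_closed bounded_ops_ell2[OF adj_bounded[OF V]])
        show "?R \<psi> \<in> ell2 J" using True by (simp add: id_op_def ell2_zero)
        fix \<phi> assume \<phi>: "\<phi> \<in> ell2 J"
        have "ell2_inner \<phi> (?R \<psi>) = (if b then ell2_inner \<phi> \<psi> else 0)"
          using True ell2.zero_right[OF \<phi>] by (simp add: id_op_def)
        then show "ell2_inner \<phi> (?S \<psi>) = ell2_inner \<phi> (?R \<psi>)"
          using adj_sum_inner[of V J L W, OF V W \<phi> True] I[rule_format, OF \<phi> True] by simp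
      qed
    next
      case False
      then show ?thesis
        using bounded_ops_outside[OF W False] bounded_ops_zero[OF adj_bounded[OF V]]
        by (simp add: sum_fun_apply id_op_def)
    qed
  qed
qed

lemma bi_isometry_bounded: "bi_isometry J L V \<Longrightarrow> V a x \<in> bounded_ops J L"
  by (simp add: bi_isometry_def)

lemma bi_isometry_inner:
  assumes "bi_isometry J L V" "\<phi> \<in> ell2 J" "\<psi> \<in> ell2 J"
  shows "(\<Sum>a\<in>UNIV. ell2_inner (V a x \<phi>) (V a x' \<psi>)) = (if x = x' then ell2_inner \<phi> \<psi> else 0)"
    and "(\<Sum>x\<in>UNIV. ell2_inner (V a x \<phi>) (V a' x \<psi>)) = (if a = a' then ell2_inner \<phi> \<psi> else 0)"
proof -
  have V: "V a x \<in> bounded_ops J L" for a x by (rule bi_isometry_bounded[OF assms(1)])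
  have "(\<Sum>a\<in>UNIV. adj J L (V a x) \<circ> V a x') = (if x = x' then id_op J else 0)"
    "(\<Sum>x\<in>UNIV. adj J L (V a x) \<circ> V a' x) = (if a = a' then id_op J else 0)"
    using assms(1) by (auto simp: bi_isometry_def)
  note * = this[THEN adj_sum_eq_iff[OF V V, THEN iffD1], rule_format, OF assms(2,3)]
  show "(\<Sum>a\<in>UNIV. ell2_inner (V a x \<phi>) (V a x' \<psi>)) = (if x = x' then ell2_inner \<phi> \<psi> else 0)"
    by (rule *(1))
  show "(\<Sum>x\<in>UNIV. ell2_inner (V a x \<phi>) (V a' x \<psi>)) = (if a = a' then ell2_inner \<phi> \<psi> else 0)"
    by (rule *(2))
qed

text \<open>Each entry of an isometric column is a contraction. This gives boundedness of the entries of a bi-isometry for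
free, and uniformly, as the direct sum over all bi-isometries requires.\<close>

lemma column_isometry_contraction:
  fixes V :: "'a::finite \<Rightarrow> ('j, 'l) op"
  assumes "\<And>a. V a \<psi> \<in> ell2 L" "\<psi> \<in> ell2 J"
    and "(\<Sum>a\<in>UNIV. ell2_inner (V a \<psi>) (V a \<psi>)) = ell2_inner \<psi> \<psi>"
  shows "ell2_norm (V a \<psi>) \<le> ell2_norm \<psi>"
proof -
  have "complex_of_real (\<Sum>a\<in>UNIV. (ell2_norm (V a \<psi>))\<^sup>2) = complex_of_real ((ell2_norm \<psi>)\<^sup>2)"
    using assms(3) unfolding ell2_inner_self[OF assms(1)] ell2_inner_self[OF assms(2)] by simp
  then have "(\<Sum>a\<in>UNIV. (ell2_norm (V a \<psi>))\<^sup>2) = (ell2_norm \<psi>)\<^sup>2"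
    by (simp only: of_real_eq_iff)
  moreover have "(ell2_norm (V a \<psi>))\<^sup>2 \<le> (\<Sum>a\<in>UNIV. (ell2_norm (V a \<psi>))\<^sup>2)"
    by (rule member_le_sum) auto
  ultimately have "(ell2_norm (V a \<psi>))\<^sup>2 \<le> (ell2_norm \<psi>)\<^sup>2" by simp
  then show ?thesis by (rule power2_le_imp_le) (rule ell2_norm_nonneg)
qed

lemma bi_isometryI:
  fixes V :: "'x::finite \<Rightarrow> 'x \<Rightarrow> ('j, 'l) op"
  assumes outside: "\<And>a x \<psi>. \<psi> \<notin> ell2 J \<Longrightarrow> V a x \<psi> = 0"
    and maps: "\<And>a x \<psi>. \<psi> \<in> ell2 J \<Longrightarrow> V a x \<psi> \<in> ell2 L"
    and add: "\<And>a x \<psi> \<phi>. \<psi> \<in> ell2 J \<Longrightarrow> \<phi> \<in> ell2 J \<Longrightarrow> V a x (\<psi> + \<phi>) = V a x \<psi> + V a x \<phi>"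
    and scale: "\<And>a x \<psi> c. \<psi> \<in> ell2 J \<Longrightarrow> V a x (c *\<^sub>C \<psi>) = c *\<^sub>C V a x \<psi>"
    and row: "\<And>x x' \<phi> \<psi>. \<phi> \<in> ell2 J \<Longrightarrow> \<psi> \<in> ell2 J \<Longrightarrow>
      (\<Sum>a\<in>UNIV. ell2_inner (V a x \<phi>) (V a x' \<psi>)) = (if x = x' then ell2_inner \<phi> \<psi> else 0)"
    and col: "\<And>a a' \<phi> \<psi>. \<phi> \<in> ell2 J \<Longrightarrow> \<psi> \<in> ell2 J \<Longrightarrow>
      (\<Sum>x\<in>UNIV. ell2_inner (V a x \<phi>) (V a' x \<psi>)) = (if a = a' then ell2_inner \<phi> \<psi> else 0)"
  shows "bi_isometry J L V"
proof -
  have bd: "ell2_norm (V a x \<psi>) \<le> 1 * ell2_norm \<psi>" if "\<psi> \<in> ell2 J" for a x \<psi>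
    using column_isometry_contraction[of "\<lambda>a. V a x" \<psi> L J a] maps[OF that] row[OF that that, of x x] that
    by simp
  have V: "V a x \<in> bounded_ops J L" for a x
    unfolding bounded_ops_def mem_Collect_eq
    by (intro conjI ballI allI impI exI[of _ 1] outside maps add scale bd)
  show ?thesis
    unfolding bi_isometry_def
  proof (intro conjI allI V)
    show "(\<Sum>a\<in>UNIV. adj J L (V a x) \<circ> V a x') = (if x = x' then id_op J else 0)" for x x'
      unfolding adj_sum_eq_iff[of "\<lambda>a. V a x" J L "\<lambda>a. V a x'", OF V V] by (intro ballI row)
    show "(\<Sum>x\<in>UNIV. adj J L (V a x) \<circ> V a' x) = (if a = a' then id_op J else 0)" for a a'
      unfolding adj_sum_eq_iff[of "\<lambda>x. V a x" J L "\<lambda>x. V a' x", OF V V] by (intro ballI col)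
  qed
qed

lemma id_op_bounded: "id_op J \<in> bounded_ops J J"
  unfolding bounded_ops_def mem_Collect_eq
  by (intro conjI exI[of _ 1]) (auto simp: id_op_def ell2_add ell2_scale)

lemma adj_id_op: "adj J J (id_op J) = id_op J"
proof
  fix \<psi>
  show "adj J J (id_op J) \<psi> = id_op J \<psi>"
  proof (cases "\<psi> \<in> ell2 J")
    case True
    have id: "id_op J \<phi> = \<phi>" if "\<phi> \<in> ell2 J" for \<phi>
      using that by (simp add: id_op_def)
    show ?thesis
      by (rule ell2_eqI[OF bounded_ops_ell2[OF adj_bounded[OF id_op_bounded]]])
        (simp_all add: True id adj_inner_right[OF id_op_bounded])
  next
    case False
    then show ?thesis
      using bounded_ops_outside[OF adj_bounded[OF id_op_bounded] False] by (simp add: id_op_def)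
  qed
qed

lemma id_op_idem: "id_op J \<circ> id_op J = id_op J"
  by (rule ext) (simp add: id_op_def ell2_zero)

lemma unitary_id_op: "unitary_op J J (id_op J)"
  by (simp add: unitary_op_def id_op_bounded adj_id_op id_op_idem)

lemma unitary_op_inner:
  assumes "unitary_op J L U" "\<phi> \<in> ell2 J" "\<psi> \<in> ell2 J"
  shows "ell2_inner (U \<phi>) (U \<psi>) = ell2_inner \<phi> \<psi>"
proof -
  have U: "U \<in> bounded_ops J L" and eq: "adj J L U \<circ> U = id_op J"
    using assms(1) by (auto simp: unitary_op_def)
  have "ell2_inner (U \<phi>) (U \<psi>) = ell2_inner \<phi> ((adj J L U \<circ> U) \<psi>)"
    using adj_inner_right[OF U bounded_ops_ell2[OF U] assms(2)] by simp
  then show ?thesis using assms(3) unfolding eq by (simp add: id_op_def)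
qed

lemma unitarily_equivalent_refl:
  assumes V: "bi_isometry J L V"
  shows "((J, L, V), (J, L, V)) \<in> unitarily_equivalent"
proof -
  have "V a x \<circ> id_op J = id_op L \<circ> V a x" for a x
  proof
    fix \<psi>
    show "(V a x \<circ> id_op J) \<psi> = (id_op L \<circ> V a x) \<psi>"
      using bounded_ops_ell2[OF bi_isometry_bounded[OF V], of a x \<psi>]
        bounded_ops_outside[OF bi_isometry_bounded[OF V], of \<psi> a x]
        bounded_ops_zero[OF bi_isometry_bounded[OF V], of a x]
      by (simp add: id_op_def)
  qed
  then have "\<exists>U W. unitary_op J J U \<and> unitary_op L L W \<and> (\<forall>a x. V a x \<circ> U = W \<circ> V a x)"
    by (intro exI[of _ "id_op J"] exI[of _ "id_op L"] conjI allI unitary_id_op)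
  then show ?thesis
    unfolding unitarily_equivalent_def mem_Collect_eq case_prod_conv by (intro conjI V)
qed

text \<open>Reflexivity makes every equivalence class nonempty, so the choice operator really picks a representative.\<close>

lemma class_representative:
  assumes "c \<in> bi_isometries // unitarily_equivalent"
  obtains J L V J' L' V' where "c = unitarily_equivalent `` {(J, L, V)}" "bi_isometry J L V"
    "(SOME p. p \<in> c) = (J', L', V')" "((J, L, V), (J', L', V')) \<in> unitarily_equivalent"
proof -
  obtain p where p: "p \<in> bi_isometries" "c = unitarily_equivalent `` {p}"
    using assms by (rule quotientE)
  obtain J L V where q: "p = (J, L, V)" by (cases p)
  obtain J' L' V' where r: "(SOME p. p \<in> c) = (J', L', V')" by (cases "SOME p. p \<in> c")
  have V: "bi_isometry J L V" using p(1) unfolding q bi_isometries_def by simp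
  have "(J, L, V) \<in> c" using unitarily_equivalent_refl[OF V] unfolding p(2) q by simp
  then have "(SOME p. p \<in> c) \<in> c" by (rule someI)
  then have "((J, L, V), (J', L', V')) \<in> unitarily_equivalent" unfolding r unfolding p(2) q by simp
  then show ?thesis using V r p(2) unfolding q by (intro that[of J L V J' L' V'])
qed

lemma bi_iso_reps_bi_isometry:
  assumes "(J, L, V) \<in> bi_iso_reps"
  shows "bi_isometry J L V"
proof -
  obtain c where c: "c \<in> bi_isometries // unitarily_equivalent" "(SOME p. p \<in> c) = (J, L, V)"
    using assms unfolding bi_iso_reps_def by (elim imageE) (rule that, simp_all)
  show ?thesis
  proof (rule class_representative[OF c(1)])
    fix J0 L0 V0 J' L' V'
    assume "(SOME p. p \<in> c) = (J', L', V')" "((J0, L0, V0), (J', L', V')) \<in> unitarily_equivalent"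
    then show ?thesis using c(2) by (simp add: unitarily_equivalent_def)
  qed
qed

lemma bi_isometry_equivalent_rep:
  assumes "bi_isometry J L V"
  obtains J' L' V' where "(J', L', V') \<in> bi_iso_reps"
    "((J, L, V), (J', L', V')) \<in> unitarily_equivalent"
proof -
  define c where "c = unitarily_equivalent `` {(J, L, V)}"
  have c: "c \<in> bi_isometries // unitarily_equivalent"
    unfolding c_def by (rule quotientI) (use assms in \<open>simp add: bi_isometries_def\<close>)
  have "(J, L, V) \<in> c" using unitarily_equivalent_refl[OF assms] by (simp add: c_def)
  then have "(SOME p. p \<in> c) \<in> c" by (rule someI)
  moreover have "(SOME p. p \<in> c) \<in> bi_iso_reps"
    unfolding bi_iso_reps_def by (rule imageI[OF c])
  moreover obtain J' L' V' where "(SOME p. p \<in> c) = (J', L', V')" by (cases "SOME p. p \<in> c")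
  ultimately show ?thesis using that[of J' L' V'] by (simp add: c_def)
qed

lemma has_sum_finite_sum:
  fixes f :: "'a \<Rightarrow> 'b \<Rightarrow> complex"
  assumes "finite A" "\<And>a. a \<in> A \<Longrightarrow> (f a has_sum s a) B"
  shows "((\<lambda>p. \<Sum>a\<in>A. f a p) has_sum (\<Sum>a\<in>A. s a)) B"
  using assms by (induction A rule: finite_induct) (auto intro: has_sum_add)

text \<open>Vectors of a direct sum, seen through their components and through the inclusion of one summand.\<close>

definition component :: "'p \<Rightarrow> ('p \<times> 'j \<Rightarrow> complex) \<Rightarrow> 'j \<Rightarrow> complex"
  where "component p \<psi> = (\<lambda>j. \<psi> (p, j))"

definition embed :: "'p \<Rightarrow> ('j \<Rightarrow> complex) \<Rightarrow> 'p \<times> 'j \<Rightarrow> complex"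
  where "embed p \<xi> = (\<lambda>(q, j). if q = p then \<xi> j else 0)"

lemma summable_on_fibre:
  fixes f :: "'p \<times> 'j \<Rightarrow> 'c::banach"
  assumes "f summable_on UNIV"
  shows "(\<lambda>j. f (p, j)) summable_on UNIV"
proof -
  have "f summable_on (Pair p ` UNIV)"
    using summable_on_subset_banach[OF assms] by blast
  then show ?thesis
    using summable_on_reindex[of "Pair p" UNIV f] by (simp add: inj_on_def o_def)
qed

lemma has_sum_fibres:
  fixes f :: "'p \<times> 'j \<Rightarrow> 'c::banach"
  assumes "f summable_on UNIV"
  shows "((\<lambda>p. \<Sum>\<^sub>\<infinity>j. f (p, j)) has_sum infsum f UNIV) UNIV"
proof (rule has_sum_SigmaD)
  show "(f has_sum infsum f UNIV) (Sigma UNIV (\<lambda>_. UNIV))"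
    using has_sum_infsum[OF assms] by simp
  show "((\<lambda>j. f (p, j)) has_sum (\<Sum>\<^sub>\<infinity>j. f (p, j))) UNIV" for p
    by (rule has_sum_infsum[OF summable_on_fibre[OF assms]])
qed

lemma component_ell2:
  assumes "\<psi> \<in> ell2 (Sigma I J)"
  shows "component p \<psi> \<in> ell2 (J p)"
  using ell2D[OF assms] summable_on_fibre[OF ell2_summable[OF assms], of p]
  by (auto simp: ell2_def component_def)

lemma dsum_inner:
  assumes "\<phi> \<in> ell2 M" "\<psi> \<in> ell2 M"
  shows "((\<lambda>p. ell2_inner (component p \<phi>) (component p \<psi>)) has_sum ell2_inner \<phi> \<psi>) UNIV"
  using has_sum_fibres[OF ell2_product_summable[OF assms]]
  by (simp add: ell2_inner_def component_def)

lemma dsum_norm_summable: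
  assumes "\<psi> \<in> ell2 M"
  shows "(\<lambda>p. (ell2_norm (component p \<psi>))\<^sup>2) summable_on UNIV"
  using has_sum_imp_summable[OF has_sum_fibres[OF ell2_summable[OF assms]]]
  by (simp add: ell2_norm_def component_def infsum_nonneg)

lemma ell2_SigmaI:
  assumes "\<And>p. p \<in> I \<Longrightarrow> component p \<psi> \<in> ell2 (J p)" "\<And>p. p \<notin> I \<Longrightarrow> component p \<psi> = 0"
    and "(\<lambda>p. (ell2_norm (component p \<psi>))\<^sup>2) summable_on UNIV"
  shows "\<psi> \<in> ell2 (Sigma I J)"
proof -
  have "(\<lambda>i. (cmod (\<psi> i))\<^sup>2) summable_on Sigma UNIV (\<lambda>_. UNIV)"
  proof (rule summable_on_SigmaI[OF _ assms(3)])
    fix p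
    have "(\<lambda>j. (cmod (component p \<psi> j))\<^sup>2) summable_on UNIV"
    proof (cases "p \<in> I")
      case True then show ?thesis using ell2_summable[OF assms(1)] by blast
    next
      case False then show ?thesis using assms(2) by simp
    qed
    from has_sum_infsum[OF this]
    show "((\<lambda>j. (cmod (\<psi> (p, j)))\<^sup>2) has_sum (ell2_norm (component p \<psi>))\<^sup>2) UNIV"
      by (simp add: ell2_norm_def component_def infsum_nonneg)
  qed auto
  moreover have "\<psi> (p, j) = 0" if "(p, j) \<notin> Sigma I J" for p j
  proof (cases "p \<in> I")
    case True
    then show ?thesis using ell2D[OF assms(1)[OF True], of j] that by (simp add: component_def)
  next
    case False
    then show ?thesis using assms(2)[OF False] by (simp add: component_def fun_eq_iff)
  qed
  ultimately show ?thesis by (auto simp: ell2_def)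
qed

lemma component_embed: "component q (embed p \<xi>) = (if q = p then \<xi> else 0)"
  by (auto simp: component_def embed_def fun_eq_iff)

lemma ell2_norm_zero: "ell2_norm 0 = 0"
  by (simp add: ell2_norm_def)

lemma embed_ell2:
  assumes "p \<in> I" "\<xi> \<in> ell2 (J p)"
  shows "embed p \<xi> \<in> ell2 (Sigma I J)"
proof (rule ell2_SigmaI)
  show "(\<lambda>q. (ell2_norm (component q (embed p \<xi>)))\<^sup>2) summable_on UNIV"
    by (rule finite_nonzero_values_imp_summable_on, rule finite_subset[of _ "{p}"])
      (auto simp: component_embed ell2_norm_zero)
qed (use assms in \<open>auto simp: component_embed ell2_zero\<close>)

lemma ell2_inner_embed: "ell2_inner (embed p \<xi>) (embed p \<eta>) = ell2_inner \<xi> \<eta>"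
proof -
  have "ell2_inner (embed p \<xi>) (embed p \<eta>) = (\<Sum>\<^sub>\<infinity>i\<in>Pair p ` UNIV. cnj (embed p \<xi> i) * embed p \<eta> i)"
    unfolding ell2_inner_def by (rule infsum_cong_neutral) (auto simp: embed_def)
  also have "\<dots> = ell2_inner \<xi> \<eta>"
    by (subst infsum_reindex) (auto simp: inj_on_def o_def embed_def ell2_inner_def)
  finally show ?thesis .
qed

lemma univ_dom_eq: "univ_dom = Sigma bi_iso_reps fst"
  and univ_cod_eq: "univ_cod = Sigma bi_iso_reps (\<lambda>p. fst (snd p))"
  by (auto simp: univ_dom_def univ_cod_def)

lemma rep_bi_isometry: "p \<in> bi_iso_reps \<Longrightarrow> bi_isometry (fst p) (fst (snd p)) (snd (snd p))"
  using bi_iso_reps_bi_isometry[of "fst p" "fst (snd p)" "snd (snd p)"] by simp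

lemma component_univ_bi_isometry:
  assumes "\<psi> \<in> ell2 univ_dom"
  shows "component p (univ_bi_isometry a x \<psi>) = (if p \<in> bi_iso_reps then snd (snd p) a x (component p \<psi>) else 0)"
  using assms unfolding univ_bi_isometry_def dsum_op_def univ_dom_def
  by (auto simp: component_def fun_eq_iff split: prod.splits)

lemma component_eq_imp_eq: "(\<And>p. component p \<phi> = component p \<psi>) \<Longrightarrow> \<phi> = \<psi>"
  by (auto simp: component_def fun_eq_iff)

lemma component_add: "component p (\<phi> + \<psi>) = component p \<phi> + component p \<psi>"
  and component_scale: "component p (c *\<^sub>C \<psi>) = c *\<^sub>C component p \<psi>"
  by (auto simp: component_def fun_eq_iff)

text \<open>The identities defining a bi-isometry hold in every summand, and inner products add up over the summands.\<close>

theorem bi_isometry_univ: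
  "bi_isometry univ_dom univ_cod (univ_bi_isometry :: 'x::finite \<Rightarrow> 'x \<Rightarrow> ('x, 'k) univ_op)"
proof (rule bi_isometryI)
  fix a x a' x' :: 'x and \<psi> \<phi> :: "('x, 'k) bi_iso \<times> 'k \<Rightarrow> complex" and c
  show "univ_bi_isometry a x \<psi> = 0" if "\<psi> \<notin> ell2 univ_dom"
    using that by (simp add: univ_bi_isometry_def dsum_op_def univ_dom_def)
  have comp: "component p \<psi> \<in> ell2 (fst p)" if "\<psi> \<in> ell2 univ_dom"
    for p :: "('x, 'k) bi_iso" and \<psi> :: "('x, 'k) bi_iso \<times> 'k \<Rightarrow> complex"
    using that component_ell2[of \<psi> bi_iso_reps fst p] unfolding univ_dom_eq by simp
  have V: "snd (snd p) a x \<in> bounded_ops (fst p) (fst (snd p))" if "p \<in> bi_iso_reps"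
    for p :: "('x, 'k) bi_iso" and a x
    by (rule bi_isometry_bounded[OF rep_bi_isometry[OF that]])
  show maps: "univ_bi_isometry a x \<psi> \<in> ell2 univ_cod" if \<psi>: "\<psi> \<in> ell2 univ_dom"
    for a x :: 'x and \<psi> :: "('x, 'k) bi_iso \<times> 'k \<Rightarrow> complex"
    unfolding univ_cod_eq
  proof (rule ell2_SigmaI)
    fix p :: "('x, 'k) bi_iso"
    show "component p (univ_bi_isometry a x \<psi>) \<in> ell2 (fst (snd p))" if "p \<in> bi_iso_reps"
      using that bounded_ops_ell2[OF V[OF that]] by (simp add: component_univ_bi_isometry[OF \<psi>])
    show "component p (univ_bi_isometry a x \<psi>) = 0" if "p \<notin> bi_iso_reps"
      using that by (simp add: component_univ_bi_isometry[OF \<psi>])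
  next
    have "ell2_norm (component p (univ_bi_isometry a x \<psi>)) \<le> ell2_norm (component p \<psi>)" for p :: "('x, 'k) bi_iso"
    proof (cases "p \<in> bi_iso_reps")
      case True
      have "ell2_norm (snd (snd p) a x (component p \<psi>)) \<le> ell2_norm (component p \<psi>)"
        by (rule column_isometry_contraction[of "\<lambda>a. snd (snd p) a x", OF bounded_ops_ell2[OF V[OF True]] comp[OF \<psi>]])
          (use bi_isometry_inner(1)[OF rep_bi_isometry[OF True] comp[OF \<psi>] comp[OF \<psi>], of x x] in simp)
      then show ?thesis using True by (simp add: component_univ_bi_isometry[OF \<psi>])
    next
      case False
      then show ?thesis by (simp add: component_univ_bi_isometry[OF \<psi>] ell2_norm_zero ell2_norm_nonneg)
    qed
    then show "(\<lambda>p. (ell2_norm (component p (univ_bi_isometry a x \<psi>)))\<^sup>2) summable_on UNIV"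
      by (intro summable_on_comparison_test[OF dsum_norm_summable[OF \<psi>]] power_mono ell2_norm_nonneg) auto
  qed
  show "univ_bi_isometry a x (\<psi> + \<phi>) = univ_bi_isometry a x \<psi> + univ_bi_isometry a x \<phi>"
    if "\<psi> \<in> ell2 univ_dom" "\<phi> \<in> ell2 univ_dom"
    by (rule component_eq_imp_eq)
      (simp add: component_add component_univ_bi_isometry that ell2_add
        bounded_ops_add[OF V comp[OF that(1)] comp[OF that(2)]])
  show "univ_bi_isometry a x (c *\<^sub>C \<psi>) = c *\<^sub>C univ_bi_isometry a x \<psi>" if "\<psi> \<in> ell2 univ_dom"
    by (rule component_eq_imp_eq)
      (simp add: component_scale component_univ_bi_isometry that ell2_scale bounded_ops_scale[OF V comp[OF that]])
  have sum: "(\<Sum>i\<in>UNIV. ell2_inner (univ_bi_isometry (f i) (g i) \<phi>) (univ_bi_isometry (f' i) (g' i) \<psi>))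
      = (if b then ell2_inner \<phi> \<psi> else 0)"
    if \<phi>: "\<phi> \<in> ell2 univ_dom" and \<psi>: "\<psi> \<in> ell2 univ_dom"
      and *: "\<And>p. p \<in> bi_iso_reps \<Longrightarrow>
        (\<Sum>i\<in>UNIV. ell2_inner (snd (snd p) (f i) (g i) (component p \<phi>)) (snd (snd p) (f' i) (g' i) (component p \<psi>)))
        = (if b then ell2_inner (component p \<phi>) (component p \<psi>) else 0)"
    for f g f' g' :: "'x \<Rightarrow> 'x" and b :: bool
  proof -
    have "((\<lambda>p. \<Sum>i\<in>UNIV. ell2_inner (component p (univ_bi_isometry (f i) (g i) \<phi>)) (component p (univ_bi_isometry (f' i) (g' i) \<psi>)))
        has_sum (\<Sum>i\<in>UNIV. ell2_inner (univ_bi_isometry (f i) (g i) \<phi>) (univ_bi_isometry (f' i) (g' i) \<psi>))) UNIV"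
      by (intro has_sum_finite_sum dsum_inner[OF maps[OF \<phi>] maps[OF \<psi>]]) simp
    moreover have "(\<Sum>i\<in>UNIV. ell2_inner (component p (univ_bi_isometry (f i) (g i) \<phi>)) (component p (univ_bi_isometry (f' i) (g' i) \<psi>)))
        = (if b then ell2_inner (component p \<phi>) (component p \<psi>) else 0)" for p :: "('x, 'k) bi_iso"
    proof (cases "p \<in> bi_iso_reps")
      case True
      then show ?thesis using *[OF True] by (simp add: component_univ_bi_isometry \<phi> \<psi>)
    next
      case False
      then have "component p \<phi> = 0"
        using ell2D[OF \<phi>] by (auto simp: component_def univ_dom_eq fun_eq_iff)
      then show ?thesis using False
        by (simp add: component_univ_bi_isometry \<phi> \<psi> ell2_inner_def)
    qed
    ultimately have "((\<lambda>p. if b then ell2_inner (component p \<phi>) (component p \<psi>) else 0)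
        has_sum (\<Sum>i\<in>UNIV. ell2_inner (univ_bi_isometry (f i) (g i) \<phi>) (univ_bi_isometry (f' i) (g' i) \<psi>))) UNIV"
      by simp
    moreover have "((\<lambda>p. if b then ell2_inner (component p \<phi>) (component p \<psi>) else 0)
        has_sum (if b then ell2_inner \<phi> \<psi> else 0)) UNIV"
      using dsum_inner[OF \<phi> \<psi>] by simp
    ultimately show ?thesis by (rule has_sum_unique)
  qed
  show "(\<Sum>a\<in>UNIV. ell2_inner (univ_bi_isometry a x \<phi>) (univ_bi_isometry a x' \<psi>)) = (if x = x' then ell2_inner \<phi> \<psi> else 0)"
    if "\<phi> \<in> ell2 univ_dom" "\<psi> \<in> ell2 univ_dom"
    by (rule sum[OF that]) (rule bi_isometry_inner(1)[OF rep_bi_isometry comp[OF that(1)] comp[OF that(2)]])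
  show "(\<Sum>x\<in>UNIV. ell2_inner (univ_bi_isometry a x \<phi>) (univ_bi_isometry a' x \<psi>)) = (if a = a' then ell2_inner \<phi> \<psi> else 0)"
    if "\<phi> \<in> ell2 univ_dom" "\<psi> \<in> ell2 univ_dom"
    by (rule sum[OF that]) (rule bi_isometry_inner(2)[OF rep_bi_isometry comp[OF that(1)] comp[OF that(2)]])
qed

text \<open>Every bi-isometry is, up to unitary equivalence, a summand of the universal one.\<close>

theorem bi_isometry_embeds:
  fixes V :: "'x::finite \<Rightarrow> 'x \<Rightarrow> ('k, 'k) op"
  assumes "bi_isometry J L V"
  obtains E :: "('k \<Rightarrow> complex) \<Rightarrow> ('x, 'k) bi_iso \<times> 'k \<Rightarrow> complex"
  where "\<And>\<xi>. \<xi> \<in> ell2 J \<Longrightarrow> E \<xi> \<in> ell2 univ_dom"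
    "\<And>a x a' x' \<xi> \<eta>. \<xi> \<in> ell2 J \<Longrightarrow> \<eta> \<in> ell2 J \<Longrightarrow>
      ell2_inner (univ_bi_isometry a x (E \<xi>)) (univ_bi_isometry a' x' (E \<eta>)) = ell2_inner (V a x \<xi>) (V a' x' \<eta>)"
proof -
  obtain J' L' V' where rep: "(J', L', V') \<in> bi_iso_reps"
    and eq: "((J, L, V), (J', L', V')) \<in> unitarily_equivalent"
    by (rule bi_isometry_equivalent_rep[OF assms])
  obtain U W where U: "unitary_op J J' U" and W: "unitary_op L L' W"
    and UW: "\<And>a x. V' a x \<circ> U = W \<circ> V a x"
    using eq unfolding unitarily_equivalent_def by blast
  define p where "p = (J', L', V')"
  have p: "p \<in> bi_iso_reps" using rep by (simp add: p_def)
  define E :: "('k \<Rightarrow> complex) \<Rightarrow> ('x, 'k) bi_iso \<times> 'k \<Rightarrow> complex" where "E \<xi> = embed p (U \<xi>)" for \<xi>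
  have Ub: "U \<in> bounded_ops J J'" using U by (simp add: unitary_op_def)
  have E: "E \<xi> \<in> ell2 univ_dom" for \<xi>
    unfolding E_def univ_dom_eq by (rule embed_ell2[OF p]) (simp add: p_def bounded_ops_ell2[OF Ub])
  have v: "univ_bi_isometry a x (E \<xi>) = embed p (W (V a x \<xi>))" for a x \<xi>
  proof (rule component_eq_imp_eq)
    fix q :: "('x, 'k) bi_iso"
    have "V' a x (U \<xi>) = W (V a x \<xi>)" using UW[of a x] by (metis comp_apply)
    moreover have "snd (snd q) a x 0 = 0" if "q \<in> bi_iso_reps"
      by (rule bounded_ops_zero[OF bi_isometry_bounded[OF rep_bi_isometry[OF that]]])
    ultimately show "component q (univ_bi_isometry a x (E \<xi>)) = component q (embed p (W (V a x \<xi>)))"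
      using p unfolding component_univ_bi_isometry[OF E] by (auto simp: component_embed E_def p_def)
  qed
  have "ell2_inner (univ_bi_isometry a x (E \<xi>)) (univ_bi_isometry a' x' (E \<eta>)) = ell2_inner (V a x \<xi>) (V a' x' \<eta>)"
    for a x a' x' \<xi> \<eta>
    unfolding v ell2_inner_embed
    by (rule unitary_op_inner[OF W bounded_ops_ell2[OF bi_isometry_bounded[OF assms]] bounded_ops_ell2[OF bi_isometry_bounded[OF assms]]])
  then show ?thesis using E by (intro that[of E])
qed

section \<open>Bistochastic block matrices and the operator system\<close>

text \<open>The index \<open>(x, a)\<close> consists of an input and an output. Values are taken in an arbitrary monoid, so that the notion
covers the generators of the operator system, with \<open>c\<close> the identity operator, as well as block matrices with
scalar entries, which are then functions of the two inner indices.\<close>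

definition bistochastic :: "('x::finite \<times> 'x \<Rightarrow> 'x \<times> 'x \<Rightarrow> 'c::comm_monoid_add) \<Rightarrow> 'c \<Rightarrow> bool"
  where "bistochastic D c \<longleftrightarrow>
    (\<forall>x x'. (\<Sum>a\<in>UNIV. D (x, a) (x', a)) = (if x = x' then c else 0)) \<and>
    (\<forall>a a'. (\<Sum>x\<in>UNIV. D (x, a) (x, a')) = (if a = a' then c else 0))"

text \<open>Linear combinations of the entries of \<open>D\<close>. Replacing \<open>D\<close> and keeping \<open>\<mu>\<close> is how a functional on the operator
system is evaluated on a combination of generators.\<close>

definition combine :: "('z::finite \<Rightarrow> 'z \<Rightarrow> complex) \<Rightarrow> ('z \<Rightarrow> 'z \<Rightarrow> 'c::complex_vector) \<Rightarrow> 'c"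
  where "combine \<mu> D = (\<Sum>z\<in>UNIV. \<Sum>z'\<in>UNIV. \<mu> z z' *\<^sub>C D z z')"

definition gens :: "'x::finite \<times> 'x \<Rightarrow> 'x \<times> 'x \<Rightarrow> ('x, 'k) univ_op"
  where "gens z z' = gen (fst z) (fst z') (snd z) (snd z')"

lemma gens_eq_adj: "gens z z' = adj univ_dom univ_cod (univ_bi_isometry (snd z) (fst z)) \<circ>
    univ_bi_isometry (snd z') (fst z')"
  by (simp add: gens_def gen_def)

lemma gens_bistochastic:
  "bistochastic (gens :: _ \<Rightarrow> _ \<Rightarrow> ('x::finite, 'k) univ_op) (id_op univ_dom)"
proof -
  have "bi_isometry univ_dom univ_cod (univ_bi_isometry :: 'x \<Rightarrow> 'x \<Rightarrow> ('x, 'k) univ_op)"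
    by (rule bi_isometry_univ)
  then show ?thesis
    unfolding bistochastic_def bi_isometry_def gens_eq_adj fst_conv snd_conv by (elim conjE) (intro conjI)
qed

lemma univ_bounded: "univ_bi_isometry a x \<in> bounded_ops univ_dom univ_cod"
  by (rule bi_isometry_bounded[OF bi_isometry_univ])

lemma gens_ell2: "gens z z' \<psi> \<in> ell2 univ_dom"
  by (simp add: gens_eq_adj bounded_ops_ell2[OF adj_bounded[OF univ_bounded]])

lemma gens_inner:
  assumes "\<phi> \<in> ell2 univ_dom"
  shows "ell2_inner \<phi> (gens z z' \<psi>) =
    ell2_inner (univ_bi_isometry (snd z) (fst z) \<phi>) (univ_bi_isometry (snd z') (fst z') \<psi>)"
  unfolding gens_eq_adj o_def
  by (rule adj_inner_right[OF univ_bounded bounded_ops_ell2[OF univ_bounded] assms])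

lemma combine_gens_inner:
  assumes "\<phi> \<in> ell2 univ_dom"
  shows "ell2_inner \<phi> (combine \<mu> gens \<psi>) = (\<Sum>z\<in>UNIV. \<Sum>z'\<in>UNIV. \<mu> z z' *
    ell2_inner (univ_bi_isometry (snd z) (fst z) \<phi>) (univ_bi_isometry (snd z') (fst z') \<psi>))"
proof -
  have e: "combine \<mu> gens \<psi> = (\<Sum>w\<in>UNIV. (case w of (z, z') \<Rightarrow> \<mu> z z') *\<^sub>C (case w of (z, z') \<Rightarrow> gens z z' \<psi>))"
    unfolding combine_def sum.cartesian_product UNIV_Times_UNIV
    by (subst sum_fun_apply) (auto intro!: sum.cong)
  have "ell2_inner \<phi> (\<Sum>w\<in>UNIV. (case w of (z, z') \<Rightarrow> \<mu> z z') *\<^sub>C (case w of (z, z') \<Rightarrow> gens z z' \<psi>))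
      = (\<Sum>w\<in>UNIV. (case w of (z, z') \<Rightarrow> \<mu> z z') * ell2_inner \<phi> (case w of (z, z') \<Rightarrow> gens z z' \<psi>))"
    by (rule ell2.sum_right[OF assms]) (simp add: gens_ell2 split: prod.split)
  then show ?thesis
    unfolding e sum.cartesian_product UNIV_Times_UNIV
    by (simp add: gens_inner[OF assms, symmetric] case_prod_unfold)
qed

lemma gen_set_eq: "{gen x x' a a' | x x' a a'. True} = {gens z z' | z z'. True}"
  unfolding gens_def by force

lemma span_gens:
  assumes "u \<in> complex_vector.span {gen x x' a a' | x x' a a'. True}"
  shows "\<exists>\<mu>. u = combine \<mu> gens"
  using assms
proof (induction rule: complex_vector.span_induct_alt)
  case base
  show ?case by (intro exI[of _ "\<lambda>_ _. 0"]) (simp add: combine_def)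
next
  case (step c g y)
  obtain z0 z0' where g: "g = gens z0 z0'" using step(1) unfolding gen_set_eq by blast
  obtain \<mu> where y: "y = combine \<mu> gens" using step(2) by blast
  have "combine (\<lambda>z z'. (if z = z0 \<and> z' = z0' then c else 0)) gens = c *\<^sub>C g"
  proof -
    have "combine (\<lambda>z z'. (if z = z0 \<and> z' = z0' then c else 0)) gens
        = (\<Sum>z\<in>UNIV. \<Sum>z'\<in>UNIV. if z' = z0' then if z = z0 then c *\<^sub>C g else 0 else 0)"
      unfolding combine_def by (intro sum.cong refl) (simp add: g)
    then show ?thesis by simp
  qed
  then have "c *\<^sub>C g + y = combine (\<lambda>z z'. (if z = z0 \<and> z' = z0' then c else 0) + \<mu> z z') gens"
    unfolding y by (simp add: combine_def scaleC_add_left sum.distrib)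
  then show ?case by blast
qed

lemma T_system_simps:
  "os_space T_system = complex_vector.span {gen x x' a a' | x x' a a'. True}"
  "os_unit T_system = id_op univ_dom"
  by (simp_all add: T_system_def subsystem_def concrete_system_def)

lemma os_pos_T_system:
  "os_pos T_system n P \<longleftrightarrow>
    (\<forall>i<n. \<forall>j<n. P i j \<in> os_space T_system \<and> P i j \<in> C_alg) \<and>
    (\<forall>\<xi>. (\<forall>i<n. \<xi> i \<in> ell2 univ_dom) \<longrightarrow> 0 \<le> (\<Sum>i<n. \<Sum>j<n. ell2_inner (\<xi> i) (P i j (\<xi> j))))"
  unfolding T_system_def subsystem_def concrete_system_def by auto

lemma form_add: "form I (M + M') \<xi> \<eta> = form I M \<xi> \<eta> + form I M' \<xi> \<eta>"
  by (simp add: form_def algebra_simps sum.distrib)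

lemma form_sum: "form I (\<Sum>a\<in>A. M a) \<xi> \<eta> = (\<Sum>a\<in>A. form I (M a) \<xi> \<eta>)"
proof (induction A rule: infinite_finite_induct)
  case (insert a A)
  then show ?case by (simp only: sum.insert form_add not_False_eq_True)
qed (simp_all add: form_def)

lemma form_zero: "form I 0 \<xi> \<eta> = 0"
  by (simp add: form_def)

lemma form_scale: "form I (c *\<^sub>C M) \<xi> \<eta> = c * form I M \<xi> \<eta>"
  by (simp add: form_def sum_distrib_left algebra_simps)

lemma form_combine: "form I (combine \<mu> D) \<xi> \<eta> = (\<Sum>z\<in>UNIV. \<Sum>z'\<in>UNIV. \<mu> z z' * form I (D z z') \<xi> \<eta>)"
  by (simp add: combine_def form_sum form_scale)

lemma form_Times:
  "form (A \<times> N) M \<xi> \<eta> =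
    (\<Sum>p\<in>A. \<Sum>p'\<in>A. form N (\<lambda>n n'. M (p, n) (p', n')) (\<lambda>n. \<xi> (p, n)) (\<lambda>n. \<eta> (p', n)))"
proof -
  have "form (A \<times> N) M \<xi> \<eta> = (\<Sum>p\<in>A. \<Sum>n\<in>N. \<Sum>p'\<in>A. \<Sum>n'\<in>N. cnj (\<xi> (p, n)) * M (p, n) (p', n') * \<eta> (p', n'))"
    unfolding form_def by (simp only: sum.cartesian_product')
  also have "\<dots> = (\<Sum>p\<in>A. \<Sum>p'\<in>A. \<Sum>n\<in>N. \<Sum>n'\<in>N. cnj (\<xi> (p, n)) * M (p, n) (p', n') * \<eta> (p', n'))"
    by (intro sum.cong refl sum.swap)
  finally show ?thesis by (simp add: form_def)
qed

lemma bistochastic_form: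
  assumes "bistochastic D c"
  shows "(\<Sum>a\<in>UNIV. form N (D (x, a) (x', a)) h g) = (if x = x' then form N c h g else 0)"
    and "(\<Sum>x\<in>UNIV. form N (D (x, a) (x, a')) h g) = (if a = a' then form N c h g else 0)"
  using assms form_sum[of N "\<lambda>a. D (x, a) (x', a)" UNIV h g] form_sum[of N "\<lambda>x. D (x, a) (x, a')" UNIV h g]
  by (auto simp: bistochastic_def form_zero)

text \<open>Factorise \<open>D\<close> as \<open>W\<^sup>* W\<close> and divide the marginal \<open>c\<close> out of \<open>W\<close> by expressing it in a
  \<open>c\<close>-orthonormal family: the result is a bi-isometry \<open>V\<close> on a finite-dimensional space, null vectors of
  \<open>c\<close> being killed by \<open>W\<close>. As \<open>V\<close> is a summand of the universal bi-isometry, positivity of \<open>P\<close>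
  can be tested on it.\<close>

theorem T_system_pos_pairing:
  fixes P :: "nat \<Rightarrow> nat \<Rightarrow> ('x::finite, 'k) univ_op"
    and D :: "'x \<times> 'x \<Rightarrow> 'x \<times> 'x \<Rightarrow> 'n \<Rightarrow> 'n \<Rightarrow> complex"
  assumes inf: "infinite (UNIV :: 'k set)" and N: "finite N"
    and psd: "psd_on (UNIV \<times> N) (\<lambda>(z, n) (z', n'). D z z' n n')"
    and bis: "bistochastic D c"
    and P: "os_pos T_system m P"
    and lam: "\<And>p p'. p < m \<Longrightarrow> p' < m \<Longrightarrow> P p p' = combine (\<mu> p p') gens"
  shows "psd_on ({..<m} \<times> N) (\<lambda>(p, n) (p', n'). combine (\<mu> p p') D n n')"
proof -
  have finite_N: "finite ((UNIV :: ('x \<times> 'x) set) \<times> N)" using N by simp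
  obtain t :: nat and w where w: "\<forall>i\<in>UNIV \<times> N. \<forall>j\<in>UNIV \<times> N.
      (case i of (z, n) \<Rightarrow> \<lambda>(z', n'). D z z' n n') j = (\<Sum>k<t. cnj (w k i) * w k j)"
    using psd_gram[OF finite_N psd] by (elim exE) (rule that)
  define W where "W z h k = (\<Sum>n\<in>N. w k (z, n) * h n)" for z :: "'x \<times> 'x" and h and k :: nat
  have DW: "form N (D z z') h g = (\<Sum>k<t. cnj (W z h k) * W z' g k)" for z z' h g
  proof -
    have "form N (D z z') h g = (\<Sum>n\<in>N. \<Sum>n'\<in>N. \<Sum>k<t. cnj (w k (z, n) * h n) * (w k (z', n') * g n'))"
      unfolding form_def
    proof (intro sum.cong refl)
      fix n n' assume "n \<in> N" "n' \<in> N"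
      then show "cnj (h n) * D z z' n n' * g n' = (\<Sum>k<t. cnj (w k (z, n) * h n) * (w k (z', n') * g n'))"
        using w[rule_format, of "(z, n)" "(z', n')"] by (simp add: sum_distrib_left sum_distrib_right algebra_simps)
    qed
    also have "\<dots> = (\<Sum>n\<in>N. \<Sum>k<t. \<Sum>n'\<in>N. cnj (w k (z, n) * h n) * (w k (z', n') * g n'))"
      by (intro sum.cong refl sum.swap)
    also have "\<dots> = (\<Sum>k<t. \<Sum>n\<in>N. \<Sum>n'\<in>N. cnj (w k (z, n) * h n) * (w k (z', n') * g n'))"
      by (rule sum.swap)
    also have "\<dots> = (\<Sum>k<t. cnj (W z h k) * W z' g k)"
      unfolding W_def cnj_sum sum_product by simp
    finally show ?thesis .
  qed
  have W_add: "W z (h + g) k = W z h k + W z g k" and W_scale: "W z (s *\<^sub>C h) k = s * W z h k" for z h g k s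
    by (simp_all add: W_def algebra_simps sum.distrib sum_distrib_left)
  have c_eq: "form N c h g = (\<Sum>a\<in>UNIV. \<Sum>k<t. cnj (W (x, a) h k) * W (x, a) g k)" for h g x
    using bistochastic_form(1)[OF bis, of N x x h g] by (simp add: DW)
  have c_psd: "psd_on N c"
    unfolding psd_on_def
  proof
    fix h
    show "0 \<le> form N c h h"
      unfolding c_eq[of h h undefined] by (intro sum_nonneg nonneg_cnj_mult_self)
  qed
  interpret c: psd_form UNIV "form N c" by (rule psd_form_of_matrix[OF c_psd])
  obtain r :: nat and b where
    b: "\<forall>i<r. \<forall>j<r. form N c (b i) (b j) = (if i = j then 1 else 0)"
    and parseval: "\<forall>\<xi> \<eta>. form N c \<xi> \<eta> = (\<Sum>k<r. form N c \<xi> (b k) * form N c (b k) \<eta>)"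
    using psd_parseval[OF N c_psd] by (elim exE conjE) (rule that)
  \<comment> \<open>For \<open>c\<close> invertible, \<open>lift\<close> is \<open>c\<^sup>-\<^sup>1\<^sup>/\<^sup>2\<close> up to a unitary, and \<open>W \<circ> lift\<close> is the bi-isometry \<open>V\<close>.\<close>
  define lift where "lift f = (\<Sum>i<r. f i *\<^sub>C b i)" for f
  have lift_right: "form N c y (lift f) = (\<Sum>i<r. f i * form N c y (b i))" for y f
    unfolding lift_def by (rule c.sum_right) simp_all
  have lift_coeff: "form N c (b k) (lift f) = f k" if "k < r" for k f
  proof -
    have "(\<Sum>i<r. f i * form N c (b k) (b i)) = (\<Sum>i<r. if k = i then f i else 0)"
      using b that by (intro sum.cong) auto
    then show ?thesis using that by (simp add: lift_right)
  qed
  have lift_inner: "form N c (lift f) (lift g) = (\<Sum>k<r. cnj (f k) * g k)" for f g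
  proof -
    have "form N c (lift f) (lift g) = (\<Sum>k<r. form N c (lift f) (b k) * form N c (b k) (lift g))"
      by (rule parseval[rule_format])
    also have "\<dots> = (\<Sum>k<r. cnj (f k) * g k)"
    proof (intro sum.cong refl)
      fix k assume k: "k \<in> {..<r}"
      have "form N c (lift f) (b k) = cnj (form N c (b k) (lift f))"
        by (rule c.hermitian) simp_all
      then show "form N c (lift f) (b k) * form N c (b k) (lift g) = cnj (f k) * g k"
        using k by (simp add: lift_coeff)
    qed
    finally show ?thesis .
  qed
  \<comment> \<open>\<open>h\<close> differs from its projection to the span of the \<open>b\<^sub>k\<close> by a \<open>c\<close>-null vector, and \<open>\<parallel>W g\<parallel>\<^sup>2\<close>, summed over outputs,
    is \<open>c (g, g)\<close>.\<close>
  have W_lift: "W z (lift (\<lambda>k. form N c (b k) h)) k = W z h k" if "k < t" for z h k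
  proof -
    define g where "g = h + (- 1) *\<^sub>C lift (\<lambda>k. form N c (b k) h)"
    have "form N c g g = form N c g h - form N c g (lift (\<lambda>k. form N c (b k) h))"
      using c.add_right[of g h "(- 1) *\<^sub>C lift (\<lambda>k. form N c (b k) h)"]
        c.scale_right[of g "lift (\<lambda>k. form N c (b k) h)" "- 1"]
      by (simp add: g_def)
    also have "form N c g (lift (\<lambda>k. form N c (b k) h)) = (\<Sum>k<r. form N c g (b k) * form N c (b k) h)"
      by (simp add: lift_right mult.commute)
    also have "\<dots> = form N c g h"
      by (rule parseval[rule_format, symmetric])
    finally have "(\<Sum>a\<in>UNIV. \<Sum>k<t. cnj (W (fst z, a) g k) * W (fst z, a) g k) = 0"
      using c_eq[of g g "fst z"] by simp
    then have "(\<Sum>k<t. cnj (W (fst z, a) g k) * W (fst z, a) g k) = 0" for a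
      by (subst (asm) sum_nonneg_eq_0_iff) (auto intro!: sum_nonneg nonneg_cnj_mult_self)
    then have "cnj (W z g k) * W z g k = 0"
      using that sum_nonneg_eq_0_iff[of "{..<t}" "\<lambda>k. cnj (W z g k) * W z g k"] nonneg_cnj_mult_self
      by (metis finite_lessThan lessThan_iff prod.collapse)
    then have "W z g k = 0" by simp
    then show ?thesis unfolding g_def W_add W_scale by simp
  qed
  obtain \<iota> :: "nat \<Rightarrow> 'k" where \<iota>: "inj \<iota>"
    using infinite_countable_subset[OF inf] by blast
  define \<kappa> where "\<kappa> = inv \<iota>"
  have \<kappa>: "\<kappa> (\<iota> i) = i" for i using \<iota> by (simp add: \<kappa>_def)
  \<comment> \<open>The finite-dimensional spaces are realised on finite subsets of the type that bounds the dimensions.\<close>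
  define J L where "J = \<iota> ` {..<r}" and "L = \<iota> ` {..<t}"
  have fin: "finite J" "finite L" by (simp_all add: J_def L_def)
  define V where "V a x \<psi> = (if \<psi> \<in> ell2 J
    then (\<lambda>l. if l \<in> L then W (x, a) (lift (\<psi> \<circ> \<iota>)) (\<kappa> l) else 0) else 0)" for a x :: 'x and \<psi>
  have inner_J: "ell2_inner \<phi> \<psi> = (\<Sum>i<r. cnj (\<phi> (\<iota> i)) * \<psi> (\<iota> i))" if "\<phi> \<in> ell2 J" for \<phi> \<psi>
  proof -
    have "ell2_inner \<phi> \<psi> = (\<Sum>j\<in>J. cnj (\<phi> j) * \<psi> j)"
      by (rule ell2_inner_finite_support[OF fin(1)]) (use ell2D[OF that] in blast)
    then show ?thesis unfolding J_def using \<iota> by (simp add: sum.reindex inj_on_def)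
  qed
  have V_inner: "ell2_inner (V a x \<phi>) (V a' x' \<psi>) = form N (D (x, a) (x', a')) (lift (\<phi> \<circ> \<iota>)) (lift (\<psi> \<circ> \<iota>))"
    if "\<phi> \<in> ell2 J" "\<psi> \<in> ell2 J" for a x a' x' \<phi> \<psi>
  proof -
    have "ell2_inner (V a x \<phi>) (V a' x' \<psi>) = (\<Sum>l\<in>L. cnj (V a x \<phi> l) * V a' x' \<psi> l)"
      by (rule ell2_inner_finite_support[OF fin(2)]) (simp add: V_def)
    also have "\<dots> = (\<Sum>k<t. cnj (W (x, a) (lift (\<phi> \<circ> \<iota>)) k) * W (x', a') (lift (\<psi> \<circ> \<iota>)) k)"
      unfolding L_def using \<iota> that by (simp add: sum.reindex inj_on_def V_def L_def \<kappa>)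
    finally show ?thesis by (simp add: DW)
  qed
  have marg: "form N c (lift (\<phi> \<circ> \<iota>)) (lift (\<psi> \<circ> \<iota>)) = ell2_inner \<phi> \<psi>" if "\<phi> \<in> ell2 J" for \<phi> \<psi>
    using inner_J[OF that] by (simp add: lift_inner)
  have "bi_isometry J L V"
  proof (rule bi_isometryI)
    fix a x a' x' :: 'x and \<psi> \<phi> :: "'k \<Rightarrow> complex" and s
    show "V a x \<psi> = 0" if "\<psi> \<notin> ell2 J" using that by (simp add: V_def)
    show "V a x \<psi> \<in> ell2 L" if "\<psi> \<in> ell2 J"
      by (rule finite_support_ell2[OF fin(2)]) (auto simp: V_def)
    have la: "lift ((\<psi> + \<phi>) \<circ> \<iota>) = lift (\<psi> \<circ> \<iota>) + lift (\<phi> \<circ> \<iota>)"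
      by (simp add: lift_def scaleC_add_left sum.distrib)
    have ls: "lift ((s *\<^sub>C \<psi>) \<circ> \<iota>) = s *\<^sub>C lift (\<psi> \<circ> \<iota>)"
      by (simp add: lift_def complex_vector.scale_sum_right)
    show "V a x (\<psi> + \<phi>) = V a x \<psi> + V a x \<phi>" if "\<psi> \<in> ell2 J" "\<phi> \<in> ell2 J"
      using that by (simp add: V_def ell2_add la W_add fun_eq_iff)
    show "V a x (s *\<^sub>C \<psi>) = s *\<^sub>C V a x \<psi>" if "\<psi> \<in> ell2 J"
      using that by (simp add: V_def ell2_scale ls W_scale fun_eq_iff)
    show "(\<Sum>a\<in>UNIV. ell2_inner (V a x \<phi>) (V a x' \<psi>)) = (if x = x' then ell2_inner \<phi> \<psi> else 0)"
      if "\<phi> \<in> ell2 J" "\<psi> \<in> ell2 J"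
      unfolding V_inner[OF that] bistochastic_form(1)[OF bis] marg[OF that(1)] ..
    show "(\<Sum>x\<in>UNIV. ell2_inner (V a x \<phi>) (V a' x \<psi>)) = (if a = a' then ell2_inner \<phi> \<psi> else 0)"
      if "\<phi> \<in> ell2 J" "\<psi> \<in> ell2 J"
      unfolding V_inner[OF that] bistochastic_form(2)[OF bis] marg[OF that(1)] ..
  qed
  then obtain E :: "('k \<Rightarrow> complex) \<Rightarrow> ('x, 'k) bi_iso \<times> 'k \<Rightarrow> complex"
    where E: "\<And>\<xi>. \<xi> \<in> ell2 J \<Longrightarrow> E \<xi> \<in> ell2 univ_dom"
    and EV: "\<And>a x a' x' \<xi> \<eta>. \<xi> \<in> ell2 J \<Longrightarrow> \<eta> \<in> ell2 J \<Longrightarrow>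
      ell2_inner (univ_bi_isometry a x (E \<xi>)) (univ_bi_isometry a' x' (E \<eta>)) = ell2_inner (V a x \<xi>) (V a' x' \<eta>)"
    by (rule bi_isometry_embeds) (rule that)
  show ?thesis
    unfolding psd_on_def
  proof
    fix \<eta> :: "nat \<times> 'n \<Rightarrow> complex"
    define h where "h p n = \<eta> (p, n)" for p n
    \<comment> \<open>The \<open>c\<close>-coordinates of \<open>h p\<close>, so that \<open>V \<xi>\<^sub>p = W h\<^sub>p\<close>.\<close>
    define \<xi> where "\<xi> p j = (if j \<in> J then form N c (b (\<kappa> j)) (h p) else 0)" for p j
    have \<xi>: "\<xi> p \<in> ell2 J" for p
      by (rule finite_support_ell2[OF fin(1)]) (simp_all add: \<xi>_def)
    have lift_\<xi>: "lift (\<xi> p \<circ> \<iota>) = lift (\<lambda>k. form N c (b k) (h p))" for p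
      unfolding lift_def by (intro sum.cong) (auto simp: \<xi>_def J_def \<kappa>)
    have "ell2_inner (E (\<xi> p)) (P p p' (E (\<xi> p'))) = form N (combine (\<mu> p p') D) (h p) (h p')"
      if "p < m" "p' < m" for p p'
    proof -
      have "form N (D z z') (lift (\<xi> p \<circ> \<iota>)) (lift (\<xi> p' \<circ> \<iota>)) = form N (D z z') (h p) (h p')" for z z'
        unfolding DW lift_\<xi> by (simp add: W_lift)
      then show ?thesis
        unfolding lam[OF that] combine_gens_inner[OF E[OF \<xi>]] EV[OF \<xi> \<xi>] V_inner[OF \<xi> \<xi>] form_combine
        by simp
    qed
    then have "(\<Sum>p<m. \<Sum>p'<m. form N (combine (\<mu> p p') D) (h p) (h p'))
        = (\<Sum>p<m. \<Sum>p'<m. ell2_inner (E (\<xi> p)) (P p p' (E (\<xi> p'))))"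
      by simp
    also have "0 \<le> \<dots>"
      using P[unfolded os_pos_T_system, THEN conjunct2, rule_format, of "\<lambda>p. E (\<xi> p)"] E[OF \<xi>] by simp
    finally show "0 \<le> form ({..<m} \<times> N) (\<lambda>(p, n) (p', n'). combine (\<mu> p p') D n n') \<eta> \<eta>"
      by (simp add: form_Times h_def[abs_def])
  qed
qed

section \<open>Choi matrices of bicorrelations\<close>

text \<open>The inverse of the Choi correspondence: the map whose Choi matrix is \<open>K\<close>.\<close>

definition choi_map :: "('u::finite \<times> 'p::finite \<Rightarrow> 'u \<times> 'p \<Rightarrow> complex) \<Rightarrow> 'u cmat \<Rightarrow> 'p cmat"
  where "choi_map K \<rho> = (\<chi> p q. \<Sum>u\<in>UNIV. \<Sum>v\<in>UNIV. \<rho> $ u $ v * K (u, p) (v, q))"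

definition choi_matrix :: "('u::finite cmat \<Rightarrow> 'p::finite cmat) \<Rightarrow> 'u \<times> 'p \<Rightarrow> 'u \<times> 'p \<Rightarrow> complex"
  where "choi_matrix \<Gamma> = (\<lambda>(u, p) (v, q). \<Gamma> (matrix_unit u v) $ p $ q)"

lemma choi_map_nth: "choi_map K \<rho> $ p $ q = (\<Sum>u\<in>UNIV. \<Sum>v\<in>UNIV. \<rho> $ u $ v * K (u, p) (v, q))"
  by (simp add: choi_map_def)

lemma matrix_unit_nth: "matrix_unit u v $ i $ j = (if i = u \<and> j = v then 1 else 0)"
  by (simp add: matrix_unit_def)

lemma sum_matrix_unit: "(\<Sum>i\<in>UNIV. \<Sum>j\<in>UNIV. matrix_unit u v $ i $ j * f i j) = f u v"
proof -
  have "(\<Sum>i\<in>UNIV. \<Sum>j\<in>UNIV. matrix_unit u v $ i $ j * f i j)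
      = (\<Sum>i\<in>UNIV. \<Sum>j\<in>UNIV. if j = v then if i = u then f i j else 0 else 0)"
    by (intro sum.cong refl) (simp add: matrix_unit_nth)
  then show ?thesis by simp
qed

lemma choi_map_matrix_unit: "choi_map K (matrix_unit u v) $ p $ q = K (u, p) (v, q)"
  unfolding choi_map_nth by (rule sum_matrix_unit)

lemma scaleC_vec_nth [simp]: "(c *\<^sub>C M) $ i = c *\<^sub>C M $ i"
  by (simp add: scaleC_vec_def)

lemma clinear_choi_map: "clinear (choi_map K)"
  unfolding Vector_Spaces.linear_iff
  by (intro conjI complex_vector.vector_space_axioms allI)
    (simp_all add: vec_eq_iff choi_map_nth algebra_simps sum.distrib sum_distrib_left)

lemma matrix_unit_expansion: "\<rho> = (\<Sum>u\<in>UNIV. \<Sum>v\<in>UNIV. (\<rho> $ u $ v) *\<^sub>C matrix_unit u v)"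
proof -
  have "(\<Sum>u\<in>UNIV. \<Sum>v\<in>UNIV. (\<rho> $ u $ v) *\<^sub>C matrix_unit u v) $ i $ j = \<rho> $ i $ j" for i j
  proof -
    have "(\<Sum>u\<in>UNIV. \<Sum>v\<in>UNIV. (\<rho> $ u $ v) *\<^sub>C matrix_unit u v) $ i $ j
        = (\<Sum>u\<in>UNIV. \<Sum>v\<in>UNIV. if v = j then if u = i then \<rho> $ u $ v else 0 else 0)"
      unfolding sum_component by (intro sum.cong refl) (auto simp: matrix_unit_nth)
    then show ?thesis by simp
  qed
  then show ?thesis by (simp add: vec_eq_iff)
qed

lemma choi_map_choi_matrix:
  assumes "clinear \<Gamma>"
  shows "choi_map (choi_matrix \<Gamma>) = \<Gamma>"
proof
  fix \<rho>
  interpret \<Gamma>: Vector_Spaces.linear scaleC scaleC \<Gamma> by (rule assms)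
  have "\<Gamma> \<rho> = (\<Sum>u\<in>UNIV. \<Sum>v\<in>UNIV. (\<rho> $ u $ v) *\<^sub>C \<Gamma> (matrix_unit u v))"
    by (subst matrix_unit_expansion) (simp only: \<Gamma>.sum \<Gamma>.scale)
  then show "choi_map (choi_matrix \<Gamma>) \<rho> = \<Gamma> \<rho>"
    by (simp add: vec_eq_iff choi_map_nth choi_matrix_def sum_component)
qed

lemma psd_block_iff_form:
  "psd_block n \<rho> \<longleftrightarrow> (\<forall>\<xi> :: nat \<Rightarrow> complex ^ 'x::finite.
    0 \<le> (\<Sum>i<n. \<Sum>j<n. form UNIV (\<lambda>p q. \<rho> i j $ p $ q) (\<lambda>p. \<xi> i $ p) (\<lambda>q. \<xi> j $ q)))"
  by (simp add: psd_block_def form_def)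

text \<open>Choi's theorem. A Gram factorisation of the Choi matrix is a Kraus decomposition of the map.\<close>

lemma completely_positive_choi_map:
  fixes K :: "'u::finite \<times> 'p::finite \<Rightarrow> 'u \<times> 'p \<Rightarrow> complex"
  shows "completely_positive (choi_map K) \<longleftrightarrow> psd_on UNIV K"
proof
  assume cp: "completely_positive (choi_map K)"
  \<comment> \<open>The matrix of all matrix units is positive, and its image under the map is the Choi matrix.\<close>
  define n where "n = card (UNIV :: 'u set)"
  obtain e :: "nat \<Rightarrow> 'u" where e: "bij_betw e {..<n} UNIV"
    using ex_bij_betw_nat_finite[of "UNIV :: 'u set"] unfolding n_def atLeast0LessThan by auto
  have "psd_block n (\<lambda>i j. matrix_unit (e i) (e j))"
    unfolding psd_block_iff_form
  proof
    fix \<xi> :: "nat \<Rightarrow> complex ^ 'u"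
    have "(\<Sum>i<n. \<Sum>j<n. form UNIV (\<lambda>p q. matrix_unit (e i) (e j) $ p $ q) (\<lambda>p. \<xi> i $ p) (\<lambda>q. \<xi> j $ q))
        = (\<Sum>i<n. \<Sum>j<n. cnj (\<xi> i $ e i) * (\<xi> j $ e j))"
    proof (intro sum.cong refl)
      fix i j
      show "form UNIV (\<lambda>p q. matrix_unit (e i) (e j) $ p $ q) (\<lambda>p. \<xi> i $ p) (\<lambda>q. \<xi> j $ q)
          = cnj (\<xi> i $ e i) * (\<xi> j $ e j)"
        using sum_matrix_unit[of "e i" "e j" "\<lambda>p q. cnj (\<xi> i $ p) * (\<xi> j $ q)"]
        by (simp add: form_def mult_ac)
    qed
    also have "\<dots> = cnj (\<Sum>i<n. \<xi> i $ e i) * (\<Sum>i<n. \<xi> i $ e i)"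
      by (simp add: sum_product)
    finally show "0 \<le> (\<Sum>i<n. \<Sum>j<n. form UNIV (\<lambda>p q. matrix_unit (e i) (e j) $ p $ q) (\<lambda>p. \<xi> i $ p) (\<lambda>q. \<xi> j $ q))"
      by (simp only: nonneg_cnj_mult_self)
  qed
  then have pos: "psd_block n (\<lambda>i j. choi_map K (matrix_unit (e i) (e j)))"
    using cp unfolding completely_positive_def by blast
  show "psd_on UNIV K"
    unfolding psd_on_def
  proof
    fix \<zeta> :: "'u \<times> 'p \<Rightarrow> complex"
    have "form UNIV K \<zeta> \<zeta> = (\<Sum>u\<in>UNIV. \<Sum>v\<in>UNIV. form UNIV (\<lambda>p q. K (u, p) (v, q)) (\<lambda>p. \<zeta> (u, p)) (\<lambda>q. \<zeta> (v, q)))"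
      using form_Times[of UNIV UNIV K \<zeta> \<zeta>] by simp
    also have "\<dots> = (\<Sum>i<n. \<Sum>j<n. form UNIV (\<lambda>p q. K (e i, p) (e j, q)) (\<lambda>p. \<zeta> (e i, p)) (\<lambda>q. \<zeta> (e j, q)))"
      by (simp add: sum.reindex_bij_betw[OF e, symmetric])
    also have "0 \<le> \<dots>"
      using pos[unfolded psd_block_iff_form, rule_format, of "\<lambda>i. \<chi> p. \<zeta> (e i, p)"]
      by (simp add: form_def choi_map_matrix_unit)
    finally show "0 \<le> form UNIV K \<zeta> \<zeta>" .
  qed
next
  assume psd: "psd_on UNIV K"
  obtain t :: nat and w where w: "\<forall>i\<in>UNIV. \<forall>j\<in>UNIV. K i j = (\<Sum>k<t. cnj (w k i) * w k j)"
    using psd_gram[OF finite psd] by (elim exE) (rule that)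
  show "completely_positive (choi_map K)"
    unfolding completely_positive_def
  proof (intro allI impI)
    fix n :: nat and \<rho> :: "nat \<Rightarrow> nat \<Rightarrow> 'u cmat"
    assume \<rho>: "psd_block n \<rho>"
    show "psd_block n (\<lambda>i j. choi_map K (\<rho> i j))"
      unfolding psd_block_iff_form
    proof
      fix \<xi> :: "nat \<Rightarrow> complex ^ 'p"
      define \<eta> where "\<eta> k i = (\<chi> u. \<Sum>p\<in>UNIV. w k (u, p) * \<xi> i $ p)" for k i
      have "form UNIV (\<lambda>p q. choi_map K (\<rho> i j) $ p $ q) (\<lambda>p. \<xi> i $ p) (\<lambda>q. \<xi> j $ q)
          = (\<Sum>k<t. form UNIV (\<lambda>u v. \<rho> i j $ u $ v) (\<lambda>u. \<eta> k i $ u) (\<lambda>v. \<eta> k j $ v))" for i j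
      proof -
        let ?t = "\<lambda>k u v p q. cnj (w k (u, p) * \<xi> i $ p) * (\<rho> i j $ u $ v) * (w k (v, q) * \<xi> j $ q)"
        have "form UNIV (\<lambda>p q. choi_map K (\<rho> i j) $ p $ q) (\<lambda>p. \<xi> i $ p) (\<lambda>q. \<xi> j $ q)
            = (\<Sum>p\<in>UNIV. \<Sum>q\<in>UNIV. \<Sum>u\<in>UNIV. \<Sum>v\<in>UNIV. \<Sum>k<t. ?t k u v p q)"
          unfolding form_def choi_map_nth
          by (simp add: w sum_distrib_left sum_distrib_right mult_ac)
        also have "\<dots> = (\<Sum>(p, q, u, v, k)\<in>UNIV \<times> UNIV \<times> UNIV \<times> UNIV \<times> {..<t}. ?t k u v p q)"
          by (simp only: sum.cartesian_product' case_prod_conv)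
        also have "\<dots> = (\<Sum>(k, u, v, q, p)\<in>{..<t} \<times> UNIV \<times> UNIV \<times> UNIV \<times> UNIV. ?t k u v p q)"
          by (rule sum.reindex_bij_witness[of _ "\<lambda>(k, u, v, q, p). (p, q, u, v, k)" "\<lambda>(p, q, u, v, k). (k, u, v, q, p)"])
            auto
        also have "\<dots> = (\<Sum>k<t. \<Sum>u\<in>UNIV. \<Sum>v\<in>UNIV. \<Sum>q\<in>UNIV. \<Sum>p\<in>UNIV. ?t k u v p q)"
          by (simp only: sum.cartesian_product' case_prod_conv)
        also have "\<dots> = (\<Sum>k<t. form UNIV (\<lambda>u v. \<rho> i j $ u $ v) (\<lambda>u. \<eta> k i $ u) (\<lambda>v. \<eta> k j $ v))"
          unfolding form_def \<eta>_def by (simp add: sum_distrib_left sum_distrib_right)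
        finally show ?thesis .
      qed
      then have "(\<Sum>i<n. \<Sum>j<n. form UNIV (\<lambda>p q. choi_map K (\<rho> i j) $ p $ q) (\<lambda>p. \<xi> i $ p) (\<lambda>q. \<xi> j $ q))
          = (\<Sum>i<n. \<Sum>j<n. \<Sum>k<t. form UNIV (\<lambda>u v. \<rho> i j $ u $ v) (\<lambda>u. \<eta> k i $ u) (\<lambda>v. \<eta> k j $ v))"
        by simp
      also have "\<dots> = (\<Sum>i<n. \<Sum>k<t. \<Sum>j<n. form UNIV (\<lambda>u v. \<rho> i j $ u $ v) (\<lambda>u. \<eta> k i $ u) (\<lambda>v. \<eta> k j $ v))"
        by (intro sum.cong refl sum.swap)
      also have "\<dots> = (\<Sum>k<t. \<Sum>i<n. \<Sum>j<n. form UNIV (\<lambda>u v. \<rho> i j $ u $ v) (\<lambda>u. \<eta> k i $ u) (\<lambda>v. \<eta> k j $ v))"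
        by (rule sum.swap)
      also have "0 \<le> \<dots>"
        by (rule sum_nonneg) (rule \<rho>[unfolded psd_block_iff_form, rule_format])
      finally show "0 \<le> (\<Sum>i<n. \<Sum>j<n. form UNIV (\<lambda>p q. choi_map K (\<rho> i j) $ p $ q) (\<lambda>p. \<xi> i $ p) (\<lambda>q. \<xi> j $ q))" .
    qed
  qed
qed

lemma trace_matrix_unit: "trace (matrix_unit u v) = (if u = v then 1 else 0)"
proof -
  have "trace (matrix_unit u v) = (\<Sum>i\<in>UNIV. if i = u then if u = v then 1 else 0 else 0)"
    unfolding trace_def by (intro sum.cong) (auto simp: matrix_unit_nth)
  then show ?thesis by simp
qed

lemma trace_choi_map:
  "trace (choi_map K \<rho>) = (\<Sum>u\<in>UNIV. \<Sum>v\<in>UNIV. \<rho> $ u $ v * (\<Sum>p\<in>UNIV. K (u, p) (v, p)))"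
proof -
  have "trace (choi_map K \<rho>) = (\<Sum>u\<in>UNIV. \<Sum>p\<in>UNIV. \<Sum>v\<in>UNIV. \<rho> $ u $ v * K (u, p) (v, p))"
    unfolding trace_def choi_map_nth by (rule sum.swap)
  also have "\<dots> = (\<Sum>u\<in>UNIV. \<Sum>v\<in>UNIV. \<Sum>p\<in>UNIV. \<rho> $ u $ v * K (u, p) (v, p))"
    by (intro sum.cong refl sum.swap)
  finally show ?thesis by (simp add: sum_distrib_left)
qed

lemma trace_preserving_choi_map:
  "(\<forall>\<rho>. trace (choi_map K \<rho>) = trace \<rho>) \<longleftrightarrow>
    (\<forall>u v. (\<Sum>p\<in>UNIV. K (u, p) (v, p)) = (if u = v then 1 else 0))"
proof
  assume *: "\<forall>\<rho>. trace (choi_map K \<rho>) = trace \<rho>"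
  show "\<forall>u v. (\<Sum>p\<in>UNIV. K (u, p) (v, p)) = (if u = v then 1 else 0)"
  proof (intro allI)
    fix u v
    show "(\<Sum>p\<in>UNIV. K (u, p) (v, p)) = (if u = v then 1 else 0)"
      using *[rule_format, of "matrix_unit u v"] unfolding trace_choi_map sum_matrix_unit trace_matrix_unit .
  qed
next
  assume *: "\<forall>u v. (\<Sum>p\<in>UNIV. K (u, p) (v, p)) = (if u = v then 1 else 0)"
  show "\<forall>\<rho>. trace (choi_map K \<rho>) = trace \<rho>"
    unfolding trace_choi_map *[rule_format] by (simp add: trace_def if_distrib cong: if_cong)
qed

text \<open>The off-diagonal matrix units and the differences of diagonal ones are traceless, and they span the traceless
matrices. With \<open>m\<close> a marginal of a Choi matrix, this turns the no-signalling condition into an identity.\<close>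

lemma functional_vanishing_on_traceless:
  fixes m :: "'x::finite \<Rightarrow> 'x \<Rightarrow> complex"
  shows "(\<forall>\<rho>. trace \<rho> = 0 \<longrightarrow> (\<Sum>x\<in>UNIV. \<Sum>x'\<in>UNIV. \<rho> $ x $ x' * m x x') = 0) \<longleftrightarrow>
    (\<exists>c. \<forall>x x'. m x x' = (if x = x' then c else 0))"
proof
  assume *: "\<forall>\<rho>. trace \<rho> = 0 \<longrightarrow> (\<Sum>x\<in>UNIV. \<Sum>x'\<in>UNIV. \<rho> $ x $ x' * m x x') = 0"
  have off: "m x x' = 0" if "x \<noteq> x'" for x x'
    using *[rule_format, of "matrix_unit x x'"] that by (simp add: trace_matrix_unit sum_matrix_unit)
  have diag: "m x x = m x' x'" for x x'
  proof -
    have "(\<Sum>i\<in>UNIV. \<Sum>j\<in>UNIV. (matrix_unit x x - matrix_unit x' x') $ i $ j * m i j) = 0"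
      by (rule *[rule_format]) (simp add: trace_sub trace_matrix_unit)
    then show ?thesis
      by (simp add: left_diff_distrib sum_subtractf sum_matrix_unit)
  qed
  show "\<exists>c. \<forall>x x'. m x x' = (if x = x' then c else 0)"
    by (intro exI[of _ "m undefined undefined"] allI) (auto simp: off intro: diag)
next
  assume "\<exists>c. \<forall>x x'. m x x' = (if x = x' then c else 0)"
  then obtain c where c: "\<forall>x x'. m x x' = (if x = x' then c else 0)" by blast
  show "\<forall>\<rho>. trace \<rho> = 0 \<longrightarrow> (\<Sum>x\<in>UNIV. \<Sum>x'\<in>UNIV. \<rho> $ x $ x' * m x x') = 0"
  proof (intro allI impI)
    fix \<rho> :: "'x cmat" assume "trace \<rho> = 0"
    have "(\<Sum>x\<in>UNIV. \<Sum>x'\<in>UNIV. \<rho> $ x $ x' * m x x') = (\<Sum>x\<in>UNIV. \<rho> $ x $ x * c)"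
      unfolding c[rule_format] by (simp add: if_distrib cong: if_cong)
    also have "\<dots> = trace \<rho> * c" by (simp add: trace_def sum_distrib_right)
    finally show "(\<Sum>x\<in>UNIV. \<Sum>x'\<in>UNIV. \<rho> $ x $ x' * m x x') = 0"
      using \<open>trace \<rho> = 0\<close> by simp
  qed
qed

text \<open>The Choi matrix of a bipartite map, with the indices of the first party and those of the second
  grouped together.\<close>

definition regroup :: "(('x \<times> 'y) \<times> ('a \<times> 'b) \<Rightarrow> ('x \<times> 'y) \<times> ('a \<times> 'b) \<Rightarrow> complex) \<Rightarrow>
    'x \<times> 'a \<Rightarrow> 'x \<times> 'a \<Rightarrow> 'y \<times> 'b \<Rightarrow> 'y \<times> 'b \<Rightarrow> complex"
  where "regroup K z z' w w' =
    K ((fst z, fst w), (snd z, snd w)) ((fst z', fst w'), (snd z', snd w'))"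

text \<open>The partial trace over the output is a multiple of the identity on the inputs.\<close>

definition scalar_marginal :: "('x \<times> 'a::finite \<Rightarrow> 'x \<times> 'a \<Rightarrow> 'w \<Rightarrow> 'w \<Rightarrow> complex) \<Rightarrow> bool"
  where "scalar_marginal R \<longleftrightarrow>
    (\<forall>w w'. \<exists>c. \<forall>x x'. (\<Sum>a\<in>UNIV. R (x, a) (x', a) w w') = (if x = x' then c else 0))"

lemma sum_UNIV_prod: "(\<Sum>u\<in>UNIV. f u) = (\<Sum>x\<in>UNIV. \<Sum>y\<in>UNIV. f (x :: 'x::finite, y :: 'y::finite))"
  by (metis UNIV_Times_UNIV sum.cartesian_product')

text \<open>Here \<open>G \<rho> \<sigma>\<close> stands for the partial trace of \<open>\<Gamma> (\<rho> \<otimes> \<sigma>)\<close> over the output of the party that receives \<open>\<rho>\<close>. It is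
kept abstract because the same argument serves for both parties.\<close>

lemma no_signalling_iff_scalar_marginal:
  fixes G :: "'x::finite cmat \<Rightarrow> 'y::finite cmat \<Rightarrow> 'b::finite cmat"
    and R :: "'x \<times> 'a::finite \<Rightarrow> 'x \<times> 'a \<Rightarrow> 'y \<times> 'b \<Rightarrow> 'y \<times> 'b \<Rightarrow> complex"
  assumes G: "\<And>\<rho> \<sigma> b b'. G \<rho> \<sigma> $ b $ b' = (\<Sum>y\<in>UNIV. \<Sum>y'\<in>UNIV. \<sigma> $ y $ y' *
      (\<Sum>x\<in>UNIV. \<Sum>x'\<in>UNIV. \<rho> $ x $ x' * (\<Sum>a\<in>UNIV. R (x, a) (x', a) (y, b) (y', b'))))"
  shows "(\<forall>\<rho> \<sigma>. trace \<rho> = 0 \<longrightarrow> G \<rho> \<sigma> = 0) \<longleftrightarrow> scalar_marginal R"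
proof
  assume *: "\<forall>\<rho> \<sigma>. trace \<rho> = 0 \<longrightarrow> G \<rho> \<sigma> = 0"
  show "scalar_marginal R"
    unfolding scalar_marginal_def functional_vanishing_on_traceless[symmetric]
  proof (intro allI impI)
    fix w w' :: "'y \<times> 'b" and \<rho> :: "'x cmat"
    assume "trace \<rho> = 0"
    then have "G \<rho> (matrix_unit (fst w) (fst w')) $ snd w $ snd w' = 0" using * by simp
    then show "(\<Sum>x\<in>UNIV. \<Sum>x'\<in>UNIV. \<rho> $ x $ x' * (\<Sum>a\<in>UNIV. R (x, a) (x', a) w w')) = 0"
      unfolding G sum_matrix_unit by simp
  qed
next
  assume *: "scalar_marginal R"
  have "(\<Sum>x\<in>UNIV. \<Sum>x'\<in>UNIV. \<rho> $ x $ x' * (\<Sum>a\<in>UNIV. R (x, a) (x', a) w w')) = 0"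
    if "trace \<rho> = 0" for \<rho> w w'
    using *[unfolded scalar_marginal_def, rule_format, of w w',
        folded functional_vanishing_on_traceless] that by blast
  then show "\<forall>\<rho> \<sigma>. trace \<rho> = 0 \<longrightarrow> G \<rho> \<sigma> = 0"
    by (simp add: vec_eq_iff G)
qed

lemma kron_nth: "kron \<rho> \<sigma> $ (x, y) $ (x', y') = \<rho> $ x $ x' * \<sigma> $ y $ y'"
  by (simp add: kron_def)

lemma ptrace_fst_choi_map:
  "ptrace_fst (choi_map K (kron \<rho> \<sigma>)) $ b $ b' = (\<Sum>y\<in>UNIV. \<Sum>y'\<in>UNIV. \<sigma> $ y $ y' *
    (\<Sum>x\<in>UNIV. \<Sum>x'\<in>UNIV. \<rho> $ x $ x' * (\<Sum>a\<in>UNIV. regroup K (x, a) (x', a) (y, b) (y', b'))))"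
proof -
  let ?t = "\<lambda>a x y x' y'. \<rho> $ x $ x' * \<sigma> $ y $ y' * K ((x, y), (a, b)) ((x', y'), (a, b'))"
  have "ptrace_fst (choi_map K (kron \<rho> \<sigma>)) $ b $ b'
      = (\<Sum>a\<in>UNIV. \<Sum>x\<in>UNIV. \<Sum>y\<in>UNIV. \<Sum>x'\<in>UNIV. \<Sum>y'\<in>UNIV. ?t a x y x' y')"
    by (simp add: ptrace_fst_def choi_map_nth sum_UNIV_prod kron_nth)
  also have "\<dots> = (\<Sum>(a, x, y, x', y')\<in>UNIV \<times> UNIV \<times> UNIV \<times> UNIV \<times> UNIV. ?t a x y x' y')"
    by (simp only: sum.cartesian_product' case_prod_conv)
  also have "\<dots> = (\<Sum>(y, y', x, x', a)\<in>UNIV \<times> UNIV \<times> UNIV \<times> UNIV \<times> UNIV. ?t a x y x' y')"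
    by (rule sum.reindex_bij_witness[of _ "\<lambda>(y, y', x, x', a). (a, x, y, x', y')" "\<lambda>(a, x, y, x', y'). (y, y', x, x', a)"])
      auto
  also have "\<dots> = (\<Sum>y\<in>UNIV. \<Sum>y'\<in>UNIV. \<Sum>x\<in>UNIV. \<Sum>x'\<in>UNIV. \<Sum>a\<in>UNIV. ?t a x y x' y')"
    by (simp only: sum.cartesian_product' case_prod_conv)
  finally show ?thesis
    by (simp add: sum_distrib_left regroup_def mult_ac)
qed

lemma ptrace_snd_choi_map:
  "ptrace_snd (choi_map K (kron \<rho> \<sigma>)) $ a $ a' = (\<Sum>x\<in>UNIV. \<Sum>x'\<in>UNIV. \<rho> $ x $ x' *
    (\<Sum>y\<in>UNIV. \<Sum>y'\<in>UNIV. \<sigma> $ y $ y' * (\<Sum>b\<in>UNIV. regroup K (x, a) (x', a') (y, b) (y', b))))"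
proof -
  let ?t = "\<lambda>b x y x' y'. \<rho> $ x $ x' * \<sigma> $ y $ y' * K ((x, y), (a, b)) ((x', y'), (a', b))"
  have "ptrace_snd (choi_map K (kron \<rho> \<sigma>)) $ a $ a'
      = (\<Sum>b\<in>UNIV. \<Sum>x\<in>UNIV. \<Sum>y\<in>UNIV. \<Sum>x'\<in>UNIV. \<Sum>y'\<in>UNIV. ?t b x y x' y')"
    by (simp add: ptrace_snd_def choi_map_nth sum_UNIV_prod kron_nth)
  also have "\<dots> = (\<Sum>(b, x, y, x', y')\<in>UNIV \<times> UNIV \<times> UNIV \<times> UNIV \<times> UNIV. ?t b x y x' y')"
    by (simp only: sum.cartesian_product' case_prod_conv)
  also have "\<dots> = (\<Sum>(x, x', y, y', b)\<in>UNIV \<times> UNIV \<times> UNIV \<times> UNIV \<times> UNIV. ?t b x y x' y')"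
    by (rule sum.reindex_bij_witness[of _ "\<lambda>(x, x', y, y', b). (b, x, y, x', y')" "\<lambda>(b, x, y, x', y'). (x, x', y, y', b)"])
      auto
  also have "\<dots> = (\<Sum>x\<in>UNIV. \<Sum>x'\<in>UNIV. \<Sum>y\<in>UNIV. \<Sum>y'\<in>UNIV. \<Sum>b\<in>UNIV. ?t b x y x' y')"
    by (simp only: sum.cartesian_product' case_prod_conv)
  finally show ?thesis
    by (simp add: sum_distrib_left regroup_def mult_ac)
qed

lemma QNS_correlation_choi_map:
  fixes K :: "('x::finite \<times> 'y::finite) \<times> ('a::finite \<times> 'b::finite) \<Rightarrow> ('x \<times> 'y) \<times> ('a \<times> 'b) \<Rightarrow> complex"
  shows "QNS_correlation (choi_map K) \<longleftrightarrow> psd_on UNIV K \<and>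
    (\<forall>u v. (\<Sum>p\<in>UNIV. K (u, p) (v, p)) = (if u = v then 1 else 0)) \<and>
    scalar_marginal (regroup K) \<and> scalar_marginal (\<lambda>w w' z z'. regroup K z z' w w')"
proof -
  have "(\<forall>\<rho> \<sigma>. trace \<rho> = 0 \<longrightarrow> ptrace_fst (choi_map K (kron \<rho> \<sigma>)) = 0) \<longleftrightarrow> scalar_marginal (regroup K)"
    by (rule no_signalling_iff_scalar_marginal) (rule ptrace_fst_choi_map)
  moreover have "(\<forall>\<sigma> \<rho>. trace \<sigma> = 0 \<longrightarrow> ptrace_snd (choi_map K (kron \<rho> \<sigma>)) = 0) \<longleftrightarrow>
      scalar_marginal (\<lambda>w w' z z'. regroup K z z' w w')"
    by (rule no_signalling_iff_scalar_marginal) (rule ptrace_snd_choi_map)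
  ultimately show ?thesis
    unfolding QNS_correlation_def quantum_channel_def completely_positive_choi_map
      trace_preserving_choi_map[symmetric]
    using clinear_choi_map by blast
qed

lemma mat_pairing_eq: "mat_pairing \<omega> \<rho> = (\<Sum>i\<in>UNIV. \<Sum>j\<in>UNIV. \<omega> $ i $ j * \<rho> $ i $ j)"
  by (simp add: mat_pairing_def trace_def matrix_matrix_mult_def transpose_def)

lemma mat_pairing_matrix_unit: "mat_pairing \<omega> (matrix_unit u v) = \<omega> $ u $ v"
  using sum_matrix_unit[of u v "\<lambda>i j. \<omega> $ i $ j"] by (simp add: mat_pairing_eq mult.commute)

text \<open>Dualising exchanges inputs and outputs in the Choi matrix.\<close>

lemma dual_map_choi_map:
  fixes K :: "'u::finite \<times> 'p::finite \<Rightarrow> 'u \<times> 'p \<Rightarrow> complex"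
  shows "dual_map (choi_map K) = choi_map (\<lambda>(p, u) (q, v). K (u, p) (v, q))" (is "_ = ?D")
  unfolding dual_map_def
proof (rule the_equality)
  show dual: "\<forall>\<omega> \<rho>. mat_pairing (?D \<omega>) \<rho> = mat_pairing \<omega> (choi_map K \<rho>)"
  proof (intro allI)
    fix \<omega> :: "'p cmat" and \<rho> :: "'u cmat"
    let ?t = "\<lambda>u v p q. \<omega> $ p $ q * K (u, p) (v, q) * \<rho> $ u $ v"
    have "mat_pairing (?D \<omega>) \<rho> = (\<Sum>u\<in>UNIV. \<Sum>v\<in>UNIV. \<Sum>p\<in>UNIV. \<Sum>q\<in>UNIV. ?t u v p q)"
      by (simp add: mat_pairing_eq choi_map_nth sum_distrib_right)
    also have "\<dots> = (\<Sum>(u, v, p, q)\<in>UNIV \<times> UNIV \<times> UNIV \<times> UNIV. ?t u v p q)"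
      by (simp only: sum.cartesian_product' case_prod_conv)
    also have "\<dots> = (\<Sum>(p, q, u, v)\<in>UNIV \<times> UNIV \<times> UNIV \<times> UNIV. ?t u v p q)"
      by (rule sum.reindex_bij_witness[of _ "\<lambda>(p, q, u, v). (u, v, p, q)" "\<lambda>(u, v, p, q). (p, q, u, v)"]) auto
    also have "\<dots> = (\<Sum>p\<in>UNIV. \<Sum>q\<in>UNIV. \<Sum>u\<in>UNIV. \<Sum>v\<in>UNIV. ?t u v p q)"
      by (simp only: sum.cartesian_product' case_prod_conv)
    also have "\<dots> = mat_pairing \<omega> (choi_map K \<rho>)"
      by (simp add: mat_pairing_eq choi_map_nth sum_distrib_left mult_ac)
    finally show "mat_pairing (?D \<omega>) \<rho> = mat_pairing \<omega> (choi_map K \<rho>)" .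
  qed
  fix \<Delta> :: "'p cmat \<Rightarrow> 'u cmat"
  assume \<Delta>: "\<forall>\<omega> \<rho>. mat_pairing (\<Delta> \<omega>) \<rho> = mat_pairing \<omega> (choi_map K \<rho>)"
  show "\<Delta> = ?D"
  proof
    fix \<omega>
    have "\<Delta> \<omega> $ u $ v = ?D \<omega> $ u $ v" for u v
      using \<Delta>[rule_format, of \<omega> "matrix_unit u v"] dual[rule_format, of \<omega> "matrix_unit u v"]
      by (simp only: mat_pairing_matrix_unit)
    then show "\<Delta> \<omega> = ?D \<omega>" by (simp add: vec_eq_iff)
  qed
qed

lemma psd_on_reindex:
  assumes "bij_betw f I I'"
  shows "psd_on I (\<lambda>i j. M (f i) (f j)) \<longleftrightarrow> psd_on I' M"
proof -
  have inj: "inj_on f I" and im: "I' = f ` I" using assms by (auto simp: bij_betw_def)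
  have eq: "form I' M \<zeta> \<zeta> = form I (\<lambda>i j. M (f i) (f j)) (\<zeta> \<circ> f) (\<zeta> \<circ> f)" for \<zeta>
    unfolding form_def im by (simp add: sum.reindex[OF inj])
  show ?thesis
  proof
    assume "psd_on I (\<lambda>i j. M (f i) (f j))"
    then show "psd_on I' M" by (simp add: psd_on_def eq)
  next
    assume psd: "psd_on I' M"
    show "psd_on I (\<lambda>i j. M (f i) (f j))"
      unfolding psd_on_def
    proof
      fix \<xi>
      have "form I (\<lambda>i j. M (f i) (f j)) \<xi> \<xi> = form I' M (\<xi> \<circ> inv_into I f) (\<xi> \<circ> inv_into I f)"
        unfolding eq unfolding form_def using inj by (intro sum.cong) auto
      then show "0 \<le> form I (\<lambda>i j. M (f i) (f j)) \<xi> \<xi>" using psd by (simp add: psd_on_def)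
    qed
  qed
qed

text \<open>The two marginals agree because both, multiplied by the cardinality of \<open>X\<close>, are the full trace.\<close>

lemma bistochasticI:
  fixes R :: "'x::finite \<times> 'x \<Rightarrow> 'x \<times> 'x \<Rightarrow> 'w \<Rightarrow> 'w \<Rightarrow> complex"
  assumes row: "scalar_marginal R"
    and col: "scalar_marginal (\<lambda>z z'. R (prod.swap z) (prod.swap z'))"
  shows "\<exists>c. bistochastic R c"
proof -
  obtain c where c: "\<And>w w' x x'. (\<Sum>a\<in>UNIV. R (x, a) (x', a) w w') = (if x = x' then c w w' else 0)"
    using row unfolding scalar_marginal_def by metis
  obtain d where d: "\<And>w w' a a'. (\<Sum>x\<in>UNIV. R (x, a) (x, a') w w') = (if a = a' then d w w' else 0)"
    using col unfolding scalar_marginal_def prod.swap_def fst_conv snd_conv by metis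
  have "c w w' = d w w'" for w w'
  proof -
    have "of_nat CARD('x) * c w w' = (\<Sum>x\<in>UNIV. \<Sum>a\<in>UNIV. R (x, a) (x, a) w w')"
      by (simp add: c)
    also have "\<dots> = (\<Sum>a\<in>UNIV. \<Sum>x\<in>UNIV. R (x, a) (x, a) w w')" by (rule sum.swap)
    also have "\<dots> = of_nat CARD('x) * d w w'" by (simp add: d)
    finally show ?thesis by simp
  qed
  then have "bistochastic R c"
    unfolding bistochastic_def by (auto simp: fun_eq_iff sum_fun_apply c d)
  then show ?thesis by blast
qed

lemma bistochastic_apply:
  fixes R :: "'x::finite \<times> 'x \<Rightarrow> 'x \<times> 'x \<Rightarrow> 'w \<Rightarrow> 'w \<Rightarrow> complex"
  assumes "bistochastic R c"
  shows "(\<Sum>a\<in>UNIV. R (x, a) (x', a) w w') = (if x = x' then c w w' else 0)"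
    and "(\<Sum>x\<in>UNIV. R (x, a) (x, a') w w') = (if a = a' then c w w' else 0)"
proof -
  have "(\<Sum>a\<in>UNIV. R (x, a) (x', a)) w w' = (if x = x' then c else 0) w w'"
    and "(\<Sum>x\<in>UNIV. R (x, a) (x, a')) w w' = (if a = a' then c else 0) w w'"
    using assms by (simp_all only: bistochastic_def)
  then show "(\<Sum>a\<in>UNIV. R (x, a) (x', a) w w') = (if x = x' then c w w' else 0)"
    and "(\<Sum>x\<in>UNIV. R (x, a) (x, a') w w') = (if a = a' then c w w' else 0)"
    by (auto simp: sum_fun_apply)
qed

lemma bistochastic_scalar_marginal:
  assumes "bistochastic R c"
  shows "scalar_marginal R" "scalar_marginal (\<lambda>z z'. R (prod.swap z) (prod.swap z'))"
  unfolding scalar_marginal_def using bistochastic_apply[OF assms] by auto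

definition bicorrelation_matrix ::
    "('x::finite \<times> 'x \<Rightarrow> 'x \<times> 'x \<Rightarrow> 'y::finite \<times> 'y \<Rightarrow> 'y \<times> 'y \<Rightarrow> complex) \<Rightarrow> bool"
  where "bicorrelation_matrix R \<longleftrightarrow>
    psd_on UNIV (\<lambda>(z, w) (z', w'). R z z' w w') \<and>
    (\<exists>c. bistochastic R c) \<and> (\<exists>d. bistochastic (\<lambda>w w' z z'. R z z' w w') d) \<and>
    (\<forall>x y. (\<Sum>a\<in>UNIV. \<Sum>b\<in>UNIV. R (x, a) (x, a) (y, b) (y, b)) = 1)"

text \<open>Complete positivity of \<open>\<Gamma>\<close> and of \<open>\<Gamma>\<^sup>*\<close> is the same condition on the Choi matrix. No-signalling of \<open>\<Gamma>\<close> gives the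
relations with a sum over outputs, no-signalling of \<open>\<Gamma>\<^sup>*\<close> those with a sum over inputs; trace preservation of
\<open>\<Gamma>\<^sup>*\<close> is unitality of \<open>\<Gamma>\<close>, and it follows from the normalisation since the two sums of a bistochastic matrix
agree.\<close>

theorem QNS_bicorrelation_choi_map:
  fixes K :: "('x::finite \<times> 'y::finite) \<times> ('x \<times> 'y) \<Rightarrow> ('x \<times> 'y) \<times> ('x \<times> 'y) \<Rightarrow> complex"
  shows "QNS_bicorrelation (choi_map K) \<longleftrightarrow> bicorrelation_matrix (regroup K)"
proof -
  define K' where "K' = (\<lambda>(p, u) (q, v). K (u, p) (v, q))"
  define R where "R = regroup K"
  have R': "regroup K' z z' w w' = R (prod.swap z) (prod.swap z') (prod.swap w) (prod.swap w')" for z z' w w'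
    by (simp add: regroup_def K'_def R_def)
  define g :: "('x \<times> 'x) \<times> ('y \<times> 'y) \<Rightarrow> ('x \<times> 'y) \<times> ('x \<times> 'y)"
    where "g = (\<lambda>((x, a), (y, b)). ((x, y), (a, b)))"
  have "bij g"
    by (rule bij_betw_byWitness[where f' = "\<lambda>((x, y), (a, b)). ((x, a), (y, b))"]) (auto simp: g_def)
  moreover have "(\<lambda>i j. K (g i) (g j)) = (\<lambda>(z, w) (z', w'). R z z' w w')"
    by (auto simp: fun_eq_iff g_def R_def regroup_def)
  ultimately have psd: "psd_on UNIV K \<longleftrightarrow> psd_on UNIV (\<lambda>(z, w) (z', w'). R z z' w w')"
    using psd_on_reindex[of g UNIV UNIV K] by simp
  have "bij (prod.swap :: ('x \<times> 'y) \<times> ('x \<times> 'y) \<Rightarrow> _)"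
    by (rule bij_betw_byWitness[where f' = prod.swap]) auto
  moreover have "(\<lambda>i j. K (prod.swap i) (prod.swap j)) = K'"
    by (auto simp: fun_eq_iff K'_def)
  ultimately have psd': "psd_on UNIV K' \<longleftrightarrow> psd_on UNIV K"
    using psd_on_reindex[of prod.swap UNIV UNIV K] by simp
  have tr: "(\<Sum>p\<in>UNIV. K ((x, y), p) ((x', y'), p)) = (\<Sum>a\<in>UNIV. \<Sum>b\<in>UNIV. R (x, a) (x', a) (y, b) (y', b))"
    for x x' y y'
    by (simp add: sum_UNIV_prod R_def regroup_def)
  have tr': "(\<Sum>p\<in>UNIV. K' ((a, b), p) ((a', b'), p)) = (\<Sum>x\<in>UNIV. \<Sum>y\<in>UNIV. R (x, a) (x, a') (y, b) (y, b'))"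
    for a a' b b'
    by (simp add: sum_UNIV_prod R_def regroup_def K'_def)
  have dual: "dual_map (choi_map K) = choi_map K'"
    unfolding K'_def by (rule dual_map_choi_map)
  show ?thesis
  proof
    assume q: "QNS_bicorrelation (choi_map K)"
    then have q1: "QNS_correlation (choi_map K)" and q2: "QNS_correlation (choi_map K')"
      unfolding QNS_bicorrelation_def dual by auto
    note q1 = q1[unfolded QNS_correlation_choi_map, folded R_def]
      and q2 = q2[unfolded QNS_correlation_choi_map R']
    have sw: "scalar_marginal (\<lambda>z z'. R (prod.swap z) (prod.swap z'))"
      unfolding scalar_marginal_def
    proof (intro allI)
      fix w w'
      show "\<exists>c. \<forall>x x'. (\<Sum>a\<in>UNIV. R (prod.swap (x, a)) (prod.swap (x', a)) w w') = (if x = x' then c else 0)"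
        using q2[THEN conjunct2, THEN conjunct2, THEN conjunct1, unfolded scalar_marginal_def R', rule_format,
            of "prod.swap w" "prod.swap w'"] by simp
    qed
    have sw': "scalar_marginal (\<lambda>w w' z z'. R z z' (prod.swap w) (prod.swap w'))"
      unfolding scalar_marginal_def
    proof (intro allI)
      fix z z'
      show "\<exists>c. \<forall>y y'. (\<Sum>b\<in>UNIV. R z z' (prod.swap (y, b)) (prod.swap (y', b))) = (if y = y' then c else 0)"
        using q2[THEN conjunct2, THEN conjunct2, THEN conjunct2, unfolded scalar_marginal_def R', rule_format,
            of "prod.swap z" "prod.swap z'"] by simp
    qed
    show "bicorrelation_matrix (regroup K)"
      unfolding bicorrelation_matrix_def R_def[symmetric] psd[symmetric]
      using q1 bistochasticI[OF _ sw] bistochasticI[OF _ sw'] by (simp add: tr[symmetric])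
  next
    assume "bicorrelation_matrix (regroup K)"
    then obtain c d where p: "psd_on UNIV K" and c: "bistochastic R c"
      and d: "bistochastic (\<lambda>w w' z z'. R z z' w w') d"
      and n: "\<And>x y. (\<Sum>a\<in>UNIV. \<Sum>b\<in>UNIV. R (x, a) (x, a) (y, b) (y, b)) = 1"
      unfolding bicorrelation_matrix_def R_def[symmetric] psd[symmetric] by blast
    have c1: "(\<Sum>a\<in>UNIV. R (x, a) (x', a) w w') = (if x = x' then c w w' else 0)"
      and c2: "(\<Sum>x\<in>UNIV. R (x, a) (x, a') w w') = (if a = a' then c w w' else 0)" for x x' a a' w w'
      by (rule bistochastic_apply[OF c])+
    have d1: "(\<Sum>b\<in>UNIV. R z z' (y, b) (y', b)) = (if y = y' then d z z' else 0)"
      and d2: "(\<Sum>y\<in>UNIV. R z z' (y, b) (y, b')) = (if b = b' then d z z' else 0)" for y y' b b' z z'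
      by (rule bistochastic_apply[OF d])+
    have t: "(\<Sum>a\<in>UNIV. \<Sum>b\<in>UNIV. R (x, a) (x', a) (y, b) (y', b)) = (if (x, y) = (x', y') then 1 else 0)"
      for x x' y y'
    proof -
      have "(\<Sum>a\<in>UNIV. \<Sum>b\<in>UNIV. R (x, a) (x', a) (y, b) (y', b)) = (\<Sum>b\<in>UNIV. \<Sum>a\<in>UNIV. R (x, a) (x', a) (y, b) (y', b))"
        by (rule sum.swap)
      then have "(\<Sum>a\<in>UNIV. \<Sum>b\<in>UNIV. R (x, a) (x', a) (y, b) (y', b)) = 0" if "x \<noteq> x'"
        using that by (simp add: c1)
      moreover have "(\<Sum>a\<in>UNIV. \<Sum>b\<in>UNIV. R (x, a) (x', a) (y, b) (y', b)) = 0" if "y \<noteq> y'"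
        using that by (simp add: d1)
      ultimately show ?thesis using n[of x y] by auto
    qed
    \<comment> \<open>For the diagonal entries, each party in turn exchanges its sum over inputs for a sum over outputs at an
      arbitrary fixed input; what remains is the normalisation.\<close>
    have t': "(\<Sum>x\<in>UNIV. \<Sum>y\<in>UNIV. R (x, a) (x, a') (y, b) (y, b')) = (if (a, b) = (a', b') then 1 else 0)"
      for a a' b b'
    proof -
      have e: "(\<Sum>x\<in>UNIV. \<Sum>y\<in>UNIV. R (x, a) (x, a') (y, b) (y, b')) = (\<Sum>y\<in>UNIV. \<Sum>x\<in>UNIV. R (x, a) (x, a') (y, b) (y, b'))"
        by (rule sum.swap)
      have "(\<Sum>x\<in>UNIV. \<Sum>y\<in>UNIV. R (x, a) (x, a') (y, b) (y, b')) = 0" if "a \<noteq> a'"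
        unfolding e using that by (simp add: c2)
      moreover have "(\<Sum>x\<in>UNIV. \<Sum>y\<in>UNIV. R (x, a) (x, a') (y, b) (y, b')) = 0" if "b \<noteq> b'"
        using that by (simp add: d2)
      moreover have "(\<Sum>x\<in>UNIV. \<Sum>y\<in>UNIV. R (x, a) (x, a) (y, b) (y, b)) = 1"
      proof -
        have "(\<Sum>x\<in>UNIV. \<Sum>y\<in>UNIV. R (x, a) (x, a) (y, b) (y, b)) = (\<Sum>x\<in>UNIV. d (x, a) (x, a))"
          by (simp add: d2)
        also have "\<dots> = (\<Sum>x\<in>UNIV. \<Sum>b\<in>UNIV. R (x, a) (x, a) (undefined, b) (undefined, b))"
          by (simp add: d1)
        also have "\<dots> = (\<Sum>b\<in>UNIV. \<Sum>x\<in>UNIV. R (x, a) (x, a) (undefined, b) (undefined, b))"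
          by (rule sum.swap)
        also have "\<dots> = (\<Sum>b\<in>UNIV. \<Sum>a\<in>UNIV. R (undefined, a) (undefined, a) (undefined, b) (undefined, b))"
          by (simp add: c1 c2)
        also have "\<dots> = 1" by (subst sum.swap) (rule n)
        finally show ?thesis .
      qed
      ultimately show ?thesis by auto
    qed
    have q1: "QNS_correlation (choi_map K)"
      unfolding QNS_correlation_choi_map R_def[symmetric]
      using p t bistochastic_scalar_marginal(1)[OF c] bistochastic_scalar_marginal(1)[OF d]
      by (auto simp: tr)
    have "scalar_marginal (regroup K')"
      using bistochastic_scalar_marginal(2)[OF c] by (simp add: scalar_marginal_def R')
    moreover have "scalar_marginal (\<lambda>w w' z z'. regroup K' z z' w w')"
      using bistochastic_scalar_marginal(2)[OF d] by (simp add: scalar_marginal_def R')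
    ultimately have q2: "QNS_correlation (choi_map K')"
      unfolding QNS_correlation_choi_map psd'
      using p t' by (auto simp: tr')
    have "choi_map K (mat 1) $ p $ q = mat 1 $ p $ q" for p q
    proof -
      obtain a b a' b' where pq: "p = (a, b)" "q = (a', b')" by (cases p, cases q)
      have "choi_map K (mat 1) $ p $ q = (\<Sum>u\<in>UNIV. K (u, p) (u, q))"
        unfolding choi_map_nth by (simp add: mat_def if_distrib if_distribR cong: if_cong)
      also have "\<dots> = (if (a, b) = (a', b') then 1 else 0)"
        unfolding t'[symmetric] by (simp add: sum_UNIV_prod R_def regroup_def pq)
      finally show ?thesis by (simp add: mat_def pq)
    qed
    then have "choi_map K (mat 1) = mat 1" by (simp add: vec_eq_iff)
    then show "QNS_bicorrelation (choi_map K)"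
      unfolding QNS_bicorrelation_def dual using q1 q2 by blast
  qed
qed

section \<open>States on the maximal tensor product\<close>

lemma gens_in_span: "gens z z' \<in> os_space T_system"
  unfolding T_system_simps gen_set_eq by (intro complex_vector.span_base) blast

lemma gens_in_C_alg: "gens z z' \<in> C_alg"
  unfolding C_alg_def cstar_generated_def gen_set_eq by blast

lemma id_in_C_alg: "id_op univ_dom \<in> C_alg"
  unfolding C_alg_def cstar_generated_def unital_cstar_subalgebra_def by blast

lemma zero_in_C_alg: "0 \<in> C_alg"
proof -
  have "0 \<in> A" if "unital_cstar_subalgebra univ_dom A" for A
  proof -
    have "0 *\<^sub>C id_op univ_dom \<in> A" using that unfolding unital_cstar_subalgebra_def by blast
    then show ?thesis by simp
  qed
  then show ?thesis unfolding C_alg_def cstar_generated_def by blast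
qed

lemma subspace_T_system:
  "complex_vector.subspace (os_space (T_system :: ('x::finite, 'k) univ_op operator_system))"
  unfolding T_system_simps by (rule complex_vector.subspace_span)

lemma sum_gens_diagonal: "(\<Sum>a\<in>UNIV. gens (x, a) (x, a)) = (id_op univ_dom :: ('x::finite, 'k) univ_op)"
  using gens_bistochastic[unfolded bistochastic_def, THEN conjunct1, rule_format, of x x] by simp

lemma id_in_span: "id_op univ_dom \<in> os_space (T_system :: ('x::finite, 'k) univ_op operator_system)"
  unfolding sum_gens_diagonal[of undefined, symmetric]
  by (intro complex_vector.subspace_sum[OF subspace_T_system] gens_in_span)

text \<open>The matrix is of the form \<open>(v\<^sub>i\<^sup>* v\<^sub>j)\<^sub>i\<^sub>j\<close>.\<close>

lemma os_pos_gens: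
  fixes e :: "nat \<Rightarrow> 'x::finite \<times> 'x"
  shows "os_pos T_system n (\<lambda>i j. gens (e i) (e j) :: ('x, 'k) univ_op)"
  unfolding os_pos_T_system
proof (intro conjI allI impI gens_in_span gens_in_C_alg)
  fix \<xi> :: "nat \<Rightarrow> ('x, 'k) bi_iso \<times> 'k \<Rightarrow> complex"
  assume \<xi>: "\<forall>i<n. \<xi> i \<in> ell2 univ_dom"
  define v where "v i = univ_bi_isometry (snd (e i)) (fst (e i)) (\<xi> i)" for i
  have v: "v i \<in> ell2 univ_cod" for i
    unfolding v_def by (rule bounded_ops_ell2[OF univ_bounded])
  have "(\<Sum>i<n. \<Sum>j<n. ell2_inner (\<xi> i) (gens (e i) (e j) (\<xi> j))) = (\<Sum>i<n. \<Sum>j<n. ell2_inner (v i) (v j))"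
    using \<xi> by (intro sum.cong) (simp_all add: gens_inner v_def)
  also have "\<dots> = ell2_inner (\<Sum>i<n. 1 *\<^sub>C v i) (\<Sum>j<n. 1 *\<^sub>C v j)"
  proof -
    have "(\<Sum>j<n. 1 *\<^sub>C v j) \<in> ell2 univ_cod"
      by (intro ell2.sum_closed ell2_scale v)
    then have "ell2_inner (\<Sum>i<n. 1 *\<^sub>C v i) (\<Sum>j<n. 1 *\<^sub>C v j) = (\<Sum>i<n. cnj 1 * ell2_inner (v i) (\<Sum>j<n. 1 *\<^sub>C v j))"
      by (rule ell2.sum_left) (rule v)
    moreover have "ell2_inner (v i) (\<Sum>j<n. 1 *\<^sub>C v j) = (\<Sum>j<n. 1 * ell2_inner (v i) (v j))" for i
      by (rule ell2.sum_right[OF v]) (rule v)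
    ultimately show ?thesis by simp
  qed
  also have "0 \<le> \<dots>"
    by (rule ell2.nonneg[of _ univ_cod]) (intro ell2.sum_closed ell2_scale v)
  finally show "0 \<le> (\<Sum>i<n. \<Sum>j<n. ell2_inner (\<xi> i) (gens (e i) (e j) (\<xi> j)))" .
qed

text \<open>The direct sum \<open>P \<oplus> 1\<close>.\<close>

definition extend_by_unit :: "nat \<Rightarrow> (nat \<Rightarrow> nat \<Rightarrow> ('x::finite, 'k) univ_op) \<Rightarrow> nat \<Rightarrow> nat \<Rightarrow> ('x, 'k) univ_op"
  where "extend_by_unit k P i j =
    (if i < k \<and> j < k then P i j else if i = k \<and> j = k then id_op univ_dom else 0)"

lemma os_pos_extend_by_unit:
  fixes P :: "nat \<Rightarrow> nat \<Rightarrow> ('x::finite, 'k) univ_op"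
  assumes "os_pos T_system k P"
  shows "os_pos T_system (Suc k) (extend_by_unit k P)"
  unfolding os_pos_T_system
proof (intro conjI allI impI)
  fix i j assume "i < Suc k" "j < Suc k"
  have zero: "(0 :: ('x, 'k) univ_op) \<in> os_space T_system"
    by (rule complex_vector.subspace_0[OF subspace_T_system])
  show "extend_by_unit k P i j \<in> os_space T_system"
    using assms[unfolded os_pos_T_system] id_in_span[where 'x = 'x and 'k = 'k] zero
    by (simp add: extend_by_unit_def)
  have idC: "id_op univ_dom \<in> (C_alg :: ('x, 'k) univ_op set)" by (rule id_in_C_alg)
  have zeroC: "0 \<in> (C_alg :: ('x, 'k) univ_op set)" by (rule zero_in_C_alg)
  show "extend_by_unit k P i j \<in> C_alg"
    using assms[unfolded os_pos_T_system] idC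
      zeroC by (simp add: extend_by_unit_def)
next
  fix \<xi> :: "nat \<Rightarrow> ('x, 'k) bi_iso \<times> 'k \<Rightarrow> complex"
  assume \<xi>: "\<forall>i<Suc k. \<xi> i \<in> ell2 univ_dom"
  have "(\<Sum>i<Suc k. \<Sum>j<Suc k. ell2_inner (\<xi> i) (extend_by_unit k P i j (\<xi> j)))
      = (\<Sum>i<k. \<Sum>j<k. ell2_inner (\<xi> i) (P i j (\<xi> j))) + ell2_inner (\<xi> k) (\<xi> k)"
  proof -
    have "ell2_inner (\<xi> i) 0 = 0" for i by (simp add: ell2_inner_def)
    moreover have "id_op univ_dom (\<xi> k) = \<xi> k" using \<xi> by (simp add: id_op_def)
    ultimately show ?thesis by (simp add: extend_by_unit_def sum.distrib)
  qed
  moreover have "0 \<le> (\<Sum>i<k. \<Sum>j<k. ell2_inner (\<xi> i) (P i j (\<xi> j)))"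
    using assms[unfolded os_pos_T_system] \<xi> by simp
  moreover have "0 \<le> ell2_inner (\<xi> k) (\<xi> k)"
    using \<xi> by (intro ell2.nonneg) auto
  ultimately show "0 \<le> (\<Sum>i<Suc k. \<Sum>j<Suc k. ell2_inner (\<xi> i) (extend_by_unit k P i j (\<xi> j)))"
    by simp
qed

lemma tens_add_left: "tens (u + u') w = tens u w + tens u' w"
  and tens_add_right: "tens u (w + w') = tens u w + tens u w'"
  by (auto simp: tens_def fun_eq_iff Vector_Spaces.linear_iff algebra_simps)

lemma tens_scale_left: "tens (c *\<^sub>C u) w = c *\<^sub>C tens u w"
  and tens_scale_right: "tens u (c *\<^sub>C w) = c *\<^sub>C tens u w"
  by (auto simp: tens_def fun_eq_iff Vector_Spaces.linear_iff algebra_simps)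

lemma tens_zero_left: "tens 0 w = 0"
  and tens_zero_right: "tens u 0 = 0"
  using tens_scale_left[of 0 0 w] tens_scale_right[of u 0 0] by simp_all

lemma tens_sum_left: "tens (\<Sum>k\<in>A. u k) w = (\<Sum>k\<in>A. tens (u k) w)"
  by (induction A rule: infinite_finite_induct) (simp_all only: sum.infinite sum.empty sum.insert tens_zero_left tens_add_left not_False_eq_True)

lemma tens_sum_right: "tens u (\<Sum>k\<in>A. w k) = (\<Sum>k\<in>A. tens u (w k))"
  by (induction A rule: infinite_finite_induct) (simp_all only: sum.infinite sum.empty sum.insert tens_zero_right tens_add_right not_False_eq_True)

lemma tens_in_alg_tensor: "u \<in> S \<Longrightarrow> w \<in> T \<Longrightarrow> tens u w \<in> alg_tensor S T"
  unfolding alg_tensor_def by (rule complex_vector.span_base) blast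

lemma subspace_alg_tensor: "complex_vector.subspace (alg_tensor S T)"
  unfolding alg_tensor_def by (rule complex_vector.subspace_span)

lemma linear_functional_on_sum:
  assumes "linear_functional_on S s" "complex_vector.subspace S" "\<And>k. k \<in> K \<Longrightarrow> \<tau> k \<in> S"
  shows "s (\<Sum>k\<in>K. \<tau> k) = (\<Sum>k\<in>K. s (\<tau> k))"
proof -
  have zero: "s 0 = 0"
  proof -
    have "s (0 *\<^sub>C 0) = 0 * s 0"
      using assms(1) complex_vector.subspace_0[OF assms(2)] unfolding linear_functional_on_def by blast
    then show ?thesis by simp
  qed
  show ?thesis
    using assms(3)
  proof (induction K rule: infinite_finite_induct)
    case (insert k K)
    have "s (\<tau> k + (\<Sum>k\<in>K. \<tau> k)) = s (\<tau> k) + s (\<Sum>k\<in>K. \<tau> k)"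
      using assms(1) insert.prems complex_vector.subspace_sum[OF assms(2), of K \<tau>]
      unfolding linear_functional_on_def by blast
    then show ?case using insert by simp
  qed (simp_all add: zero)
qed

text \<open>\<open>\<alpha> (P \<otimes> Q) \<alpha>\<^sup>* + r (1 \<otimes> 1)\<close> is again of the form \<open>\<beta> (P' \<otimes> Q') \<beta>\<^sup>*\<close>, with \<open>P' = P \<oplus> 1\<close> and
  \<open>Q' = Q \<oplus> 1\<close>.\<close>

lemma max_precone_add_unit:
  fixes P :: "nat \<Rightarrow> nat \<Rightarrow> ('x::finite, 'k) univ_op" and Q :: "nat \<Rightarrow> nat \<Rightarrow> ('y::finite, 'k) univ_op"
    and r :: real
  assumes P: "os_pos T_system k P" and Q: "os_pos T_system m Q" and r: "r > 0"
  shows "max_precone T_system T_system 1 (\<lambda>i j. (if i = j then complex_of_real r *\<^sub>C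
      tens (os_unit (T_system :: ('x, 'k) univ_op operator_system))
        (os_unit (T_system :: ('y, 'k) univ_op operator_system)) else 0) +
    (\<Sum>(p, q)\<in>{..<k} \<times> {..<m}. \<Sum>(p', q')\<in>{..<k} \<times> {..<m}.
       (\<alpha> (p, q) * cnj (\<alpha> (p', q'))) *\<^sub>C tens (P p p') (Q q q')))"
proof -
  define P' where "P' = extend_by_unit k P"
  define Q' where "Q' = extend_by_unit m Q"
  define \<beta> where "\<beta> = (\<lambda>(p, q). if p < k \<and> q < m then \<alpha> (p, q) else if p = k \<and> q = m then complex_of_real (sqrt r) else 0)"
  define A where "A = {..<k} \<times> {..<m}"
  define F where "F = (\<lambda>x y. (\<beta> x * cnj (\<beta> y)) *\<^sub>C tens (P' (fst x) (fst y)) (Q' (snd x) (snd y)))"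
  have A: "finite A" "(k, m) \<notin> A" by (auto simp: A_def)
  have sub: "insert (k, m) A \<subseteq> {..<Suc k} \<times> {..<Suc m}" by (auto simp: A_def)
  have zero: "\<beta> x = 0" if "x \<notin> insert (k, m) A" for x
    using that by (cases x) (auto simp: \<beta>_def A_def)
  have "(\<Sum>x\<in>{..<Suc k} \<times> {..<Suc m}. \<Sum>y\<in>{..<Suc k} \<times> {..<Suc m}. F x y)
      = (\<Sum>x\<in>insert (k, m) A. \<Sum>y\<in>{..<Suc k} \<times> {..<Suc m}. F x y)"
    using sub zero by (intro sum.mono_neutral_right) (auto simp: F_def)
  also have "\<dots> = (\<Sum>x\<in>insert (k, m) A. \<Sum>y\<in>insert (k, m) A. F x y)"
    using sub zero by (intro sum.cong refl sum.mono_neutral_right) (auto simp: F_def)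
  also have "\<dots> = F (k, m) (k, m) + (\<Sum>y\<in>A. F (k, m) y) + ((\<Sum>x\<in>A. F x (k, m)) + (\<Sum>x\<in>A. \<Sum>y\<in>A. F x y))"
    using A by (simp only: sum.insert sum.distrib not_False_eq_True add_ac)
  also have "(\<Sum>y\<in>A. F (k, m) y) = 0"
    by (rule sum.neutral) (auto simp: F_def A_def P'_def extend_by_unit_def tens_zero_left)
  also have "(\<Sum>x\<in>A. F x (k, m)) = 0"
    by (rule sum.neutral) (auto simp: F_def A_def P'_def extend_by_unit_def tens_zero_left)
  also have "F (k, m) (k, m) = complex_of_real r *\<^sub>C tens (id_op univ_dom) (id_op univ_dom)"
    using r by (simp add: F_def \<beta>_def P'_def Q'_def extend_by_unit_def flip: of_real_mult)
  also have "(\<Sum>x\<in>A. \<Sum>y\<in>A. F x y) = (\<Sum>x\<in>A. \<Sum>y\<in>A. (\<alpha> x * cnj (\<alpha> y)) *\<^sub>C tens (P (fst x) (fst y)) (Q (snd x) (snd y)))"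
    by (intro sum.cong refl) (auto simp: F_def \<beta>_def A_def P'_def Q'_def extend_by_unit_def)
  finally have eq: "(\<Sum>x\<in>{..<Suc k} \<times> {..<Suc m}. \<Sum>y\<in>{..<Suc k} \<times> {..<Suc m}. F x y)
      = complex_of_real r *\<^sub>C tens (id_op univ_dom) (id_op univ_dom)
        + (\<Sum>x\<in>A. \<Sum>y\<in>A. (\<alpha> x * cnj (\<alpha> y)) *\<^sub>C tens (P (fst x) (fst y)) (Q (snd x) (snd y)))"
    by (simp only: add_0_left add_0_right)
  show ?thesis
    unfolding max_precone_def
  proof (intro exI conjI)
    show "os_pos T_system (Suc k) P'" unfolding P'_def by (rule os_pos_extend_by_unit[OF P])
    show "os_pos T_system (Suc m) Q'" unfolding Q'_def by (rule os_pos_extend_by_unit[OF Q])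
    show "\<forall>i<1::nat. \<forall>j<1::nat. (if i = j then complex_of_real r *\<^sub>C
      tens (os_unit (T_system :: ('x, 'k) univ_op operator_system))
        (os_unit (T_system :: ('y, 'k) univ_op operator_system)) else 0) +
      (\<Sum>(p, q)\<in>{..<k} \<times> {..<m}. \<Sum>(p', q')\<in>{..<k} \<times> {..<m}.
       (\<alpha> (p, q) * cnj (\<alpha> (p', q'))) *\<^sub>C tens (P p p') (Q q q'))
      = (\<Sum>(p, q)\<in>{..<Suc k} \<times> {..<Suc m}. \<Sum>(p', q')\<in>{..<Suc k} \<times> {..<Suc m}.
       ((\<lambda>_. \<beta>) i (p, q) * cnj ((\<lambda>_. \<beta>) j (p', q'))) *\<^sub>C tens (P' p p') (Q' q q'))"
      using eq by (simp add: F_def A_def case_prod_unfold T_system_simps)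
  qed
qed

definition state_matrix :: "((('x::finite, 'k) univ_op, ('y::finite, 'k) univ_op) tensor \<Rightarrow> complex) \<Rightarrow>
    'x \<times> 'x \<Rightarrow> 'x \<times> 'x \<Rightarrow> 'y \<times> 'y \<Rightarrow> 'y \<times> 'y \<Rightarrow> complex"
  where "state_matrix s z z' w w' = s (tens (gens z z') (gens w w'))"

text \<open>The generators form a positive and bistochastic block matrix, and applying \<open>s\<close> preserves both properties. For
positivity, the value of the quadratic form at \<open>\<zeta>\<close> is \<open>s\<close> of an element \<open>\<alpha> (P \<otimes> Q) \<alpha>\<^sup>*\<close> with \<open>P\<close> and \<open>Q\<close> the matrices
of generators.\<close>

theorem state_matrix_bicorrelation:
  fixes s :: "(('x::finite, 'k) univ_op, ('y::finite, 'k) univ_op) tensor \<Rightarrow> complex"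
  assumes s: "state (max_tensor T_system T_system) s"
  shows "bicorrelation_matrix (state_matrix s)"
proof -
  define S where "S = alg_tensor (os_space (T_system :: ('x, 'k) univ_op operator_system))
    (os_space (T_system :: ('y, 'k) univ_op operator_system))"
  have sub: "complex_vector.subspace S" unfolding S_def by (rule subspace_alg_tensor)
  have lin: "linear_functional_on S s" and unit: "s (tens (id_op univ_dom) (id_op univ_dom)) = 1"
    and pos: "\<And>u. os_pos (max_tensor (T_system :: ('x, 'k) univ_op operator_system)
      (T_system :: ('y, 'k) univ_op operator_system)) 1 (\<lambda>_ _. u) \<Longrightarrow> 0 \<le> s u"
    using s by (auto simp: state_def max_tensor_def S_def T_system_simps)
  note lin_sum = linear_functional_on_sum[OF lin sub]
  have scale: "s (c *\<^sub>C u) = c * s u" if "u \<in> S" for c u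
    using lin that unfolding linear_functional_on_def by blast
  have mem: "tens u w \<in> S" if "u \<in> os_space T_system" "w \<in> os_space T_system" for u w
    unfolding S_def using that by (rule tens_in_alg_tensor)
  have s0: "s 0 = 0" using scale[of 0 0] complex_vector.subspace_0[OF sub] by simp
  have left: "(\<Sum>i\<in>UNIV. s (tens (u i) w)) = s (tens (\<Sum>i\<in>UNIV. u i) w)"
    if "\<And>i. u i \<in> os_space T_system" "w \<in> os_space T_system" for u :: "'x \<Rightarrow> ('x, 'k) univ_op" and w
    unfolding tens_sum_left by (rule lin_sum[symmetric]) (rule mem[OF that])
  have right: "(\<Sum>i\<in>UNIV. s (tens u (w i))) = s (tens u (\<Sum>i\<in>UNIV. w i))"
    if "\<And>i. w i \<in> os_space T_system" "u \<in> os_space T_system" for w :: "'y \<Rightarrow> ('y, 'k) univ_op" and u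
    unfolding tens_sum_right by (rule lin_sum[symmetric]) (rule mem[OF that(2,1)])
  have bX: "(\<Sum>a\<in>UNIV. gens (x, a) (x', a)) = (if x = x' then id_op univ_dom else (0 :: ('x, 'k) univ_op))"
    "(\<Sum>x\<in>UNIV. gens (x, a) (x, a')) = (if a = a' then id_op univ_dom else (0 :: ('x, 'k) univ_op))" for x x' a a'
    using gens_bistochastic unfolding bistochastic_def by blast+
  have bY: "(\<Sum>b\<in>UNIV. gens (y, b) (y', b)) = (if y = y' then id_op univ_dom else (0 :: ('y, 'k) univ_op))"
    "(\<Sum>y\<in>UNIV. gens (y, b) (y, b')) = (if b = b' then id_op univ_dom else (0 :: ('y, 'k) univ_op))" for y y' b b'
    using gens_bistochastic unfolding bistochastic_def by blast+
  have 1: "bistochastic (state_matrix s) (\<lambda>w w'. s (tens (id_op univ_dom) (gens w w')))"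
    unfolding bistochastic_def
    by (auto simp: fun_eq_iff sum_fun_apply state_matrix_def left gens_in_span bX tens_zero_left s0)
  have 2: "bistochastic (\<lambda>w w' z z'. state_matrix s z z' w w') (\<lambda>z z'. s (tens (gens z z') (id_op univ_dom)))"
    unfolding bistochastic_def
    by (auto simp: fun_eq_iff sum_fun_apply state_matrix_def right gens_in_span bY tens_zero_right s0)
  have 3: "(\<Sum>a\<in>UNIV. \<Sum>b\<in>UNIV. state_matrix s (x, a) (x, a) (y, b) (y, b)) = 1" for x y
    by (simp add: state_matrix_def right left gens_in_span id_in_span bX bY unit)
  have 4: "psd_on UNIV (\<lambda>(z, w) (z', w'). state_matrix s z z' w w')"
    unfolding psd_on_def
  proof
    fix \<zeta> :: "('x \<times> 'x) \<times> ('y \<times> 'y) \<Rightarrow> complex"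
    define k where "k = card (UNIV :: ('x \<times> 'x) set)"
    define m where "m = card (UNIV :: ('y \<times> 'y) set)"
    obtain e :: "nat \<Rightarrow> 'x \<times> 'x" where e: "bij_betw e {..<k} UNIV"
      using ex_bij_betw_nat_finite[of "UNIV :: ('x \<times> 'x) set"] unfolding k_def atLeast0LessThan by auto
    obtain f :: "nat \<Rightarrow> 'y \<times> 'y" where f: "bij_betw f {..<m} UNIV"
      using ex_bij_betw_nat_finite[of "UNIV :: ('y \<times> 'y) set"] unfolding m_def atLeast0LessThan by auto
    have ef: "bij_betw (map_prod e f) ({..<k} \<times> {..<m}) UNIV"
      using bij_betw_map_prod[OF e f] by simp
    define P where "P i j = (gens (e i) (e j) :: ('x, 'k) univ_op)" for i j
    define Q where "Q i j = (gens (f i) (f j) :: ('y, 'k) univ_op)" for i j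
    define \<alpha> where "\<alpha> x = cnj (\<zeta> (map_prod e f x))" for x
    define u where "u = (\<Sum>x\<in>{..<k} \<times> {..<m}. \<Sum>y\<in>{..<k} \<times> {..<m}.
      (\<alpha> x * cnj (\<alpha> y)) *\<^sub>C tens (P (fst x) (fst y)) (Q (snd x) (snd y)))"
    have P: "os_pos T_system k P" unfolding P_def by (rule os_pos_gens)
    have Q: "os_pos T_system m Q" unfolding Q_def by (rule os_pos_gens)
    have t: "tens (P i j) (Q i' j') \<in> S" for i j i' j'
      unfolding P_def Q_def by (rule mem[OF gens_in_span gens_in_span])
    have tc: "c *\<^sub>C tens (P i j) (Q i' j') \<in> S" for c i j i' j'
      by (rule complex_vector.subspace_scale[OF sub t])
    have "0 \<le> s u"
    proof (rule pos)
      have "u \<in> S" unfolding u_def by (intro complex_vector.subspace_sum[OF sub] tc)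
      moreover have "max_precone T_system T_system 1 (\<lambda>i j. (if i = j then complex_of_real r *\<^sub>C
        tens (os_unit (T_system :: ('x, 'k) univ_op operator_system))
          (os_unit (T_system :: ('y, 'k) univ_op operator_system)) else 0) + u)" if "r > 0" for r
        using max_precone_add_unit[OF P Q that, of \<alpha>] by (simp add: u_def case_prod_unfold)
      ultimately show "os_pos (max_tensor (T_system :: ('x, 'k) univ_op operator_system)
          (T_system :: ('y, 'k) univ_op operator_system)) 1 (\<lambda>_ _. u)"
        by (simp add: max_tensor_def S_def)
    qed
    also have "s u = (\<Sum>x\<in>{..<k} \<times> {..<m}. \<Sum>y\<in>{..<k} \<times> {..<m}.
        (\<alpha> x * cnj (\<alpha> y)) * s (tens (P (fst x) (fst y)) (Q (snd x) (snd y))))"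
      unfolding u_def
      by (simp add: lin_sum complex_vector.subspace_sum[OF sub] tc scale t)
    also have "\<dots> = form ({..<k} \<times> {..<m}) (\<lambda>i j. (\<lambda>(z, w) (z', w'). state_matrix s z z' w w') (map_prod e f i) (map_prod e f j))
        (\<zeta> \<circ> map_prod e f) (\<zeta> \<circ> map_prod e f)"
      unfolding form_def by (intro sum.cong refl) (auto simp: \<alpha>_def P_def Q_def state_matrix_def)
    also have "\<dots> = form UNIV (\<lambda>(z, w) (z', w'). state_matrix s z z' w w') \<zeta> \<zeta>"
      unfolding form_def by (simp add: sum.reindex_bij_betw[OF ef, symmetric])
    finally show "0 \<le> form UNIV (\<lambda>(z, w) (z', w'). state_matrix s z z' w w') \<zeta> \<zeta>" .
  qed
  show ?thesis
    unfolding bicorrelation_matrix_def using 1 2 3 4 by blast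
qed

section \<open>States from bicorrelation matrices\<close>

lemma combine_apply: "combine \<mu> D n n' = combine \<mu> (\<lambda>z z'. D z z' n n')"
  by (simp add: combine_def sum_fun_apply)

lemma combine_add: "combine (\<lambda>z z'. \<mu> z z' + \<nu> z z') D = combine \<mu> D + combine \<nu> D"
  by (simp add: combine_def scaleC_add_left sum.distrib)

lemma combine_scale: "combine (\<lambda>z z'. c * \<mu> z z') D = c *\<^sub>C combine \<mu> D"
  by (simp add: combine_def complex_vector.scale_sum_right)

lemma combine_sum: "combine (\<lambda>z z'. \<Sum>b\<in>B. \<mu> b z z') D = (\<Sum>b\<in>B. combine (\<mu> b) D)"
proof (induction B rule: infinite_finite_induct)
  case (insert b B)
  then show ?case by (simp only: sum.insert combine_add not_False_eq_True)
qed (simp_all add: combine_def)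

lemma combine_single: "combine (\<lambda>y y'. if y = z \<and> y' = z' then 1 else 0) D = D z z'"
proof -
  have "combine (\<lambda>y y'. if y = z \<and> y' = z' then 1 else 0) D
      = (\<Sum>y\<in>UNIV. \<Sum>y'\<in>UNIV. if y' = z' then if y = z then D z z' else 0 else 0)"
    unfolding combine_def by (intro sum.cong refl) auto
  then show ?thesis by simp
qed

lemma combine_add_right: "combine \<mu> (\<lambda>z z'. D z z' + E z z') = combine \<mu> D + combine \<mu> E"
  by (simp add: combine_def scaleC_add_right sum.distrib)

lemma combine_zero_right: "combine \<mu> (\<lambda>z z'. 0) = 0"
  by (simp add: combine_def)

lemma combine_sum_right: "combine \<mu> (\<lambda>z z'. \<Sum>a\<in>A. D a z z') = (\<Sum>a\<in>A. combine \<mu> (D a))"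
proof (induction A rule: infinite_finite_induct)
  case (insert a A)
  then show ?case by (simp only: sum.insert combine_add_right not_False_eq_True)
qed (simp_all add: combine_zero_right)

text \<open>A combination of generators that equals \<open>0\<close> is positive together with its negative. Both positivities pass
  to the combination of the blocks of \<open>D\<close>, which is therefore zero.\<close>

lemma T_system_relation:
  fixes D :: "'x::finite \<times> 'x \<Rightarrow> 'x \<times> 'x \<Rightarrow> 'n \<Rightarrow> 'n \<Rightarrow> complex"
  assumes inf: "infinite (UNIV :: 'k set)" and N: "finite N" "n \<in> N" "n' \<in> N"
    and psd: "psd_on (UNIV \<times> N) (\<lambda>(z, n) (z', n'). D z z' n n')" and bis: "bistochastic D c"
    and rel: "combine \<mu> gens = (0 :: ('x, 'k) univ_op)"
  shows "combine \<mu> D n n' = 0"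
proof -
  have pos: "os_pos T_system 1 (\<lambda>_ _. 0 :: ('x, 'k) univ_op)"
    unfolding os_pos_T_system
  proof (intro conjI allI impI)
    show "(0 :: ('x, 'k) univ_op) \<in> os_space T_system"
      by (rule complex_vector.subspace_0[OF subspace_T_system])
    show "(0 :: ('x, 'k) univ_op) \<in> C_alg"
      by (rule zero_in_C_alg)
  qed (simp add: ell2_inner_def)
  have psd_rel: "psd_on ({..<1::nat} \<times> N) (\<lambda>(p, n) (p', n'). combine \<nu> D n n')"
    if "combine \<nu> gens = (0 :: ('x, 'k) univ_op)" for \<nu>
    by (rule T_system_pos_pairing[where \<mu> = "\<lambda>_ _. \<nu>", OF inf N(1) psd bis pos]) (rule that[symmetric])
  have neg: "combine (\<lambda>z z'. - 1 * \<mu> z z') D n n' = - combine \<mu> D n n'"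
    for D :: "'x \<times> 'x \<Rightarrow> 'x \<times> 'x \<Rightarrow> 'n \<Rightarrow> 'n \<Rightarrow> complex" and n n'
    unfolding combine_scale by simp
  have "combine (\<lambda>z z'. - 1 * \<mu> z z') gens = (0 :: ('x, 'k) univ_op)"
    unfolding combine_scale rel by simp
  from psd_rel[OF this]
  have "psd_on ({..<1::nat} \<times> N) (\<lambda>i j. - (case i of (p, n) \<Rightarrow> \<lambda>(p', n'). combine \<mu> D n n') j)"
    unfolding neg by (simp add: case_prod_unfold)
  from psd_and_uminus_psd_imp_zero[OF _ psd_rel[OF rel] this, of "(0, n)" "(0, n')"]
  show ?thesis using N by simp
qed

text \<open>\<open>B\<close> indexes a basis that consists of generators, and \<open>f\<close> gives the coordinates in it. The functionals are
  extended to all operators because elementary tensors are evaluated on such functionals.\<close>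

lemma gens_coordinates:
  "\<exists>(B :: (('x::finite \<times> 'x) \<times> ('x \<times> 'x)) set)
    (f :: ('x \<times> 'x) \<times> ('x \<times> 'x) \<Rightarrow> ('x, 'k) univ_op \<Rightarrow> complex).
    (\<forall>b. clinear (f b)) \<and>
    (\<forall>z z'. (gens z z' :: ('x, 'k) univ_op) = (\<Sum>b\<in>B. f b (gens z z') *\<^sub>C gens (fst b) (snd b)))"
proof -
  define G where "G = (range (\<lambda>(z, z'). gens z z') :: ('x, 'k) univ_op set)"
  obtain B0 where B0: "B0 \<subseteq> G" "complex_vector.independent B0" "G \<subseteq> complex_vector.span B0"
    by (rule complex_vector.maximal_independent_subset)
  have fin: "finite B0" using B0(1) by (rule finite_subset) (simp add: G_def)
  interpret vector_space_pair "scaleC :: complex \<Rightarrow> ('x, 'k) univ_op \<Rightarrow> _" "scaleC :: complex \<Rightarrow> complex \<Rightarrow> _" ..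
  define g where "g v = construct B0 (\<lambda>v'. if v' = v then 1 else 0 :: complex)" for v
  have lin: "clinear (g v)" for v
    unfolding g_def by (rule linear_construct[OF B0(2)])
  have add: "g v (u + w) = g v u + g v w" and scale: "g v (c *\<^sub>C u) = c * g v u" and zero: "g v 0 = 0" for v u w c
    using linear_add[OF lin] linear_scale[OF lin] linear_0[OF lin] by simp_all
  have coord: "u = (\<Sum>v\<in>B0. g v u *\<^sub>C v)" if "u \<in> complex_vector.span B0" for u
    using that
  proof (induction rule: complex_vector.span_induct_alt)
    case base
    show ?case by (simp only: zero complex_vector.scale_zero_left sum.neutral_const)
  next
    case (step c x y)
    have "(\<Sum>v\<in>B0. g v x *\<^sub>C v) = (\<Sum>v\<in>B0. if v = x then x else 0)"
      by (intro sum.cong refl) (auto simp: g_def construct_basis[OF B0(2) step(1)])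
    then have x: "(\<Sum>v\<in>B0. g v x *\<^sub>C v) = x" using step(1) fin by simp
    have "(\<Sum>v\<in>B0. g v (c *\<^sub>C x + y) *\<^sub>C v) = (\<Sum>v\<in>B0. c *\<^sub>C (g v x *\<^sub>C v) + g v y *\<^sub>C v)"
      by (simp only: add scale complex_vector.scale_left_distrib complex_vector.scale_scale)
    also have "\<dots> = c *\<^sub>C (\<Sum>v\<in>B0. g v x *\<^sub>C v) + (\<Sum>v\<in>B0. g v y *\<^sub>C v)"
      by (simp only: sum.distrib complex_vector.scale_sum_right)
    also have "\<dots> = c *\<^sub>C x + y"
      by (rule arg_cong2[where f = "(+)", OF arg_cong[where f = "(*\<^sub>C) c", OF x] step(2)[symmetric]])
    finally show ?case by (rule sym)
  qed
  define ix where "ix v = (SOME b. (case b of (z, z') \<Rightarrow> gens z z') = v)" for v :: "('x, 'k) univ_op"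
  have ix: "gens (fst (ix v)) (snd (ix v)) = v" if "v \<in> B0" for v
  proof -
    from subsetD[OF B0(1) that] have "\<exists>b. (case b of (z, z') \<Rightarrow> gens z z') = v"
      unfolding G_def by (elim imageE) (intro exI, rule sym)
    then have "(case ix v of (z, z') \<Rightarrow> gens z z') = v" unfolding ix_def by (rule someI_ex)
    then show ?thesis by (simp add: case_prod_unfold)
  qed
  have inj: "inj_on ix B0"
    by (rule inj_on_inverseI[where g = "\<lambda>b. gens (fst b) (snd b)"]) (rule ix)
  define f where "f b = g (gens (fst b) (snd b))" for b
  have "(gens z z' :: ('x, 'k) univ_op) = (\<Sum>b\<in>ix ` B0. f b (gens z z') *\<^sub>C gens (fst b) (snd b))" for z z'
  proof -
    have "(gens z z' :: ('x, 'k) univ_op) \<in> complex_vector.span B0" using B0(3) by (auto simp: G_def)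
    from coord[OF this]
    have "(gens z z' :: ('x, 'k) univ_op) = (\<Sum>v\<in>B0. g v (gens z z') *\<^sub>C v)" .
    also have "\<dots> = (\<Sum>b\<in>ix ` B0. f b (gens z z') *\<^sub>C gens (fst b) (snd b))"
      unfolding sum.reindex[OF inj] by (intro sum.cong refl) (simp add: f_def ix)
    finally show ?thesis .
  qed
  moreover have "clinear (f b)" for b unfolding f_def by (rule lin)
  ultimately show ?thesis
    by (intro exI[of _ "ix ` B0"] exI[of _ f] conjI allI)
qed

text \<open>The expansion of a generator in the basis is a linear relation.\<close>

lemma coordinates_respected:
  fixes D :: "'x::finite \<times> 'x \<Rightarrow> 'x \<times> 'x \<Rightarrow> 'n::finite \<Rightarrow> 'n \<Rightarrow> complex"
    and f :: "('x \<times> 'x) \<times> ('x \<times> 'x) \<Rightarrow> ('x, 'k) univ_op \<Rightarrow> complex"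
  assumes inf: "infinite (UNIV :: 'k set)"
    and psd: "psd_on UNIV (\<lambda>(z, n) (z', n'). D z z' n n')" and bis: "bistochastic D c"
    and coord: "(gens z z' :: ('x, 'k) univ_op) = (\<Sum>b\<in>B. f b (gens z z') *\<^sub>C gens (fst b) (snd b))"
  shows "D z z' n n' = (\<Sum>b\<in>B. f b (gens z z') * D (fst b) (snd b) n n')"
proof -
  define \<mu> where "\<mu> y y' = (if y = z \<and> y' = z' then 1 else 0) +
    - 1 * (\<Sum>b\<in>B. f b (gens z z') * (if y = fst b \<and> y' = snd b then 1 else 0))" for y y'
  have \<mu>: "combine \<mu> E = E z z' + - 1 *\<^sub>C (\<Sum>b\<in>B. f b (gens z z') *\<^sub>C E (fst b) (snd b))"
    for E :: "'x \<times> 'x \<Rightarrow> 'x \<times> 'x \<Rightarrow> 'c::complex_vector"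
    unfolding \<mu>_def combine_add combine_scale combine_sum combine_single ..
  have "combine \<mu> gens = (0 :: ('x, 'k) univ_op)"
    unfolding \<mu> by simp (rule coord)
  then have "combine \<mu> D n n' = 0"
    using T_system_relation[OF inf, of UNIV n n' D c \<mu>] psd bis by simp
  then show ?thesis unfolding \<mu> by (simp add: sum_fun_apply)
qed

lemma psd_on_UNIV_swap:
  assumes "psd_on UNIV (\<lambda>(z, w) (z', w'). R z z' w w')"
  shows "psd_on UNIV (\<lambda>(w, z) (w', z'). R z z' w w')"
proof -
  have "bij (prod.swap :: 'a \<times> 'b \<Rightarrow> 'b \<times> 'a)"
    by (rule bij_betw_byWitness[where f' = prod.swap]) auto
  from psd_on_reindex[OF this, of "\<lambda>(w, z) (w', z'). R z z' w w'"] show ?thesis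
    using assms by (simp add: case_prod_unfold)
qed

lemma tens_combine_left: "tens (combine \<mu> D) w = combine \<mu> (\<lambda>z z'. tens (D z z') w)"
  unfolding combine_def tens_sum_left tens_scale_left ..

lemma tens_combine_right: "tens u (combine \<nu> E) = combine \<nu> (\<lambda>w w'. tens u (E w w'))"
  unfolding combine_def tens_sum_right tens_scale_right ..

lemma tens_combine:
  "tens (combine \<mu> D) (combine \<nu> E) = combine \<mu> (\<lambda>z z'. combine \<nu> (\<lambda>w w'. tens (D z z') (E w w')))"
  unfolding tens_combine_left unfolding tens_combine_right ..

lemma os_pos_combination:
  fixes P :: "nat \<Rightarrow> nat \<Rightarrow> ('x::finite, 'k) univ_op"
  assumes "os_pos T_system k P"
  shows "\<exists>\<mu>. \<forall>p<k. \<forall>p'<k. P p p' = combine (\<mu> p p') gens"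
proof (intro exI allI impI)
  fix p p' assume "p < k" "p' < k"
  then have "P p p' \<in> os_space T_system" using assms unfolding os_pos_T_system by simp
  from someI_ex[OF span_gens[OF this[unfolded T_system_simps]]]
  show "P p p' = combine ((\<lambda>p p'. SOME \<mu>. P p p' = combine \<mu> gens) p p') gens" .
qed

text \<open>The functional \<open>s\<close> prescribes the values of \<open>R\<close> on the tensor products of basis elements; the relations satisfied
by \<open>R\<close> give the remaining values on generators. Positivity on \<open>P \<otimes> Q\<close> is obtained one leg at a time: \<open>Q\<close> turns \<open>R\<close>
into a block matrix \<open>D\<close> that is still positive and bistochastic in the first leg, and \<open>P\<close> turns \<open>D\<close> into a positive
scalar matrix.\<close>

theorem bicorrelation_state:
  fixes R :: "'x::finite \<times> 'x \<Rightarrow> 'x \<times> 'x \<Rightarrow> 'y::finite \<times> 'y \<Rightarrow> 'y \<times> 'y \<Rightarrow> complex"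
  assumes inf: "infinite (UNIV :: 'k set)" and R: "bicorrelation_matrix R"
  shows "\<exists>s :: (('x, 'k) univ_op, ('y, 'k) univ_op) tensor \<Rightarrow> complex.
    state (max_tensor T_system T_system) s \<and> state_matrix s = R"
proof -
  obtain c d where psd: "psd_on UNIV (\<lambda>(z, w) (z', w'). R z z' w w')"
    and c: "bistochastic R c" and d: "bistochastic (\<lambda>w w' z z'. R z z' w w') d"
    and norm: "\<And>x y. (\<Sum>a\<in>UNIV. \<Sum>b\<in>UNIV. R (x, a) (x, a) (y, b) (y, b)) = 1"
    using R unfolding bicorrelation_matrix_def by blast
  note psd' = psd_on_UNIV_swap[OF psd]
  obtain B and f :: "('x \<times> 'x) \<times> ('x \<times> 'x) \<Rightarrow> ('x, 'k) univ_op \<Rightarrow> complex"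
    where f: "\<forall>b. clinear (f b)"
    and fB: "\<forall>z z'. (gens z z' :: ('x, 'k) univ_op) = (\<Sum>b\<in>B. f b (gens z z') *\<^sub>C gens (fst b) (snd b))"
    using gens_coordinates by (elim exE conjE) (rule that)
  obtain B' and g :: "('y \<times> 'y) \<times> ('y \<times> 'y) \<Rightarrow> ('y, 'k) univ_op \<Rightarrow> complex"
    where g: "\<forall>b. clinear (g b)"
    and gB: "\<forall>w w'. (gens w w' :: ('y, 'k) univ_op) = (\<Sum>b\<in>B'. g b (gens w w') *\<^sub>C gens (fst b) (snd b))"
    using gens_coordinates by (elim exE conjE) (rule that)
  define s :: "(('x, 'k) univ_op, ('y, 'k) univ_op) tensor \<Rightarrow> complex"
    where "s \<tau> = (\<Sum>b\<in>B. \<Sum>b'\<in>B'. R (fst b) (snd b) (fst b') (snd b') * \<tau> (f b, g b'))" for \<tau>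
  have s_add: "s (\<tau> + \<tau>') = s \<tau> + s \<tau>'" and s_scale: "s (r *\<^sub>C \<tau>) = r * s \<tau>" for \<tau> \<tau>' r
    by (simp_all add: s_def algebra_simps sum.distrib sum_distrib_left)
  have s_zero: "s 0 = 0" by (simp add: s_def)
  have s_sum: "s (\<Sum>k\<in>K. \<tau> k) = (\<Sum>k\<in>K. s (\<tau> k))" for K and \<tau> :: "'i \<Rightarrow> _"
    by (induction K rule: infinite_finite_induct)
      (simp_all only: sum.infinite sum.empty sum.insert s_zero s_add not_False_eq_True)
  have s_combine: "s (combine \<mu> D) = combine \<mu> (\<lambda>z z'. s (D z z'))" for \<mu> :: "'z::finite \<Rightarrow> 'z \<Rightarrow> complex" and D
    by (simp add: combine_def s_sum s_scale)
  have s_gens: "s (tens (gens z z') (gens w w')) = R z z' w w'" for z z' w w'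
  proof -
    have "R z z' w w' = (\<Sum>b\<in>B. f b (gens z z') * R (fst b) (snd b) w w')"
      by (rule coordinates_respected[where D = R and f = f and B = B, OF inf psd c fB[rule_format]])
    also have "\<dots> = (\<Sum>b\<in>B. f b (gens z z') * (\<Sum>b'\<in>B'. g b' (gens w w') * R (fst b) (snd b) (fst b') (snd b')))"
      by (intro sum.cong refl arg_cong2[where f = "(*)"])
        (rule coordinates_respected[where D = "\<lambda>w w' z z'. R z z' w w'" and f = g and B = B', OF inf psd' d gB[rule_format]])
    also have "\<dots> = s (tens (gens z z') (gens w w'))"
      by (simp add: s_def tens_def f g sum_distrib_left mult_ac)
    finally show ?thesis ..
  qed
  have s_pos: "0 \<le> s u" if u: "max_precone T_system T_system 1 (\<lambda>_ _. u)" for u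
  proof -
    from u obtain k m and P :: "nat \<Rightarrow> nat \<Rightarrow> ('x, 'k) univ_op" and Q :: "nat \<Rightarrow> nat \<Rightarrow> ('y, 'k) univ_op"
      and \<alpha> :: "nat \<Rightarrow> nat \<times> nat \<Rightarrow> complex"
      where P: "os_pos T_system k P" and Q: "os_pos T_system m Q"
      and u_eq: "\<forall>i<1. \<forall>j<1. u = (\<Sum>(p, q)\<in>{..<k} \<times> {..<m}. \<Sum>(p', q')\<in>{..<k} \<times> {..<m}.
          (\<alpha> i (p, q) * cnj (\<alpha> j (p', q'))) *\<^sub>C tens (P p p') (Q q q'))"
      unfolding max_precone_def by (elim exE conjE) (rule that)
    obtain \<mu> where \<mu>: "\<forall>p<k. \<forall>p'<k. P p p' = combine (\<mu> p p') gens"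
      using os_pos_combination[OF P] by (elim exE) (rule that)
    obtain \<nu> where \<nu>: "\<forall>q<m. \<forall>q'<m. Q q q' = combine (\<nu> q q') gens"
      using os_pos_combination[OF Q] by (elim exE) (rule that)
    \<comment> \<open>The generators of the second leg are replaced by the blocks of \<open>R\<close>.\<close>
    define D where "D z z' q q' = combine (\<nu> q q') (R z z')" for z z' q q'
    have "psd_on ({..<m} \<times> UNIV) (\<lambda>(q, z) (q', z'). combine (\<nu> q q') (\<lambda>w w' z z'. R z z' w w') z z')"
      by (rule T_system_pos_pairing[OF inf finite _ d Q \<nu>[rule_format]]) (use psd' in simp_all)
    then have "psd_on ({..<m} \<times> UNIV) (\<lambda>(q, z) (q', z'). D z z' q q')"
      by (simp add: D_def combine_apply)
    moreover have "bij_betw prod.swap (UNIV \<times> {..<m}) ({..<m} \<times> (UNIV :: ('x \<times> 'x) set))"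
      by (rule bij_betw_byWitness[where f' = prod.swap]) auto
    ultimately have D_psd: "psd_on (UNIV \<times> {..<m}) (\<lambda>(z, q) (z', q'). D z z' q q')"
      using psd_on_reindex[of prod.swap "UNIV \<times> {..<m}" "{..<m} \<times> UNIV" "\<lambda>(q, z) (q', z'). D z z' q q'"]
      by (simp add: case_prod_unfold)
    have D_bis: "bistochastic D (\<lambda>q q'. combine (\<nu> q q') c)"
    proof -
      have "(\<Sum>a\<in>UNIV. D (x, a) (x', a) q q') = (if x = x' then combine (\<nu> q q') c else 0)"
        and "(\<Sum>x\<in>UNIV. D (x, a) (x, a') q q') = (if a = a' then combine (\<nu> q q') c else 0)" for x x' a a' q q'
        unfolding D_def combine_sum_right[symmetric] bistochastic_apply[OF c] by (auto simp: combine_zero_right)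
      then show ?thesis unfolding bistochastic_def by (auto simp: fun_eq_iff sum_fun_apply)
    qed
    \<comment> \<open>The scalar matrix \<open>(s (P\<^sub>p\<^sub>p\<^sub>' \<otimes> Q\<^sub>q\<^sub>q\<^sub>'))\<close>.\<close>
    have M: "psd_on ({..<k} \<times> {..<m}) (\<lambda>(p, q) (p', q'). combine (\<mu> p p') D q q')"
      by (rule T_system_pos_pairing[OF inf finite_lessThan D_psd D_bis P \<mu>[rule_format]])
    have sM: "s (tens (P p p') (Q q q')) = combine (\<mu> p p') D q q'"
      if "p < k" "p' < k" "q < m" "q' < m" for p p' q q'
      unfolding \<mu>[rule_format, OF that(1,2)] \<nu>[rule_format, OF that(3,4)] tens_combine s_combine s_gens combine_apply[of _ D] D_def ..
    have "u = (\<Sum>x\<in>{..<k} \<times> {..<m}. \<Sum>y\<in>{..<k} \<times> {..<m}.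
        (\<alpha> 0 x * cnj (\<alpha> 0 y)) *\<^sub>C tens (P (fst x) (fst y)) (Q (snd x) (snd y)))"
      using u_eq[rule_format, of 0 0] by (simp add: case_prod_unfold)
    then have "s u = (\<Sum>x\<in>{..<k} \<times> {..<m}. \<Sum>y\<in>{..<k} \<times> {..<m}.
        (\<alpha> 0 x * cnj (\<alpha> 0 y)) * s (tens (P (fst x) (fst y)) (Q (snd x) (snd y))))"
      by (simp only: s_sum s_scale)
    also have "\<dots> = form ({..<k} \<times> {..<m}) (\<lambda>(p, q) (p', q'). combine (\<mu> p p') D q q')
        (\<lambda>x. cnj (\<alpha> 0 x)) (\<lambda>x. cnj (\<alpha> 0 x))"
      unfolding form_def by (intro sum.cong refl) (auto simp: sM)
    finally show ?thesis using M by (simp add: psd_on_def)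
  qed
  have s_unit: "s (tens (id_op univ_dom) (id_op univ_dom)) = 1"
    unfolding sum_gens_diagonal[of undefined, symmetric] tens_sum_left
    unfolding tens_sum_right s_sum s_gens by (rule norm)
  have "state (max_tensor T_system T_system) s"
    unfolding state_def
  proof (intro conjI allI impI)
    show "linear_functional_on (os_space (max_tensor T_system T_system)) s"
      by (simp add: linear_functional_on_def s_add s_scale)
    show "s (os_unit (max_tensor T_system T_system)) = 1"
      by (simp add: max_tensor_def T_system_simps s_unit)
    fix u
    assume "os_pos (max_tensor (T_system :: ('x, 'k) univ_op operator_system)
      (T_system :: ('y, 'k) univ_op operator_system)) 1 (\<lambda>_ _. u)"
    then have *: "max_precone T_system T_system 1 (\<lambda>i j. (if i = j then complex_of_real r *\<^sub>C
        tens (os_unit (T_system :: ('x, 'k) univ_op operator_system))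
          (os_unit (T_system :: ('y, 'k) univ_op operator_system)) else 0) + u)" if "r > 0" for r
      using that by (simp add: max_tensor_def)
    show "0 \<le> s u"
    proof (rule nonneg_Archimedean)
      fix r :: real assume "r > 0"
      from *[OF this] have "max_precone T_system T_system 1 (\<lambda>_ _. complex_of_real r *\<^sub>C
        tens (id_op univ_dom :: ('x, 'k) univ_op) (id_op univ_dom :: ('y, 'k) univ_op) + u)"
        unfolding max_precone_def by (simp add: T_system_simps)
      from s_pos[OF this] show "0 \<le> complex_of_real r + s u"
        by (simp only: s_add s_scale s_unit mult_1_right)
    qed
  qed
  moreover have "state_matrix s = R"
    by (auto simp: fun_eq_iff state_matrix_def s_gens)
  ultimately show ?thesis by blast
qed

section \<open>The correspondence\<close>

definition ungroup :: "('x \<times> 'a \<Rightarrow> 'x \<times> 'a \<Rightarrow> 'y \<times> 'b \<Rightarrow> 'y \<times> 'b \<Rightarrow> complex) \<Rightarrow>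
    ('x \<times> 'y) \<times> ('a \<times> 'b) \<Rightarrow> ('x \<times> 'y) \<times> ('a \<times> 'b) \<Rightarrow> complex"
  where "ungroup R = (\<lambda>((x, y), (a, b)) ((x', y'), (a', b')). R (x, a) (x', a') (y, b) (y', b'))"

lemma regroup_ungroup: "regroup (ungroup R) = R"
  and ungroup_regroup: "ungroup (regroup K) = K"
  by (auto simp: regroup_def ungroup_def fun_eq_iff)

lemma Gamma_of_eq_choi_map: "Gamma_of s = choi_map (ungroup (state_matrix s))"
proof
  fix \<rho> :: "('a \<times> 'b) cmat"
  have nth: "(\<Sum>a\<in>UNIV. \<Sum>a'\<in>UNIV. \<Sum>b\<in>UNIV. \<Sum>b'\<in>UNIV. h a a' b b' *
      kron (matrix_unit a a') (matrix_unit b b') $ (i, j) $ (i', j')) = h i i' j j'" for h :: "'a \<Rightarrow> 'a \<Rightarrow> 'b \<Rightarrow> 'b \<Rightarrow> complex" and i i' j j'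
  proof -
    have "(\<Sum>a\<in>UNIV. \<Sum>a'\<in>UNIV. \<Sum>b\<in>UNIV. \<Sum>b'\<in>UNIV. h a a' b b' *
        kron (matrix_unit a a') (matrix_unit b b') $ (i, j) $ (i', j')) = (\<Sum>a\<in>UNIV. \<Sum>a'\<in>UNIV. matrix_unit i i' $ a $ a' *
          (\<Sum>b\<in>UNIV. \<Sum>b'\<in>UNIV. matrix_unit j j' $ b $ b' * h a a' b b'))"
      unfolding sum_distrib_left
      by (intro sum.cong refl) (auto simp: kron_nth matrix_unit_nth)
    then show ?thesis unfolding sum_matrix_unit .
  qed
  have "Gamma_of s \<rho> $ (a, b) $ (a', b') = choi_map (ungroup (state_matrix s)) \<rho> $ (a, b) $ (a', b')" for a b a' b'
  proof -
    let ?t = "\<lambda>x x' y y'. \<rho> $ (x, y) $ (x', y') * s (tens (gen x x' a a') (gen y y' b b'))"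
    have "Gamma_of s \<rho> $ (a, b) $ (a', b') = (\<Sum>x\<in>UNIV. \<Sum>x'\<in>UNIV. \<Sum>y\<in>UNIV. \<Sum>y'\<in>UNIV. ?t x x' y y')"
      unfolding Gamma_of_def sum_component scaleC_vec_nth scaleC_complex nth ..
    also have "\<dots> = (\<Sum>x\<in>UNIV. \<Sum>y\<in>UNIV. \<Sum>x'\<in>UNIV. \<Sum>y'\<in>UNIV. ?t x x' y y')"
      by (intro sum.cong refl sum.swap)
    also have "\<dots> = choi_map (ungroup (state_matrix s)) \<rho> $ (a, b) $ (a', b')"
      by (simp add: choi_map_nth sum_UNIV_prod ungroup_def state_matrix_def gens_def)
    finally show ?thesis .
  qed
  then show "Gamma_of s \<rho> = choi_map (ungroup (state_matrix s)) \<rho>"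
    by (simp add: vec_eq_iff)
qed

theorem theorem5p4:
  fixes \<Gamma> :: "('x::finite \<times> 'y::finite) cmat \<Rightarrow> ('x \<times> 'y) cmat"
  assumes "infinite (UNIV :: 'k set)"
    and "clinear \<Gamma>"
  shows "QNS_bicorrelation \<Gamma> \<longleftrightarrow>
    (\<exists>s :: (('x, 'k) univ_op, ('y, 'k) univ_op) tensor \<Rightarrow> complex.
       state (max_tensor T_system T_system) s \<and> \<Gamma> = Gamma_of s)"
proof
  define R where "R = regroup (choi_matrix \<Gamma>)"
  have \<Gamma>: "\<Gamma> = choi_map (choi_matrix \<Gamma>)"
    by (rule choi_map_choi_matrix[OF assms(2), symmetric])
  assume "QNS_bicorrelation \<Gamma>"
  then have "bicorrelation_matrix R"
    unfolding R_def QNS_bicorrelation_choi_map[symmetric] \<Gamma>[symmetric] .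
  from bicorrelation_state[OF assms(1) this]
  obtain s :: "(('x, 'k) univ_op, ('y, 'k) univ_op) tensor \<Rightarrow> complex"
    where s: "state (max_tensor T_system T_system) s" "state_matrix s = R"
    by blast
  have "Gamma_of s = \<Gamma>"
    unfolding Gamma_of_eq_choi_map s(2) R_def ungroup_regroup \<Gamma>[symmetric] ..
  then show "\<exists>s :: (('x, 'k) univ_op, ('y, 'k) univ_op) tensor \<Rightarrow> complex.
       state (max_tensor T_system T_system) s \<and> \<Gamma> = Gamma_of s"
    using s(1) by blast
next
  assume "\<exists>s :: (('x, 'k) univ_op, ('y, 'k) univ_op) tensor \<Rightarrow> complex.
       state (max_tensor T_system T_system) s \<and> \<Gamma> = Gamma_of s"
  then obtain s :: "(('x, 'k) univ_op, ('y, 'k) univ_op) tensor \<Rightarrow> complex"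
    where s: "state (max_tensor T_system T_system) s" and \<Gamma>: "\<Gamma> = Gamma_of s"
    by blast
  show "QNS_bicorrelation \<Gamma>"
    unfolding \<Gamma> Gamma_of_eq_choi_map QNS_bicorrelation_choi_map regroup_ungroup
    by (rule state_matrix_bicorrelation[OF s])
qed

end
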